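(* Let $N\in\mathbb{N}$ and let $\{S_n\}_{n=0}^\infty$ be a sequence of Hermitian complex $(N\times N)$ matrices such that the block Hankel matrices $\Gamma_n=(S_{k+l})_{k,l=0}^{n}$ satisfy $\Gamma_n\geq 0$ for all $n\in\mathbb{Z}_+$. Let the Hilbert space $H$, the sequence $\{x_n\}_{n=0}^\infty\subset H$ and the densely defined symmetric operator $A$ in $H$ be constructed from $\{S_n\}$ as described in the context, and let $\overline{A}$ be the closure of $A$. All solutions of the matrix Hamburger moment problem with data $\{S_n\}_{n=0}^\infty$ have the form $$M(x)=(m_{k,j}(x))_{k,j=0}^{N-1},$$ where the $m_{k,j}$ satisfy $$\int_{\mathbb{R}}\frac{1}{x-\lambda}\,dm_{k,j}(x)=\left((A_{F(\lambda)}-\lambda E_H)^{-1}x_k,x_j\right)_H,\qquad \lambda\in\mathbb{C}_+,\ 0\le k,j\le N-1,\qquad( * )$$ where $F(\lambda)$ is an operator-valued function analytic in $\mathbb{C}_+$ whose values are contractions ($\|F(\lambda)\|\le 1$) mapping $N_i(\overline{A})$ into $N_{-i}(\overline{A})$, and $A_{F(\lambda)}$ is the quasiself-adjoint extension of $\overline{A}$ defined by $F(\lambda)$. Conversely, to any operator-valued function $F(\lambda)$ analytic in $\mathbb{C}_+$ whose values are contractions ($\|F(\lambda)\|\le 1$) mapping $N_i(\overline{A})$ into $N_{-i}(\overline{A})$ there corresponds by relation $( * )$ a solution of the matrix Hamburger moment problem. Moreover, the correspondence between all operator-valued functions $F$ analytic in $\mathbb{C}_+$ whose values are contractions mapping $N_i(\overline{A})$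 into $N_{-i}(\overline{A})$ and all solutions of the moment problem, established by relation $( * )$, is one-to-one.
   Context: Notation: $\mathbb{Z}_+$ is the set of non-negative integers, $\mathbb{C}_+=\{z\in\mathbb{C}:\operatorname{Im}z>0\}$, $E_H$ is the identity operator on $H$; scalar products are linear in the first argument. Matrix Hamburger moment problem: given Hermitian $N\times N$ complex matrices $\{S_n\}_{n=0}^\infty$, find a left-continuous non-decreasing (with respect to the order of Hermitian matrices) matrix function $M(x)=(m_{k,l}(x))_{k,l=0}^{N-1}$ on $\mathbb{R}$ with $M(-\infty)=0$ such that $\int_{\mathbb{R}}x^n\,dM(x)=S_n$ for all $n\in\mathbb{Z}_+$. Such $M$ is called a solution. Construction of $H$, $x_n$, $A$: write $S_n=(s_n^{k,l})_{k,l=0}^{N-1}$ and let $\Gamma=(\Gamma_{n,m})_{n,m=0}^\infty$ be the infinite block matrix $(S_{k+l})_{k,l=0}^\infty$ viewed as a scalar matrix, i.e. $\Gamma_{rN+j,tN+n}=s_{r+t}^{j,n}$ for $0\le j,n\le N-1$, $r,t\in\mathbb{Z}_+$. Since all $\Gamma_n\ge 0$, there are a Hilbert space $H$ and a sequence $\{x_n\}_{n=0}^\infty$ in $H$ with $(x_n,x_m)_H=\Gamma_{n,m}$ for all $n,m\in\mathbb{Z}_+$ and whose closed linear span is $H$; fix such $H$ and $\{x_n\}$. Let $L$ be the linear span of $\{x_n\}_{n\in\mathbb{Z}_+}$. The operator $A$ with domain $D(A)=L$ is (well) defined by $A\sum_k\alpha_kx_k=\sum_k\alpha_kx_{k+N}$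 for finite sums, i.e. $Ax_k=x_{k+N}$, $k\in\mathbb{Z}_+$. It is a densely defined symmetric operator in $H$. Defect subspaces: for a closed symmetric operator $B$ in $H$ with dense domain $D(B)$, and $\lambda\in\mathbb{C}\setminus\mathbb{R}$, $N_\lambda(B)=H\ominus(B-\lambda E_H)D(B)$. Quasiself-adjoint extension: for a closed symmetric operator $B$ in $H$ with dense domain $D(B)$ and a bounded linear operator $C:N_i(B)\to N_{-i}(B)$, the quasiself-adjoint extension $B_C$ of $B$ defined by $C$ has domain $\{f+C\psi-\psi:\ f\in D(B),\ \psi\in N_i(B)\}$ and acts by $B_C(f+C\psi-\psi)=Bf+iC\psi+i\psi$. Here $A_{F(\lambda)}$ denotes $(\overline{A})_{F(\lambda)}$. *)

theory Defs
  imports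
    "HOL-Analysis.Analysis"
    "Jordan_Normal_Form.Schur_Decomposition"
begin

section \<open>Complex Hilbert spaces\<close>

class complex_inner = real_normed_vector +
  fixes scaleC :: "complex \<Rightarrow> 'a \<Rightarrow> 'a" (infixr "*\<^sub>C" 75)
    and cinner :: "'a \<Rightarrow> 'a \<Rightarrow> complex"
  assumes scaleC_add_right: "a *\<^sub>C (x + y) = a *\<^sub>C x + a *\<^sub>C y"
    and scaleC_add_left: "(a + b) *\<^sub>C x = a *\<^sub>C x + b *\<^sub>C x"
    and scaleC_scaleC: "a *\<^sub>C b *\<^sub>C x = (a * b) *\<^sub>C x"
    and scaleR_scaleC: "scaleR r x = of_real r *\<^sub>C x"
    and cinner_commute: "cinner x y = cnj (cinner y x)"
    and cinner_add_left: "cinner (x + y) z = cinner x z + cinner y z"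
    and cinner_scaleC_left: "cinner (a *\<^sub>C x) y = a * cinner x y"
    and cinner_self: "cinner x x = of_real ((norm x)\<^sup>2)"

class complex_hilbert = complex_inner + complete_space

instantiation complex :: complex_hilbert
begin

definition scaleC_complex :: "complex \<Rightarrow> complex \<Rightarrow> complex" where
  "scaleC_complex a x = a * x"

definition cinner_complex :: "complex \<Rightarrow> complex \<Rightarrow> complex" where
  "cinner_complex x y = x * cnj y"

instance
proof
  fix a b x y z :: complex and r :: real
  show "a *\<^sub>C (x + y) = a *\<^sub>C x + a *\<^sub>C y"
    by (simp add: scaleC_complex_def distrib_left)
  show "(a + b) *\<^sub>C x = a *\<^sub>C x + b *\<^sub>C x"
    by (simp add: scaleC_complex_def distrib_right)
  show "a *\<^sub>C b *\<^sub>C x = (a * b) *\<^sub>C x"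
    by (simp add: scaleC_complex_def mult.assoc)
  show "scaleR r x = of_real r *\<^sub>C x"
    by (simp add: scaleC_complex_def scaleR_conv_of_real)
  show "cinner x y = cnj (cinner y x)"
    by (simp add: cinner_complex_def mult.commute)
  show "cinner (x + y) z = cinner x z + cinner y z"
    by (simp add: cinner_complex_def distrib_right)
  show "cinner (a *\<^sub>C x) y = a * cinner x y"
    by (simp add: cinner_complex_def scaleC_complex_def mult.assoc)
  show "cinner x x = of_real ((norm x)\<^sup>2)"
    unfolding cinner_complex_def by (rule complex_norm_square [symmetric])
qed

end

lemma vector_space_scaleC: "vector_space (scaleC :: complex \<Rightarrow> 'a \<Rightarrow> 'a::complex_inner)"
proof
  show "1 *\<^sub>C x = x" for x :: 'a
    using scaleR_scaleC[of 1 x] by simp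
qed (rule scaleC_add_right scaleC_add_left scaleC_scaleC)+

definition ortho_compl :: "'h::complex_inner set \<Rightarrow> 'h set" where
  "ortho_compl V = {h. \<forall>v\<in>V. cinner h v = 0}"


section \<open>Unbounded operators as graphs\<close>

text \<open>A (not necessarily everywhere defined) linear operator is represented by its graph.
  Its domain is \<open>Domain\<close>, its range is \<open>Range\<close>, its inverse is the converse relation
  (an operator iff it is single-valued), and its closure is the topological closure of the graph
  in the product space.\<close>

type_synonym 'h graph = "('h \<times> 'h) set"

definition graph_apply :: "'h graph \<Rightarrow> 'h \<Rightarrow> 'h" where
  "graph_apply B f = (THE g. (f, g) \<in> B)"

definition minus_scalar :: "'h::complex_inner graph \<Rightarrow> complex \<Rightarrow> 'h graph" where
  "minus_scalar B z = {(f, g - z *\<^sub>C f) | f g. (f, g) \<in> B}"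

definition resolvent :: "'h::complex_inner graph \<Rightarrow> complex \<Rightarrow> 'h graph" where
  "resolvent B z = (minus_scalar B z)\<inverse>"

definition defect :: "complex \<Rightarrow> 'h::complex_inner graph \<Rightarrow> 'h set" where
  "defect z B = ortho_compl (Range (minus_scalar B z))"

definition quasi_sa_ext :: "'h::complex_inner graph \<Rightarrow> ('h \<Rightarrow> 'h) \<Rightarrow> 'h graph" where
  "quasi_sa_ext B C =
    {(f + C \<psi> - \<psi>, g + \<i> *\<^sub>C C \<psi> + \<i> *\<^sub>C \<psi>) | f g \<psi>. (f, g) \<in> B \<and> \<psi> \<in> defect \<i> B}"


section \<open>Analytic contraction-valued functions in the upper half-plane\<close>

definition upper_half_plane :: "complex set" where
  "upper_half_plane = {z. Im z > 0}"

definition contractions :: "'h::complex_inner set \<Rightarrow> 'h set \<Rightarrow> ('h \<Rightarrow> 'h) set" where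
  "contractions V W = {C \<in> V \<rightarrow>\<^sub>E W.
     (\<forall>\<phi>\<in>V. \<forall>\<psi>\<in>V. \<forall>a b. C (a *\<^sub>C \<phi> + b *\<^sub>C \<psi>) = a *\<^sub>C C \<phi> + b *\<^sub>C C \<psi>) \<and>
     (\<forall>\<psi>\<in>V. norm (C \<psi>) \<le> norm \<psi>)}"

text \<open>Complex differentiability in the operator norm of a function whose values are operators on
  the subspace \<open>V\<close>. The derivative \<open>G\<close> is only relevant on \<open>V\<close>, where it is automatically linear
  and bounded as a limit in operator norm of bounded linear operators.\<close>

definition operator_analytic_on ::
    "'h::complex_inner set \<Rightarrow> (complex \<Rightarrow> 'h \<Rightarrow> 'h) \<Rightarrow> complex set \<Rightarrow> bool" where
  "operator_analytic_on V F T \<longleftrightarrow>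
    (\<forall>z\<in>T. \<exists>G. \<forall>\<epsilon>>0. \<forall>\<^sub>F w in at z. \<forall>\<psi>\<in>V.
       norm (inverse (w - z) *\<^sub>C (F w \<psi> - F z \<psi>) - G \<psi>) \<le> \<epsilon> * norm \<psi>)"

text \<open>Functions are taken to be extensional (\<open>undefined\<close> off their domain), so that equality in
  the following set is equality on the upper half-plane and on \<open>V\<close>.\<close>

definition contractive_analytic ::
    "'h::complex_inner set \<Rightarrow> 'h set \<Rightarrow> (complex \<Rightarrow> 'h \<Rightarrow> 'h) set" where
  "contractive_analytic V W =
    {F \<in> upper_half_plane \<rightarrow>\<^sub>E contractions V W. operator_analytic_on V F upper_half_plane}"


section \<open>Stieltjes integrals\<close>

text \<open>The library's \<open>interval_measure\<close> expects a right-continuous function; the reflection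
  turns a left-continuous \<open>g\<close> into a right-continuous one. See the lemma below.\<close>

definition stieltjes_measure :: "(real \<Rightarrow> real) \<Rightarrow> real measure" where
  "stieltjes_measure g = distr (interval_measure (\<lambda>t. - g (- t))) borel uminus"

lemma emeasure_stieltjes_measure:
  assumes "mono g" and "\<And>t. continuous (at_left t) g" and "a \<le> b"
  shows "emeasure (stieltjes_measure g) {a..<b} = ennreal (g b - g a)"
proof -
  have cont: "continuous (at_right t) (\<lambda>t. - g (- t))" for t
  proof -
    have "(g \<longlongrightarrow> g (- t)) (at_left (- t))"
      using assms(2)[of "- t"] by (simp add: continuous_within)
    then have "((\<lambda>s. g (- s)) \<longlongrightarrow> g (- t)) (at_right t)"
      by (simp add: at_left_minus filterlim_filtermap)
    then show ?thesis
      by (auto simp: continuous_within intro!: tendsto_minus)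
  qed
  have "emeasure (stieltjes_measure g) {a..<b} =
      emeasure (interval_measure (\<lambda>t. - g (- t))) (uminus -` {a..<b})"
    unfolding stieltjes_measure_def by (subst emeasure_distr) auto
  also have "uminus -` {a..<b} = {- b <.. - a}"
    by auto
  also have "emeasure (interval_measure (\<lambda>t. - g (- t))) {- b <.. - a} = ennreal (g b - g a)"
    using emeasure_interval_measure_Ioc[of "- b" "- a" "\<lambda>t. - g (- t)"] assms(1,3) cont
    by (auto simp: mono_def)
  finally show ?thesis .
qed

text \<open>The Lebesgue-Stieltjes integral of \<open>f\<close> with respect to a complex function \<open>m\<close> of locally
  bounded variation, through a Jordan decomposition of the real and imaginary parts. The value
  does not depend on the decomposition: if \<open>g1 - g2 = g1' - g2'\<close>, then the measures of
  \<open>g1 + g2'\<close> and \<open>g1' + g2\<close> agree.\<close>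

definition has_stieltjes_integral ::
    "(real \<Rightarrow> complex) \<Rightarrow> (real \<Rightarrow> complex) \<Rightarrow> complex \<Rightarrow> bool" where
  "has_stieltjes_integral f m I \<longleftrightarrow>
    (\<exists>g1 g2 g3 g4 :: real \<Rightarrow> real.
       (\<forall>g\<in>{g1, g2, g3, g4}. mono g \<and> (\<forall>t. continuous (at_left t) g) \<and>
          integrable (stieltjes_measure g) f) \<and>
       (\<forall>t. m t = Complex (g1 t - g2 t) (g3 t - g4 t)) \<and>
       I = ((LINT t|stieltjes_measure g1. f t) - (LINT t|stieltjes_measure g2. f t))
         + \<i> * ((LINT t|stieltjes_measure g3. f t) - (LINT t|stieltjes_measure g4. f t)))"


section \<open>The matrix Hamburger moment problem\<close>

definition hermitian_mat :: "complex mat \<Rightarrow> bool" where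
  "hermitian_mat A \<longleftrightarrow> mat_adjoint A = A"

text \<open>The order on type \<open>complex\<close> is that of \<open>Complex_Order\<close>: \<open>0 \<le> z\<close> says that \<open>z\<close> is
  real and nonnegative.\<close>

definition psd_mat :: "nat \<Rightarrow> complex mat \<Rightarrow> bool" where
  "psd_mat d A \<longleftrightarrow> A \<in> carrier_mat d d \<and> hermitian_mat A \<and>
     (\<forall>v\<in>carrier_vec d. 0 \<le> (A *\<^sub>v v) \<bullet>c v)"

definition hankel_entry :: "nat \<Rightarrow> (nat \<Rightarrow> complex mat) \<Rightarrow> nat \<Rightarrow> nat \<Rightarrow> complex" where
  "hankel_entry N S n m = S (n div N + m div N) $$ (n mod N, m mod N)"

definition block_hankel :: "nat \<Rightarrow> (nat \<Rightarrow> complex mat) \<Rightarrow> nat \<Rightarrow> complex mat" where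
  "block_hankel N S n =
    mat ((n + 1) * N) ((n + 1) * N) (\<lambda>(i, j). hankel_entry N S i j)"

definition hamburger_solution ::
    "nat \<Rightarrow> (nat \<Rightarrow> complex mat) \<Rightarrow> (real \<Rightarrow> complex mat) \<Rightarrow> bool" where
  "hamburger_solution N S M \<longleftrightarrow>
     (\<forall>t. M t \<in> carrier_mat N N \<and> hermitian_mat (M t)) \<and>
     (\<forall>s t. s \<le> t \<longrightarrow> psd_mat N (M t - M s)) \<and>
     (\<forall>k<N. \<forall>j<N.
        (\<forall>t. continuous (at_left t) (\<lambda>s. M s $$ (k, j))) \<and>
        ((\<lambda>t. M t $$ (k, j)) \<longlongrightarrow> 0) at_bot \<and>
        (\<forall>n. has_stieltjes_integral (\<lambda>t. of_real (t ^ n)) (\<lambda>t. M t $$ (k, j)) (S n $$ (k, j))))"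

definition shift_operator :: "nat \<Rightarrow> (nat \<Rightarrow> 'h::complex_inner) \<Rightarrow> 'h graph" where
  "shift_operator N x =
    {(\<Sum>k<n. \<alpha> k *\<^sub>C x k, \<Sum>k<n. \<alpha> k *\<^sub>C x (k + N)) | (n::nat) \<alpha>. True}"

definition parameters :: "nat \<Rightarrow> (nat \<Rightarrow> 'h::complex_inner) \<Rightarrow> (complex \<Rightarrow> 'h \<Rightarrow> 'h) set" where
  "parameters N x = contractive_analytic
     (defect \<i> (closure (shift_operator N x))) (defect (- \<i>) (closure (shift_operator N x)))"

text \<open>The first two conjuncts inside the quantifiers say that the right-hand side of the relation
  \<open>\<integral> 1/(t - z) dm\<^sub>k\<^sub>j(t) = ((A\<^sub>F\<^sub>(\<^sub>z\<^sub>) - z)\<^sup>-\<^sup>1 x\<^sub>k, x\<^sub>j)\<close> makes sense: the inverse is an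
  operator, and \<open>x k\<close> is in its domain.\<close>

definition corresponds ::
    "nat \<Rightarrow> (nat \<Rightarrow> 'h::complex_inner) \<Rightarrow> (complex \<Rightarrow> 'h \<Rightarrow> 'h) \<Rightarrow> (real \<Rightarrow> complex mat) \<Rightarrow> bool"
  where
  "corresponds N x F M \<longleftrightarrow>
    (\<forall>z\<in>upper_half_plane. \<forall>k<N. \<forall>j<N.
       let R = resolvent (quasi_sa_ext (closure (shift_operator N x)) (F z)) z in
         single_valued R \<and> x k \<in> Domain R \<and>
         has_stieltjes_integral (\<lambda>t. 1 / (of_real t - z)) (\<lambda>t. M t $$ (k, j))
           (cinner (graph_apply R (x k)) (x j)))"

end

(* A parameter value F(z) is the restriction to the defect subspace of a contraction T(z) that extends
   the Cayley transform of the closure of A, and T(z) is the Cayley transform of the quasi-selfadjoint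
   extension, so T(z) and the resolvent R(z) of that extension determine each other.
   A family R(z) arises from a parameter iff it is analytic, inverts A - z on its range, and satisfies
   Im z |R(z) u|^2 <= Im (R(z) u, u).

   Given F, the functions (R(z) v, v) for v in the span of x_0, ..., x_(N-1) are Nevanlinna functions
   with representing measures; the recursion (R(z) A v, A v) = (v, A v) + z (v, v) + z^2 (R(z) v, v)
   identifies the moments, and polarization assembles the measures into M.
   Given M, the kernel "integral of t^(n div N + m div N) / (t - z) dM(t)" is that of a bounded operator
   R(z); positivity of dM gives the dissipativity bound through Riemann-Stieltjes sums.
   The correspondence is injective because the recursion determines R(z) from the N x N entries, and
   Stieltjes inversion determines M from them. *)
theory Submission
  imports Defs "HOL-Complex_Analysis.Complex_Analysis" "HOL-Probability.Probability"
    "HOL-Real_Asymp.Real_Asymp"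
begin

section \<open>Complex Hilbert spaces\<close>

text \<open>The values of F are arbitrary contractions varying with z, so no self-adjoint operator
  in H and no spectral measure is available; both directions work with the resolvent values alone
  and avoid a dilation to a larger space. Two obstacles shape the proof. The measure attached to
  each v comes from a compactness argument and carries no structure in v. That its distribution
  function is a quadratic form in v is recovered afterwards: inversion exhibits it as a pointwise
  limit of quadratic forms, and these are closed under limits because polarization involves finitely
  many values. Secondly, the integral against an entry of M is given only through some unspecified
  Jordan decomposition. Riemann-Stieltjes sums over a fixed mesh depend on M alone, which yields
  uniqueness of the integral; moreover every increment of M is a positive matrix, so inequalities
  can be proved cell by cell and passed to the limit. The moments exist at all because the bound
  |R(z)| <= 1 / Im z, applied at the powers A^n v, makes each remainder of the expansion at infinity
  decay along the imaginary axis.\<close>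

lemma scaleC_one [simp]: "1 *\<^sub>C (x::'a::complex_inner) = x"
  using scaleR_scaleC[of 1 x] by simp

lemma scaleC_zero_left [simp]: "0 *\<^sub>C (x::'a::complex_inner) = 0"
  using scaleR_scaleC[of 0 x] by simp

lemma scaleC_zero_right [simp]: "a *\<^sub>C (0::'a::complex_inner) = 0"
  using scaleC_add_right[of a 0 0] by simp

lemma scaleC_minus_right: "a *\<^sub>C (- x) = - (a *\<^sub>C (x::'a::complex_inner))"
  using scaleC_add_right[of a x "- x"] by (simp add: eq_neg_iff_add_eq_0 add.commute)

lemma scaleC_minus_left: "(- a) *\<^sub>C x = - (a *\<^sub>C (x::'a::complex_inner))"
  using scaleC_add_left[of a "- a" x] by (simp add: eq_neg_iff_add_eq_0 add.commute)

lemma scaleC_diff_right: "a *\<^sub>C (x - y) = a *\<^sub>C x - a *\<^sub>C (y::'a::complex_inner)"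
  using scaleC_add_right[of a x "- y"] by (simp add: scaleC_minus_right)

lemma scaleC_diff_left: "(a - b) *\<^sub>C x = a *\<^sub>C x - b *\<^sub>C (x::'a::complex_inner)"
  using scaleC_add_left[of a "- b" x] by (simp add: scaleC_minus_left)

lemmas scaleC_simps = scaleC_add_right scaleC_add_left scaleC_diff_right scaleC_diff_left
  scaleC_minus_right scaleC_minus_left scaleC_scaleC

lemma scaleC_sum_right: "a *\<^sub>C sum f A = (\<Sum>i\<in>A. a *\<^sub>C (f i::'a::complex_inner))"
  by (induction A rule: infinite_finite_induct) (auto simp: scaleC_add_right)

lemma cinner_zero_left [simp]: "cinner 0 (y::'a::complex_inner) = 0"
  using cinner_scaleC_left[of 0 0 y] by simp

lemma cinner_zero_right [simp]: "cinner (x::'a::complex_inner) 0 = 0"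
  using cinner_commute[of x 0] by simp

lemma cinner_add_right: "cinner x (y + z) = cinner x y + cinner (x::'a::complex_inner) z"
  by (metis cinner_commute cinner_add_left complex_cnj_add)

lemma cinner_scaleC_right: "cinner x (a *\<^sub>C y) = cnj a * cinner (x::'a::complex_inner) y"
  by (metis cinner_commute cinner_scaleC_left complex_cnj_mult)

lemma cinner_minus_left: "cinner (- x) y = - cinner (x::'a::complex_inner) y"
  using cinner_scaleC_left[of "-1" x y] by (simp add: scaleC_minus_left)

lemma cinner_minus_right: "cinner x (- y) = - cinner (x::'a::complex_inner) y"
  using cinner_scaleC_right[of x "-1" y] by (simp add: scaleC_minus_left)

lemma cinner_diff_left: "cinner (x - z) y = cinner x y - cinner (z::'a::complex_inner) y"
  using cinner_add_left[of x "- z" y] by (simp add: cinner_minus_left)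

lemma cinner_diff_right: "cinner y (x - z) = cinner y x - cinner (y::'a::complex_inner) z"
  using cinner_add_right[of y x "- z"] by (simp add: cinner_minus_right)

lemma cinner_sum_left: "cinner (sum f A) y = (\<Sum>i\<in>A. cinner (f i) (y::'a::complex_inner))"
  by (induction A rule: infinite_finite_induct) (auto simp: cinner_add_left)

lemma cinner_sum_right: "cinner y (sum f A) = (\<Sum>i\<in>A. cinner (y::'a::complex_inner) (f i))"
  by (induction A rule: infinite_finite_induct) (auto simp: cinner_add_right)

lemmas cinner_simps = cinner_add_left cinner_add_right cinner_diff_left cinner_diff_right
  cinner_minus_left cinner_minus_right cinner_scaleC_left cinner_scaleC_right

section \<open>Norm identities and the Cauchy-Schwarz inequality\<close>

lemma norm_sq_cinner: "(norm (x::'a::complex_inner))\<^sup>2 = Re (cinner x x)"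
  by (simp add: cinner_self)

lemma cinner_self_eq_0 [simp]: "cinner x x = 0 \<longleftrightarrow> (x::'a::complex_inner) = 0"
  by (simp add: cinner_self)

lemma Re_cinner_commute: "Re (cinner x y) = Re (cinner (y::'a::complex_inner) x)"
  by (subst cinner_commute) simp

lemma Im_cinner_commute: "Im (cinner x y) = - Im (cinner (y::'a::complex_inner) x)"
  by (subst cinner_commute) simp

lemma norm_sq_add: "(norm (x + y))\<^sup>2 = (norm x)\<^sup>2 + (norm (y::'a::complex_inner))\<^sup>2 + 2 * Re (cinner x y)"
  unfolding norm_sq_cinner using Re_cinner_commute[of x y] by (simp add: cinner_simps)

lemma norm_sq_diff: "(norm (x - y))\<^sup>2 = (norm x)\<^sup>2 + (norm (y::'a::complex_inner))\<^sup>2 - 2 * Re (cinner x y)"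
  unfolding norm_sq_cinner using Re_cinner_commute[of x y] by (simp add: cinner_simps)

lemma norm_scaleC [simp]: "norm (a *\<^sub>C x) = cmod a * norm (x::'a::complex_inner)"
proof -
  have "(norm (a *\<^sub>C x))\<^sup>2 = Re ((a * cnj a) * cinner x x)"
    unfolding norm_sq_cinner by (simp add: cinner_simps mult_ac)
  also have "\<dots> = (cmod a * norm x)\<^sup>2"
    unfolding cinner_self complex_norm_square[symmetric] by (simp add: power_mult_distrib)
  finally show ?thesis
    by (simp add: power2_eq_iff_nonneg)
qed

text \<open>Discriminant argument: a quadratic inequality valid for every scaling s of one vector
  becomes a bound by a product. It serves the Cauchy-Schwarz inequality here and its analogue for
  kernels later.\<close>

lemma le_mult_of_scaled_le:
  fixes a b c :: real
  assumes "a \<ge> 0" "c \<ge> 0" and le: "\<And>s. s > 0 \<Longrightarrow> 2 * s * b \<le> a\<^sup>2 + s\<^sup>2 * c\<^sup>2"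
  shows "b \<le> a * c"
proof (rule ccontr)
  assume "\<not> b \<le> a * c"
  then have b: "b > a * c" by simp
  then have bpos: "b > 0" using assms(1,2) by (smt (verit) mult_nonneg_nonneg)
  show False
  proof (cases "c = 0")
    case True
    \<comment> \<open>With c = 0 the left-hand side is unbounded in s; this s makes it exceed
      a^2.\<close>
    have "2 * ((a\<^sup>2 + 1) / b) * b \<le> a\<^sup>2"
      using le[of "(a\<^sup>2 + 1) / b"] bpos True by (simp add: add_nonneg_pos)
    also have "a\<^sup>2 < 2 * (a\<^sup>2 + 1)" using zero_le_power2[of a] by (simp only: distrib_left)
    also have "\<dots> = 2 * ((a\<^sup>2 + 1) / b) * b" using bpos by simp
    finally show False by simp
  next
    case False
    then have c: "c > 0" using assms(2) by simp
    \<comment> \<open>The right-hand side minus the left-hand side is smallest at s = b /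
      c^2.\<close>
    have "2 * (b / c\<^sup>2) * b \<le> a\<^sup>2 + (b / c\<^sup>2)\<^sup>2 * c\<^sup>2"
      by (rule le) (use bpos c in simp)
    moreover have "(b / c\<^sup>2)\<^sup>2 * c\<^sup>2 = b\<^sup>2 / c\<^sup>2"
      using c by (simp add: power2_eq_square)
    moreover have "2 * (b / c\<^sup>2) * b = 2 * (b\<^sup>2 / c\<^sup>2)"
      by (simp add: power2_eq_square)
    ultimately have "b\<^sup>2 / c\<^sup>2 \<le> a\<^sup>2" by linarith
    then have "b\<^sup>2 \<le> (a * c)\<^sup>2"
      using c by (simp add: pos_divide_le_eq power_mult_distrib)
    then have "b \<le> a * c"
      using assms(1,2) power2_le_imp_le[of b "a * c"] by simp
    with b show False by simp
  qed
qed

text \<open>The supremum of Re (e * z) over the unit circle is attained at e = cnj z / |z|. Complex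
  bounds thus reduce to bounds on real parts that hold for every rotation.\<close>

lemma cmod_le_of_Re_le:
  assumes "\<And>e. cmod e = 1 \<Longrightarrow> Re (e * z) \<le> b"
  shows "cmod z \<le> b"
proof (cases "z = 0")
  case True then show ?thesis using assms[of 1] by simp
next
  case False
  have "cnj z / cmod z * z = cmod z"
    using False complex_norm_square[of z] by (simp add: power2_eq_square field_simps)
  then show ?thesis using assms[of "cnj z / cmod z"] False
    by (simp add: norm_divide)
qed

lemma cinner_Cauchy_Schwarz: "cmod (cinner x y) \<le> norm x * norm (y::'a::complex_inner)"
proof (rule cmod_le_of_Re_le)
  fix e :: complex assume e: "cmod e = 1"
  show "Re (e * cinner x y) \<le> norm x * norm y"
  proof (rule le_mult_of_scaled_le)
    fix s :: real assume "s > 0"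
    have "0 \<le> (norm (e *\<^sub>C x - complex_of_real s *\<^sub>C y))\<^sup>2" by simp
    also have "\<dots> = (norm x)\<^sup>2 + s\<^sup>2 * (norm y)\<^sup>2 - 2 * (s * Re (e * cinner x y))"
      unfolding norm_sq_diff using e by (simp add: cinner_simps power_mult_distrib)
    finally show "2 * s * Re (e * cinner x y) \<le> (norm x)\<^sup>2 + s\<^sup>2 * (norm y)\<^sup>2" by simp
  qed auto
qed

lemma bounded_bilinear_cinner: "bounded_bilinear (cinner :: 'a::complex_inner \<Rightarrow> 'a \<Rightarrow> complex)"
  by (rule bounded_bilinear.intro)
     (auto simp: cinner_simps scaleR_scaleC scaleC_complex_def intro!: exI[of _ 1] cinner_Cauchy_Schwarz)

lemma bounded_bilinear_scaleC: "bounded_bilinear (scaleC :: complex \<Rightarrow> 'a::complex_inner \<Rightarrow> 'a)"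
  by (rule bounded_bilinear.intro)
     (auto simp: scaleC_simps scaleR_scaleC scaleC_complex_def mult.commute intro!: exI[of _ 1])

lemmas tendsto_cinner [tendsto_intros] = bounded_bilinear.tendsto[OF bounded_bilinear_cinner]
lemmas tendsto_scaleC [tendsto_intros] = bounded_bilinear.tendsto[OF bounded_bilinear_scaleC]
lemmas continuous_on_cinner [continuous_intros] = bounded_bilinear.continuous_on[OF bounded_bilinear_cinner]
lemmas continuous_on_scaleC [continuous_intros] = bounded_bilinear.continuous_on[OF bounded_bilinear_scaleC]

section \<open>Closed subspaces and orthogonal projection\<close>

definition csubspace :: "'a::complex_inner set \<Rightarrow> bool" where
  "csubspace V \<longleftrightarrow> 0 \<in> V \<and> (\<forall>u\<in>V. \<forall>v\<in>V. \<forall>a b. a *\<^sub>C u + b *\<^sub>C v \<in> V)"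

lemma csubspaceD: "csubspace V \<Longrightarrow> u \<in> V \<Longrightarrow> v \<in> V \<Longrightarrow> a *\<^sub>C u + b *\<^sub>C v \<in> V"
  by (simp add: csubspace_def)

lemma csubspace_0: "csubspace V \<Longrightarrow> 0 \<in> V"
  by (simp add: csubspace_def)

lemma csubspace_scaleC: "csubspace V \<Longrightarrow> u \<in> V \<Longrightarrow> a *\<^sub>C u \<in> V"
  using csubspaceD[of V u u a 0] by simp

lemma csubspace_ortho_compl: "csubspace (ortho_compl V)"
  by (auto simp: csubspace_def ortho_compl_def cinner_simps)

lemma ortho_compl_cinner: "h \<in> ortho_compl V \<Longrightarrow> v \<in> V \<Longrightarrow> cinner h v = 0 \<and> cinner v h = 0"
  by (metis (mono_tags, lifting) cinner_commute complex_cnj_zero mem_Collect_eq ortho_compl_def)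

lemma parallelogram: "(norm (x + y))\<^sup>2 + (norm (x - y))\<^sup>2 = 2 * (norm x)\<^sup>2 + 2 * (norm (y::'a::complex_inner))\<^sup>2"
  by (simp add: norm_sq_add norm_sq_diff)

text \<open>A minimizing sequence is Cauchy by the parallelogram law, midpoints staying in
  \<open>V\<close>; the minimizer is orthogonal because moving it along a non-orthogonal w would
  shorten the distance.\<close>

lemma orthogonal_projection:
  fixes V :: "'a::complex_hilbert set"
  assumes V: "csubspace V" "closed V"
  obtains v where "v \<in> V" "x - v \<in> ortho_compl V"
proof -
  define d where "d = infdist x V"
  have Vne: "V \<noteq> {}" using V(1) csubspace_0 by blast
  have d_le: "d \<le> norm (x - v)" if "v \<in> V" for v
    unfolding d_def using infdist_le[OF that, of x] by (simp add: dist_norm)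
  have d0: "d \<ge> 0" unfolding d_def by (rule infdist_nonneg)
  have "\<exists>v\<in>V. norm (x - v) < d + e" if "e > 0" for e
  proof (rule ccontr)
    assume "\<not> (\<exists>v\<in>V. norm (x - v) < d + e)"
    then have "d + e \<le> infdist x V"
      unfolding infdist_notempty[OF Vne] dist_norm by (intro cINF_greatest Vne) force
    then show False using that by (simp add: d_def)
  qed
  then have "\<exists>v\<in>V. norm (x - v) < d + inverse (real (Suc n))" for n
    by simp
  then obtain s where s: "\<And>n. s n \<in> V" "\<And>n. norm (x - s n) < d + inverse (real (Suc n))"
    by metis
  have key: "(norm (s m - s n))\<^sup>2 \<le> 2 * (norm (x - s m))\<^sup>2 + 2 * (norm (x - s n))\<^sup>2 - 4 * d\<^sup>2" for m n
  proof -
    have "(1/2) *\<^sub>C s m + (1/2) *\<^sub>C s n \<in> V"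
      using csubspaceD[OF V(1) s(1) s(1)] by blast
    then have "d \<le> norm (x - ((1/2) *\<^sub>C s m + (1/2) *\<^sub>C s n))" by (rule d_le)
    then have "2 * d \<le> norm (2 *\<^sub>C (x - ((1/2) *\<^sub>C s m + (1/2) *\<^sub>C s n)))" by simp
    also have "2 *\<^sub>C (x - ((1/2) *\<^sub>C s m + (1/2) *\<^sub>C s n)) = (x - s m) + (x - s n)"
      using scaleC_add_left[of 1 1 x] by (simp add: scaleC_simps)
    finally have "(2 * d)\<^sup>2 \<le> (norm ((x - s m) + (x - s n)))\<^sup>2"
      using d0 by (intro power_mono) auto
    then show ?thesis
      using parallelogram[of "x - s m" "x - s n"] by (simp add: power_mult_distrib norm_minus_commute)
  qed
  have lim: "(\<lambda>n. norm (x - s n)) \<longlonglongrightarrow> d"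
  proof (rule tendsto_sandwich[where f="\<lambda>_. d" and h="\<lambda>n. d + inverse (real (Suc n))"])
    show "(\<lambda>n. d + inverse (real (Suc n))) \<longlonglongrightarrow> d"
      using LIMSEQ_inverse_real_of_nat_add[of d] by simp
  qed (use s d_le in \<open>auto intro!: always_eventually intro: less_imp_le simp del: of_nat_Suc\<close>)
  have lim2: "(\<lambda>n. (norm (x - s n))\<^sup>2) \<longlonglongrightarrow> d\<^sup>2"
    by (intro tendsto_intros lim)
  have "Cauchy s"
  proof (rule metric_CauchyI)
    fix e :: real assume e: "e > 0"
    have "\<forall>\<^sub>F n in sequentially. (norm (x - s n))\<^sup>2 < d\<^sup>2 + e\<^sup>2 / 4"
      using lim2 e by (intro order_tendstoD) auto
    then obtain M where M: "\<And>n. n \<ge> M \<Longrightarrow> (norm (x - s n))\<^sup>2 < d\<^sup>2 + e\<^sup>2 / 4"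
      by (auto simp: eventually_sequentially)
    have "dist (s m) (s n) < e" if "m \<ge> M" "n \<ge> M" for m n
    proof -
      have "(norm (s m - s n))\<^sup>2 < e\<^sup>2"
        using key[of m n] M[OF that(1)] M[OF that(2)] by linarith
      then show ?thesis using e by (simp add: dist_norm power2_less_imp_less)
    qed
    then show "\<exists>M. \<forall>m\<ge>M. \<forall>n\<ge>M. dist (s m) (s n) < e" by blast
  qed
  then obtain v where v: "s \<longlonglongrightarrow> v" using Cauchy_convergent_iff convergent_def by blast
  have vV: "v \<in> V" using closed_sequentially[OF V(2) s(1) v] .
  have nv: "norm (x - v) = d"
    using LIMSEQ_unique[OF lim tendsto_norm[OF tendsto_diff[OF tendsto_const v]]] by simp
  have "x - v \<in> ortho_compl V"
    unfolding ortho_compl_def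
  proof safe
    fix w assume w: "w \<in> V"
    have "cmod (cinner (x - v) w) \<le> 0"
    proof (rule cmod_le_of_Re_le)
      fix e :: complex assume e: "cmod e = 1"
      show "Re (e * cinner (x - v) w) \<le> 0"
      proof (rule ccontr)
        define r where "r = Re (e * cinner (x - v) w)"
        assume "\<not> Re (e * cinner (x - v) w) \<le> 0"
        then have r: "r > 0" by (simp add: r_def)
        \<comment> \<open>Moving by s along the rotated w gains 2 s r and costs s^2 |w|^2; this s
          keeps the cost below half the gain, and the added 1 excludes a zero denominator.\<close>
        define s where "s = r / ((norm w)\<^sup>2 + 1)"
        have s: "s > 0" using r by (simp add: s_def add_nonneg_pos)
        have "v + (complex_of_real s * cnj e) *\<^sub>C w \<in> V"
          using csubspaceD[OF V(1) vV w, of 1] by simp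
        then have "d \<le> norm (x - (v + (complex_of_real s * cnj e) *\<^sub>C w))" by (rule d_le)
        then have "d\<^sup>2 \<le> (norm ((x - v) - (complex_of_real s * cnj e) *\<^sub>C w))\<^sup>2"
          using d0 by (metis diff_diff_add power_mono)
        also have "\<dots> = d\<^sup>2 + s\<^sup>2 * (norm w)\<^sup>2 - 2 * (s * r)"
          unfolding norm_sq_diff nv using e
          by (simp add: cinner_simps norm_mult power_mult_distrib r_def mult.assoc)
        finally have "2 * (s * r) \<le> s * (s * (norm w)\<^sup>2)" by (simp add: power2_eq_square)
        then have "2 * r \<le> s * (norm w)\<^sup>2" using s by simp
        moreover have "s * (norm w)\<^sup>2 \<le> r"
          unfolding s_def using r by (simp add: add_nonneg_pos pos_divide_le_eq distrib_left)
        ultimately show False using r by simp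
      qed
    qed
    then show "cinner (x - v) w = 0" by simp
  qed
  with vV that show thesis by blast
qed

section \<open>Linear maps, Riesz representation, closed graphs\<close>

definition clin :: "('a::complex_inner \<Rightarrow> 'b::complex_inner) \<Rightarrow> bool" where
  "clin T \<longleftrightarrow> (\<forall>u v a b. T (a *\<^sub>C u + b *\<^sub>C v) = a *\<^sub>C T u + b *\<^sub>C T v)"

lemma clinD: "clin T \<Longrightarrow> T (a *\<^sub>C u + b *\<^sub>C v) = a *\<^sub>C T u + b *\<^sub>C T v"
  by (simp add: clin_def)

lemma clin_add: "clin T \<Longrightarrow> T (u + v) = T u + T v"
  using clinD[of T 1 u 1 v] by simp

lemma clin_scaleC: "clin T \<Longrightarrow> T (a *\<^sub>C u) = a *\<^sub>C T u"
  using clinD[of T a u 0 u] by simp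

lemma clin_0: "clin T \<Longrightarrow> T 0 = 0"
  using clin_scaleC[of T 0 0] by simp

lemma clin_diff: "clin T \<Longrightarrow> T (u - v) = T u - T v"
  using clinD[of T 1 u "-1" v] by (simp add: scaleC_minus_left)

lemma clin_sum: "clin T \<Longrightarrow> T (sum f A) = (\<Sum>i\<in>A. T (f i))"
  by (induction A rule: infinite_finite_induct) (auto simp: clin_add clin_0)

lemma clin_tendsto:
  assumes "clin T" "\<And>u. norm (T u) \<le> K * norm u" "(f \<longlongrightarrow> l) F"
  shows "((\<lambda>t. T (f t)) \<longlongrightarrow> T l) F"
proof (rule bounded_linear.tendsto[OF _ assms(3)])
  show "bounded_linear T"
  proof (rule bounded_linear_intro)
    show "norm (T x) \<le> norm x * K" for x using assms(2)[of x] by (simp add: mult.commute)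
  qed (auto simp: clin_add[OF assms(1)] clin_scaleC[OF assms(1)] scaleR_scaleC)
qed

text \<open>The kernel is closed; any vector orthogonal to it on which the functional does not
  vanish represents the functional after scaling.\<close>

lemma riesz_representation:
  fixes l :: "'a::complex_hilbert \<Rightarrow> complex"
  assumes l: "clin l" and bd: "\<And>u. norm (l u) \<le> K * norm u"
  shows "\<exists>r. \<forall>v. l v = cinner v r"
proof -
  let ?V = "{v. l v = 0}"
  have "csubspace ?V"
    by (auto simp: csubspace_def clinD[OF l] clin_0[OF l])
  moreover have "closed ?V"
    unfolding closed_sequential_limits
  proof safe
    fix s v assume "\<forall>n. s n \<in> ?V" "s \<longlonglongrightarrow> v"
    then show "l v = 0" using clin_tendsto[OF l bd, of s v sequentially]
      by (simp add: LIMSEQ_const_iff)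
  qed
  ultimately have proj: "\<exists>v. l v = 0 \<and> u - v \<in> ortho_compl ?V" for u
    using orthogonal_projection[of ?V u] by (metis mem_Collect_eq)
  show ?thesis
  proof (cases "\<forall>v. l v = 0")
    case True
    then show ?thesis by (intro exI[of _ 0]) auto
  next
    case False
    then obtain u where u: "l u \<noteq> 0" by blast
    obtain v where v: "l v = 0" "u - v \<in> ortho_compl ?V" using proj by blast
    define w where "w = u - v"
    have lw: "l w \<noteq> 0" using u v by (simp add: w_def clin_diff[OF l])
    then have w0: "w \<noteq> 0" using clin_0[OF l] by auto
    have "l x = cinner x (cnj (l w / cinner w w) *\<^sub>C w)" for x
    proof -
      have "l (x - (l x / l w) *\<^sub>C w) = 0"
        using lw by (simp add: clin_diff[OF l] clin_scaleC[OF l] scaleC_complex_def)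
      then have "cinner (x - (l x / l w) *\<^sub>C w) w = 0"
        using v(2) ortho_compl_cinner unfolding w_def by blast
      then have "cinner x w = l x / l w * cinner w w" by (simp add: cinner_simps)
      then show ?thesis using lw w0 by (simp add: cinner_simps)
    qed
    then show ?thesis by blast
  qed
qed

text \<open>The bound turns Cauchy sequences of first components into Cauchy sequences of second
  components, so limits stay in the closed graph. This serves both extension by continuity and the
  closedness of the range of the Cayley transform.\<close>

lemma closed_Domain_of_bounded:
  fixes G :: "('a::complex_hilbert \<times> 'b::complex_hilbert) set"
  assumes cl: "closed G"
    and diff: "\<And>a b a' b'. (a, b) \<in> G \<Longrightarrow> (a', b') \<in> G \<Longrightarrow> (a - a', b - b') \<in> G"
    and bd: "\<And>a b. (a, b) \<in> G \<Longrightarrow> norm b \<le> K * norm a"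
  shows "closed (Domain G)"
  unfolding closed_sequential_limits
proof safe
  fix s a assume s: "\<forall>n. s n \<in> Domain G" "s \<longlonglongrightarrow> a"
  then have "\<forall>n. \<exists>b. (s n, b) \<in> G" by blast
  then obtain t where t: "\<And>n. (s n, t n) \<in> G" by metis
  have "Cauchy t"
  proof (rule metric_CauchyI)
    fix e :: real assume e: "e > 0"
    have "Cauchy s" using s(2) LIMSEQ_imp_Cauchy by blast
    \<comment> \<open>\<open>K\<close> may be zero or negative, so the modulus divides by the
      positive number |K| + 1.\<close>
    then obtain M where M: "\<And>m n. m \<ge> M \<Longrightarrow> n \<ge> M \<Longrightarrow> dist (s m) (s n) < e / (\<bar>K\<bar> + 1)"
      using metric_CauchyD[of s "e / (\<bar>K\<bar> + 1)"] e by (auto simp: add_nonneg_pos)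
    have "dist (t m) (t n) < e" if "m \<ge> M" "n \<ge> M" for m n
    proof -
      have "norm (t m - t n) \<le> K * norm (s m - s n)"
        by (rule bd[OF diff[OF t t]])
      also have "\<dots> \<le> (\<bar>K\<bar> + 1) * norm (s m - s n)"
        by (intro mult_right_mono) auto
      also have "\<dots> < (\<bar>K\<bar> + 1) * (e / (\<bar>K\<bar> + 1))"
        using M[OF that] by (intro mult_strict_left_mono) (auto simp: dist_norm)
      also have "\<dots> = e" by (simp add: add_nonneg_pos less_imp_neq[THEN not_sym])
      finally show ?thesis by (simp add: dist_norm)
    qed
    then show "\<exists>M. \<forall>m\<ge>M. \<forall>n\<ge>M. dist (t m) (t n) < e" by blast
  qed
  then obtain b where b: "t \<longlonglongrightarrow> b" using Cauchy_convergent_iff convergent_def by blast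
  have "(a, b) \<in> G"
    using closed_sequentially[OF cl, of "\<lambda>n. (s n, t n)" "(a, b)"] t tendsto_Pair[OF s(2) b] by blast
  then show "a \<in> Domain G" by blast
qed

section \<open>Linear combinations of a sequence and linear relations\<close>

definition lincomb :: "(nat \<Rightarrow> 'a::complex_inner) \<Rightarrow> nat \<Rightarrow> (nat \<Rightarrow> complex) \<Rightarrow> 'a" where
  "lincomb x p \<alpha> = (\<Sum>k<p. \<alpha> k *\<^sub>C x k)"

lemma lincomb_pad:
  assumes "p \<le> m"
  shows "lincomb x p \<alpha> = lincomb x m (\<lambda>k. if k < p then \<alpha> k else 0)"
  unfolding lincomb_def using assms by (intro sum.mono_neutral_cong_left) auto

lemma lincomb_add: "a *\<^sub>C lincomb x p \<alpha> + b *\<^sub>C lincomb x p \<beta> = lincomb x p (\<lambda>k. a * \<alpha> k + b * \<beta> k)"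
  unfolding lincomb_def by (simp add: scaleC_sum_right scaleC_simps sum.distrib)

lemma lincomb_single: "lincomb x (Suc n) (\<lambda>k. if k = n then 1 else 0) = x n"
  unfolding lincomb_def by (simp add: if_distrib[of "\<lambda>c. c *\<^sub>C _"] cong: if_cong)

definition clin_rel :: "('a::complex_inner \<times> 'b::complex_inner) set \<Rightarrow> bool" where
  "clin_rel G \<longleftrightarrow> (0, 0) \<in> G \<and> (\<forall>f g f' g' a b. (f, g) \<in> G \<longrightarrow> (f', g') \<in> G \<longrightarrow>
     (a *\<^sub>C f + b *\<^sub>C f', a *\<^sub>C g + b *\<^sub>C g') \<in> G)"

lemma clin_relD: "clin_rel G \<Longrightarrow> (f, g) \<in> G \<Longrightarrow> (f', g') \<in> G \<Longrightarrow>
    (a *\<^sub>C f + b *\<^sub>C f', a *\<^sub>C g + b *\<^sub>C g') \<in> G"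
  by (simp add: clin_rel_def)

lemma clin_rel_diff: "clin_rel G \<Longrightarrow> (f, g) \<in> G \<Longrightarrow> (f', g') \<in> G \<Longrightarrow> (f - f', g - g') \<in> G"
  using clin_relD[of G f g f' g' 1 "-1"] by (simp add: scaleC_minus_left)

lemma clin_rel_closure:
  assumes "clin_rel G"
  shows "clin_rel (closure G)"
  unfolding clin_rel_def
proof (intro conjI allI impI)
  show "(0, 0) \<in> closure G"
    using assms closure_subset[of G] by (auto simp: clin_rel_def)
  fix f g f' g' and a b :: complex
  assume "(f, g) \<in> closure G" "(f', g') \<in> closure G"
  then obtain s t where s: "\<And>n. s n \<in> G" "s \<longlonglongrightarrow> (f, g)" and t: "\<And>n. t n \<in> G" "t \<longlonglongrightarrow> (f', g')"
    unfolding closure_sequential by blast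
  let ?r = "\<lambda>n. (a *\<^sub>C fst (s n) + b *\<^sub>C fst (t n), a *\<^sub>C snd (s n) + b *\<^sub>C snd (t n))"
  have "?r n \<in> G" for n
    by (rule clin_relD[OF assms]) (use s(1)[of n] t(1)[of n] in auto)
  moreover have "?r \<longlonglongrightarrow> (a *\<^sub>C f + b *\<^sub>C f', a *\<^sub>C g + b *\<^sub>C g')"
    using tendsto_fst[OF s(2)] tendsto_snd[OF s(2)] tendsto_fst[OF t(2)] tendsto_snd[OF t(2)]
    by (auto intro!: tendsto_intros)
  ultimately show "(a *\<^sub>C f + b *\<^sub>C f', a *\<^sub>C g + b *\<^sub>C g') \<in> closure G"
    unfolding closure_sequential by (intro exI[of _ ?r]) auto
qed

lemma closed_relation_closure:
  assumes "\<And>p. p \<in> G \<Longrightarrow> P p" "closed {p. P p}" "p \<in> closure G"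
  shows "P p"
  using closure_minimal[of G "{p. P p}"] assms by blast

text \<open>The x_n may be linearly dependent, so sending x_n to y_n is at first only a relation; an
  estimate later makes it single-valued.\<close>

definition comb_graph :: "(nat \<Rightarrow> 'a::complex_inner) \<Rightarrow> (nat \<Rightarrow> 'b::complex_inner) \<Rightarrow> ('a \<times> 'b) set" where
  "comb_graph x y = {(lincomb x p \<alpha>, lincomb y p \<alpha>) | p \<alpha>. True}"

lemma comb_graphI: "(lincomb x p \<alpha>, lincomb y p \<alpha>) \<in> comb_graph x y"
  by (auto simp: comb_graph_def)

lemma clin_rel_comb_graph: "clin_rel (comb_graph x y)"
  unfolding clin_rel_def
proof (intro conjI allI impI)
  show "(0, 0) \<in> comb_graph x y"
    using comb_graphI[of x 0 "\<lambda>_. 0" y] by (simp add: lincomb_def)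
  fix f g f' g' and a b :: complex
  assume "(f, g) \<in> comb_graph x y" "(f', g') \<in> comb_graph x y"
  then obtain p \<alpha> q \<beta> where fg: "f = lincomb x p \<alpha>" "g = lincomb y p \<alpha>"
      "f' = lincomb x q \<beta>" "g' = lincomb y q \<beta>"
    by (auto simp: comb_graph_def)
  have "p \<le> max p q" "q \<le> max p q" by auto
  note pad = lincomb_pad[OF this(1)] lincomb_pad[OF this(2)]
  show "(a *\<^sub>C f + b *\<^sub>C f', a *\<^sub>C g + b *\<^sub>C g') \<in> comb_graph x y"
    unfolding fg pad[of _ \<alpha>] pad[of _ \<beta>] lincomb_add by (rule comb_graphI)
qed

lemma span_eq_lincombs:
  fixes x :: "nat \<Rightarrow> 'a::complex_inner"
  shows "Modules.module.span scaleC (range x) = {lincomb x p \<alpha> | p \<alpha>. True}"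
proof -
  interpret vector_space "scaleC :: complex \<Rightarrow> 'a \<Rightarrow> 'a"
    by (rule vector_space_scaleC)
  have rel: "clin_rel (comb_graph x x)" by (rule clin_rel_comb_graph)
  have mem: "u \<in> {lincomb x p \<alpha> | p \<alpha>. True} \<longleftrightarrow> (u, u) \<in> comb_graph x x" for u
    by (auto simp: comb_graph_def)
  have "subspace {lincomb x p \<alpha> | p \<alpha>. True}"
  proof (rule subspaceI)
    show "0 \<in> {lincomb x p \<alpha> | p \<alpha>. True}"
      unfolding mem using rel by (simp add: clin_rel_def)
    show "u + v \<in> {lincomb x p \<alpha> | p \<alpha>. True}"
      if "u \<in> {lincomb x p \<alpha> | p \<alpha>. True}" "v \<in> {lincomb x p \<alpha> | p \<alpha>. True}" for u v
      using that unfolding mem using clin_relD[OF rel, of u u v v 1 1] by simp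
    show "c *\<^sub>C u \<in> {lincomb x p \<alpha> | p \<alpha>. True}"
      if "u \<in> {lincomb x p \<alpha> | p \<alpha>. True}" for c u
      using that unfolding mem using clin_relD[OF rel, of u u u u c 0] by simp
  qed
  moreover have "range x \<subseteq> {lincomb x p \<alpha> | p \<alpha>. True}"
  proof safe
    fix n show "\<exists>p \<alpha>. x n = lincomb x p \<alpha> \<and> True"
      using lincomb_single[of x n] by metis
  qed
  ultimately have "span (range x) \<subseteq> {lincomb x p \<alpha> | p \<alpha>. True}"
    by (rule span_minimal[rotated])
  moreover have "lincomb x p \<alpha> \<in> span (range x)" for p \<alpha>
    unfolding lincomb_def by (intro span_sum span_scale span_base) auto
  ultimately show ?thesis by blast
qed

section \<open>Operators determined by their values on a dense span\<close>

lemma clin_eq_on_dense: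
  fixes x :: "nat \<Rightarrow> 'a::complex_inner"
  assumes T: "clin T" "\<And>u. norm (T u) \<le> K * norm u" and T': "clin T'" "\<And>u. norm (T' u) \<le> K' * norm u"
    and dense: "closure (Modules.module.span scaleC (range x)) = UNIV"
    and eq: "\<And>n. T (x n) = T' (x n)"
  shows "T u = T' u"
proof -
  have "u \<in> closure (Modules.module.span scaleC (range x))" using dense by simp
  then obtain s where s: "\<And>n. s n \<in> Modules.module.span scaleC (range x)" "s \<longlonglongrightarrow> u"
    unfolding closure_sequential by blast
  have "T (s n) = T' (s n)" for n
  proof -
    obtain p \<alpha> where "s n = lincomb x p \<alpha>" using s(1)[of n] unfolding span_eq_lincombs by blast
    then show ?thesis
      by (simp add: lincomb_def clin_sum[OF T(1)] clin_sum[OF T'(1)] clin_scaleC[OF T(1)]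
          clin_scaleC[OF T'(1)] eq del: scaleC_zero_left)
  qed
  then have "(\<lambda>n. T (s n)) \<longlonglongrightarrow> T' u"
    using clin_tendsto[OF T' s(2)] by simp
  then show ?thesis
    using clin_tendsto[OF T s(2)] LIMSEQ_unique by blast
qed

text \<open>The bound applied to a difference (0, b - b') makes the relation single-valued. Inverses
  and extensions below are turned into operators in this way.\<close>

lemma operator_of_total_relation:
  fixes G :: "('a::complex_inner \<times> 'b::complex_inner) set"
  assumes rel: "clin_rel G" and bd: "\<And>a b. (a, b) \<in> G \<Longrightarrow> norm b \<le> K * norm a"
    and total: "\<And>a. \<exists>b. (a, b) \<in> G"
  shows "\<exists>T. clin T \<and> (\<forall>u. norm (T u) \<le> K * norm u) \<and> (\<forall>a b. (a, b) \<in> G \<longleftrightarrow> b = T a)"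
proof -
  have sv: "b = b'" if "(a, b) \<in> G" "(a, b') \<in> G" for a b b'
    using bd[OF clin_rel_diff[OF rel that]] by simp
  define T where "T u = (SOME b. (u, b) \<in> G)" for u
  have T: "(u, T u) \<in> G" for u
    unfolding T_def by (rule someI_ex) (rule total)
  have "clin T"
    unfolding clin_def using sv[OF T clin_relD[OF rel T T]] by blast
  moreover have "(a, b) \<in> G \<longleftrightarrow> b = T a" for a b
    using sv T by blast
  ultimately show ?thesis using bd[OF T] by blast
qed

text \<open>Extension by continuity: the closure of the graph keeps the bound, and its domain is
  closed and contains the dense span. The bound on all combinations also encodes that the assignment
  is well defined.\<close>

lemma bounded_operator_on_dense:
  fixes x :: "nat \<Rightarrow> 'a::complex_hilbert" and r :: "nat \<Rightarrow> 'b::complex_hilbert"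
  assumes dense: "closure (Modules.module.span scaleC (range x)) = UNIV"
    and bd: "\<And>p \<alpha>. norm (lincomb r p \<alpha>) \<le> K * norm (lincomb x p \<alpha>)"
  shows "\<exists>T. clin T \<and> (\<forall>u. norm (T u) \<le> K * norm u) \<and> (\<forall>n. T (x n) = r n)"
proof -
  let ?G = "closure (comb_graph x r)"
  have rel: "clin_rel ?G"
    by (rule clin_rel_closure[OF clin_rel_comb_graph])
  have bdG: "norm b \<le> K * norm a" if "(a, b) \<in> ?G" for a b
  proof -
    have "case (a, b) of (a, b) \<Rightarrow> norm b \<le> K * norm a"
      by (rule closed_relation_closure[OF _ _ that])
         (auto simp: comb_graph_def bd split_beta intro!: closed_Collect_le continuous_intros)
    then show ?thesis by simp
  qed
  have "closed (Domain ?G)"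
    by (rule closed_Domain_of_bounded[of _ K]) (auto intro: clin_rel_diff[OF rel] bdG)
  moreover have "Modules.module.span scaleC (range x) \<subseteq> Domain ?G"
    unfolding span_eq_lincombs using comb_graphI[of x _ _ r] closure_subset[of "comb_graph x r"] by blast
  ultimately have "closure (Modules.module.span scaleC (range x)) \<subseteq> Domain ?G"
    by (rule closure_minimal[rotated])
  then have dom: "Domain ?G = UNIV" unfolding dense by (rule top.extremum_uniqueI)
  have "\<exists>T. clin T \<and> (\<forall>u. norm (T u) \<le> K * norm u) \<and> (\<forall>a b. (a, b) \<in> ?G \<longleftrightarrow> b = T a)"
    by (rule operator_of_total_relation[OF rel bdG]) (use dom in \<open>auto simp: Domain_iff[symmetric]\<close>)
  then obtain T where T: "clin T" "\<And>u. norm (T u) \<le> K * norm u" "\<And>a b. (a, b) \<in> ?G \<longleftrightarrow> b = T a" by metis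
  have "T (x n) = r n" for n
  proof -
    have "(x n, r n) \<in> ?G"
      using comb_graphI[of x "Suc n" "\<lambda>k. if k = n then 1 else 0" r] closure_subset[of "comb_graph x r"]
      unfolding lincomb_single by blast
    then show ?thesis using T(3) by simp
  qed
  then show ?thesis using T(1,2) by blast
qed

lemma cinner_lincomb:
  "cinner (lincomb x p \<alpha>) (lincomb y q \<beta>) = (\<Sum>n<p. \<Sum>m<q. \<alpha> n * cnj (\<beta> m) * cinner (x n) (y m))"
  unfolding lincomb_def
  by (subst sum.swap) (simp add: cinner_sum_left cinner_sum_right cinner_simps sum_distrib_left mult_ac)

text \<open>The estimate passes to the closure of the span and can then be tested at w
  itself.\<close>

lemma norm_le_of_dense_cinner:
  assumes dense: "closure (Modules.module.span scaleC (range x)) = UNIV"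
    and "c \<ge> 0" and le: "\<And>p \<beta>. cmod (cinner w (lincomb x p \<beta>)) \<le> c * norm (lincomb x p \<beta>)"
  shows "norm w \<le> c"
proof -
  have "closed {v. cmod (cinner w v) \<le> c * norm v}"
    by (intro closed_Collect_le continuous_intros)
  moreover have "Modules.module.span scaleC (range x) \<subseteq> {v. cmod (cinner w v) \<le> c * norm v}"
    unfolding span_eq_lincombs using le by blast
  ultimately have "closure (Modules.module.span scaleC (range x)) \<subseteq> {v. cmod (cinner w v) \<le> c * norm v}"
    by (rule closure_minimal[rotated])
  then have "w \<in> {v. cmod (cinner w v) \<le> c * norm v}"
    unfolding dense by (rule subsetD) simp
  then have "norm w * norm w \<le> c * norm w"
    by (simp add: cinner_self power2_eq_square norm_mult)
  then show ?thesis using \<open>c \<ge> 0\<close> by (cases "w = 0") auto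
qed

text \<open>For fixed n the form is a bounded functional, whose Riesz vector becomes the image of
  x_n; the same bound shows that these images depend boundedly on combinations.\<close>

lemma bounded_operator_of_kernel:
  fixes x :: "nat \<Rightarrow> 'a::complex_hilbert"
  assumes dense: "closure (Modules.module.span scaleC (range x)) = UNIV" and K: "K \<ge> 0"
    and bd: "\<And>p \<alpha> \<beta>. cmod (\<Sum>n<p. \<Sum>m<p. \<alpha> n * cnj (\<beta> m) * b n m)
                \<le> K * norm (lincomb x p \<alpha>) * norm (lincomb x p \<beta>)"
  shows "\<exists>T. clin T \<and> (\<forall>u. norm (T u) \<le> K * norm u) \<and> (\<forall>n m. cinner (T (x n)) (x m) = b n m)"
proof -
  \<comment> \<open>Zero padding frees the two combinations from having the same length, so that one
    of them can be a single x_n.\<close>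
  have bd2: "cmod (\<Sum>n<p. \<Sum>m<q. \<alpha> n * cnj (\<beta> m) * b n m)
                \<le> K * norm (lincomb x p \<alpha>) * norm (lincomb x q \<beta>)" for p q \<alpha> \<beta>
  proof -
    let ?m = "max p q"
    let ?a = "\<lambda>k. if k < p then \<alpha> k else 0" and ?b = "\<lambda>k. if k < q then \<beta> k else 0"
    have "(\<Sum>n<p. \<Sum>m<q. \<alpha> n * cnj (\<beta> m) * b n m) = (\<Sum>n<?m. \<Sum>m<?m. ?a n * cnj (?b m) * b n m)"
      by (intro sum.mono_neutral_cong_left) (auto intro!: sum.mono_neutral_cong_left)
    also have "cmod \<dots> \<le> K * norm (lincomb x ?m ?a) * norm (lincomb x ?m ?b)" by (rule bd)
    also have "lincomb x ?m ?a = lincomb x p \<alpha>" by (rule lincomb_pad[symmetric]) simp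
    also have "lincomb x ?m ?b = lincomb x q \<beta>" by (rule lincomb_pad[symmetric]) simp
    finally show ?thesis .
  qed
  have "\<exists>r. \<forall>m. cinner (x m) r = cnj (b n m)" for n
  proof -
    have "norm (lincomb (\<lambda>m. cnj (b n m)) q \<beta>) \<le> (K * norm (x n)) * norm (lincomb x q \<beta>)" for q \<beta>
    proof -
      have "(\<Sum>k<Suc n. \<Sum>m<q. (if k = n then 1 else 0) * cnj (\<beta> m) * b k m) = (\<Sum>m<q. cnj (\<beta> m) * b n m)"
        by (simp add: if_distrib[of "\<lambda>c. c * _"] cong: if_cong)
      also have "\<dots> = cnj (lincomb (\<lambda>m. cnj (b n m)) q \<beta>)"
        by (simp add: lincomb_def scaleC_complex_def)
      finally show ?thesis
        using bd2[where p="Suc n" and q=q and \<alpha>="\<lambda>k. if k = n then 1 else 0" and \<beta>=\<beta>] unfolding lincomb_single by simp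
    qed
    from bounded_operator_on_dense[OF dense this] obtain l where l: "clin l"
      "\<And>u. norm (l u) \<le> K * norm (x n) * norm u" "\<And>m. l (x m) = cnj (b n m)" by blast
    from riesz_representation[OF l(1,2)] l(3) show ?thesis by metis
  qed
  then obtain r where r: "\<And>n m. cinner (x m) (r n) = cnj (b n m)" by metis
  have r': "cinner (r n) (x m) = b n m" for n m
    using r[of m n] by (metis cinner_commute complex_cnj_cnj)
  have "norm (lincomb r p \<alpha>) \<le> K * norm (lincomb x p \<alpha>)" for p \<alpha>
    by (rule norm_le_of_dense_cinner[OF dense]) (use bd2 K in \<open>auto simp: cinner_lincomb r'\<close>)
  from bounded_operator_on_dense[OF dense this] r' show ?thesis by metis
qed

text \<open>The equation for v is the fixed-point equation v = (u - b W v) / a, whose right-hand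
  side contracts with factor |b / a| < 1.\<close>

lemma contraction_perturbation:
  fixes W :: "'a::complex_hilbert \<Rightarrow> 'a"
  assumes W: "clin W" "\<And>u. norm (W u) \<le> norm u" and ab: "cmod b < cmod a"
  shows "(cmod a - cmod b) * norm v \<le> norm (a *\<^sub>C v + b *\<^sub>C W v)"
    and "\<exists>v. a *\<^sub>C v + b *\<^sub>C W v = u"
proof -
  have "cmod a * norm v = norm (a *\<^sub>C v)" by simp
  also have "\<dots> \<le> norm (a *\<^sub>C v + b *\<^sub>C W v) + norm (b *\<^sub>C W v)"
    by (metis add_diff_cancel_right' norm_triangle_ineq4)
  also have "norm (b *\<^sub>C W v) \<le> cmod b * norm v" using W(2)[of v] by (simp add: mult_left_mono)
  finally show "(cmod a - cmod b) * norm v \<le> norm (a *\<^sub>C v + b *\<^sub>C W v)"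
    by (simp add: left_diff_distrib)
  have a0: "a \<noteq> 0" using ab by auto
  define f where "f v = (1 / a) *\<^sub>C (u - b *\<^sub>C W v)" for v
  have "dist (f v) (f w) \<le> cmod (b / a) * dist v w" for v w
  proof -
    have "f v - f w = (b / a) *\<^sub>C W (w - v)"
      by (simp add: f_def clin_diff[OF W(1)] scaleC_simps algebra_simps)
    then show ?thesis
      using W(2)[of "w - v"] by (simp add: dist_norm mult_left_mono norm_minus_commute)
  qed
  then obtain v where "f v = v"
    using banach_fix_type[of "cmod (b / a)" f] ab a0 by (auto simp: norm_divide)
  then have "a *\<^sub>C v = u - b *\<^sub>C W v"
    using a0 unfolding f_def by (metis scaleC_scaleC nonzero_eq_divide_eq times_divide_eq_right mult.right_neutral mult.commute scaleC_one)
  then show "\<exists>v. a *\<^sub>C v + b *\<^sub>C W v = u" by (intro exI[of _ v]) simp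
qed

section \<open>Differentiability in the operator norm\<close>

text \<open>Derivative in operator norm, since one neighbourhood serves all u. The remainder form
  avoids dividing by w - z; linearity and boundedness of the derivative are derived from those of
  the values.\<close>

definition has_op_derivative :: "(complex \<Rightarrow> 'a::complex_inner \<Rightarrow> 'b::complex_inner) \<Rightarrow> ('a \<Rightarrow> 'b) \<Rightarrow> complex \<Rightarrow> bool" where
  "has_op_derivative \<Phi> G z \<longleftrightarrow> (\<forall>e>0. \<forall>\<^sub>F w in at z. \<forall>u.
     norm (\<Phi> w u - \<Phi> z u - (w - z) *\<^sub>C G u) \<le> e * cmod (w - z) * norm u)"

lemma has_op_derivativeD:
  "has_op_derivative \<Phi> G z \<Longrightarrow> e > 0 \<Longrightarrow>
    \<forall>\<^sub>F w in at z. \<forall>u. norm (\<Phi> w u - \<Phi> z u - (w - z) *\<^sub>C G u) \<le> e * cmod (w - z) * norm u"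
  by (simp add: has_op_derivative_def)

lemma mult_half_cancel: "c \<noteq> 0 \<Longrightarrow> c * (e / (2 * c)) = e / (2::real)"
  by simp

text \<open>Translates between the difference quotients in which analyticity of parameters is stated
  and the remainder form used in this section.\<close>

lemma quotient_remainder:
  assumes "w \<noteq> z"
  shows "norm (inverse (w - z) *\<^sub>C (a - b) - (c::'a::complex_inner)) \<le> e * n \<longleftrightarrow>
    norm (a - b - (w - z) *\<^sub>C c) \<le> e * cmod (w - z) * n"
proof -
  have "(w - z) *\<^sub>C (inverse (w - z) *\<^sub>C (a - b) - c) = a - b - (w - z) *\<^sub>C c"
    using assms by (simp add: scaleC_diff_right[of _ "inverse (w - z) *\<^sub>C (a - b)"] scaleC_scaleC)
  then have "norm (a - b - (w - z) *\<^sub>C c) = cmod (w - z) * norm (inverse (w - z) *\<^sub>C (a - b) - c)"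
    by (metis norm_scaleC)
  moreover have "cmod (w - z) > 0" using assms by simp
  moreover have "e * cmod (w - z) * n = cmod (w - z) * (e * n)" by simp
  ultimately show ?thesis
    by (simp only: mult_le_cancel_left_pos)
qed

lemma has_op_derivative_vector:
  assumes "has_op_derivative \<Phi> G z"
  shows "((\<lambda>w. inverse (w - z) *\<^sub>C (\<Phi> w u - \<Phi> z u)) \<longlongrightarrow> G u) (at z)"
proof (rule tendstoI)
  fix e :: real assume e: "e > 0"
  define d where "d = e / (2 * (norm u + 1))"
  have n: "norm u + 1 > 0" by (simp add: add_nonneg_pos)
  have d: "d > 0" using e n by (simp add: d_def)
  have "d * norm u \<le> (norm u + 1) * d" using d by (simp add: algebra_simps)
  also have "\<dots> = e / 2" unfolding d_def by (rule mult_half_cancel) (use n in simp)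
  also have "\<dots> < e" using e by simp
  finally have de: "d * norm u < e" .
  have "\<forall>\<^sub>F w in at z. w \<noteq> z" by (simp add: eventually_at_filter)
  with has_op_derivativeD[OF assms d]
  show "\<forall>\<^sub>F w in at z. dist (inverse (w - z) *\<^sub>C (\<Phi> w u - \<Phi> z u)) (G u) < e"
  proof eventually_elim
    case (elim w)
    then show ?case using quotient_remainder[of w z "\<Phi> w u" "\<Phi> z u" "G u" d "norm u"] de
      by (auto simp: dist_norm intro: le_less_trans)
  qed
qed

lemma has_op_derivative_clin:
  assumes der: "has_op_derivative \<Phi> G z" and lin: "\<forall>\<^sub>F w in at z. clin (\<Phi> w)" "clin (\<Phi> z)"
  shows "clin G"
  unfolding clin_def
proof (intro allI)
  fix u v and a b :: complex
  let ?q = "\<lambda>u w. inverse (w - z) *\<^sub>C (\<Phi> w u - \<Phi> z u)"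
  have "((\<lambda>w. a *\<^sub>C ?q u w + b *\<^sub>C ?q v w) \<longlongrightarrow> a *\<^sub>C G u + b *\<^sub>C G v) (at z)"
    by (intro tendsto_intros has_op_derivative_vector der)
  moreover have "\<forall>\<^sub>F w in at z. a *\<^sub>C ?q u w + b *\<^sub>C ?q v w = ?q (a *\<^sub>C u + b *\<^sub>C v) w"
    using lin(1)
  proof eventually_elim
    case (elim w)
    then show ?case
      by (simp add: clinD lin(2) scaleC_simps algebra_simps)
  qed
  ultimately have "(?q (a *\<^sub>C u + b *\<^sub>C v) \<longlongrightarrow> a *\<^sub>C G u + b *\<^sub>C G v) (at z)"
    by (rule Lim_transform_eventually)
  then show "G (a *\<^sub>C u + b *\<^sub>C v) = a *\<^sub>C G u + b *\<^sub>C G v"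
    using has_op_derivative_vector[OF der] tendsto_unique[OF at_neq_bot] by blast
qed

text \<open>A single point w near z suffices: the derivative is a difference quotient of two bounded
  operators up to an error of norm at most one.\<close>

lemma has_op_derivative_bounded:
  assumes der: "has_op_derivative \<Phi> G z"
    and bd: "\<forall>\<^sub>F w in at z. \<exists>K. \<forall>u. norm (\<Phi> w u) \<le> K * norm u" "\<And>u. norm (\<Phi> z u) \<le> K0 * norm u"
  obtains L where "L \<ge> 0" "\<And>u. norm (G u) \<le> L * norm u"
proof -
  have "\<forall>\<^sub>F w in at z. w \<noteq> z" by (simp add: eventually_at_filter)
  with has_op_derivativeD[OF der, of 1, simplified] bd(1)
  have "\<forall>\<^sub>F w in at z. w \<noteq> z \<and> (\<forall>u. norm (\<Phi> w u - \<Phi> z u - (w - z) *\<^sub>C G u) \<le> cmod (w - z) * norm u)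
      \<and> (\<exists>K. \<forall>u. norm (\<Phi> w u) \<le> K * norm u)"
    by eventually_elim blast
  then obtain w where w: "w \<noteq> z" "\<And>u. norm (\<Phi> w u - \<Phi> z u - (w - z) *\<^sub>C G u) \<le> cmod (w - z) * norm u"
      "\<exists>K. \<forall>u. norm (\<Phi> w u) \<le> K * norm u"
    using eventually_happens[of _ "at z"] by force
  from w(3) obtain K where K: "\<And>u. norm (\<Phi> w u) \<le> K * norm u" by blast
  let ?L = "1 + (\<bar>K\<bar> + \<bar>K0\<bar>) / cmod (w - z)"
  have "norm (G u) \<le> ?L * norm u" for u
  proof -
    have "cmod (w - z) * norm (G u) = norm ((w - z) *\<^sub>C G u)" by simp
    also have "(w - z) *\<^sub>C G u = \<Phi> w u - \<Phi> z u - (\<Phi> w u - \<Phi> z u - (w - z) *\<^sub>C G u)" by simp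
    also have "norm \<dots> \<le> norm (\<Phi> w u) + norm (\<Phi> z u) + norm (\<Phi> w u - \<Phi> z u - (w - z) *\<^sub>C G u)"
      by (meson add_mono norm_triangle_ineq4 order_refl order_trans)
    also have "\<dots> \<le> \<bar>K\<bar> * norm u + \<bar>K0\<bar> * norm u + cmod (w - z) * norm u"
      using K[of u] bd(2)[of u] w(2)[of u]
        mult_right_mono[OF abs_ge_self[of K] norm_ge_zero[of u]] mult_right_mono[OF abs_ge_self[of K0] norm_ge_zero[of u]]
      by linarith
    also have "\<dots> = cmod (w - z) * (?L * norm u)"
      using w(1) by (simp add: field_simps)
    finally show ?thesis using w(1) by (simp add: mult_le_cancel_left_pos)
  qed
  then show thesis using that[of ?L] by simp
qed

text \<open>Product rule for the expressions that occur as numerators and denominators when T(z) is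
  written through R(z) or conversely.\<close>

lemma has_op_derivative_affine:
  fixes \<Phi> :: "complex \<Rightarrow> 'a::complex_inner \<Rightarrow> 'a"
  assumes der: "has_op_derivative \<Phi> G z" and L: "L \<ge> 0" "\<And>u. norm (G u) \<le> L * norm u"
  shows "has_op_derivative (\<lambda>w u. (a + b * w) *\<^sub>C u + (c + d * w) *\<^sub>C \<Phi> w u)
    (\<lambda>u. b *\<^sub>C u + d *\<^sub>C \<Phi> z u + (c + d * z) *\<^sub>C G u) z"
  unfolding has_op_derivative_def
proof (intro allI impI)
  fix e :: real assume e: "e > 0"
  \<comment> \<open>The error is (c + d z) times the remainder of \<Phi> plus d (w - z) times the
    increment of \<Phi>; \<open>e1\<close> and \<open>e2\<close> allot each of them half of
    e.\<close>
  define k where "k = cmod (c + d * z)"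
  define e1 where "e1 = min 1 (e / (2 * (k + 1)))"
  define e2 where "e2 = e / (2 * (cmod d * (1 + L) + 1))"
  have pos: "k + 1 > 0" "cmod d * (1 + L) + 1 > 0" unfolding k_def using L by (auto intro!: add_nonneg_pos)
  then have e12: "e1 > 0" "e2 > 0" "e1 \<le> 1" using e by (auto simp: e1_def e2_def)
  have ke1: "k * e1 \<le> e / 2"
  proof -
    have "k * e1 \<le> (k + 1) * (e / (2 * (k + 1)))"
      using e12(1) pos by (intro mult_mono) (auto simp: e1_def k_def)
    also have "\<dots> = e / 2" by (rule mult_half_cancel) (use pos in simp)
    finally show ?thesis .
  qed
  have "\<forall>\<^sub>F w in at z. dist w z < e2" using e12 by (auto simp: eventually_at)
  with has_op_derivativeD[OF der e12(1)]
  show "\<forall>\<^sub>F w in at z. \<forall>u. norm ((a + b * w) *\<^sub>C u + (c + d * w) *\<^sub>C \<Phi> w u - ((a + b * z) *\<^sub>C u + (c + d * z) *\<^sub>C \<Phi> z u)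
      - (w - z) *\<^sub>C (b *\<^sub>C u + d *\<^sub>C \<Phi> z u + (c + d * z) *\<^sub>C G u)) \<le> e * cmod (w - z) * norm u"
  proof eventually_elim
    case (elim w)
    show ?case
    proof
      fix u
      let ?r = "\<Phi> w u - \<Phi> z u - (w - z) *\<^sub>C G u" and ?h = "cmod (w - z)"
      have r: "norm ?r \<le> e1 * ?h * norm u" using elim by blast
      have "norm (\<Phi> w u - \<Phi> z u) \<le> norm ?r + norm ((w - z) *\<^sub>C G u)"
        by (metis diff_add_cancel norm_triangle_ineq)
      also have "\<dots> \<le> 1 * ?h * norm u + ?h * (L * norm u)"
        proof (rule add_mono)
          show "norm ?r \<le> 1 * ?h * norm u"
            by (rule order_trans[OF r mult_right_mono[OF mult_right_mono[OF e12(3)]]]) auto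
          show "norm ((w - z) *\<^sub>C G u) \<le> ?h * (L * norm u)"
            unfolding norm_scaleC by (rule mult_left_mono[OF L(2)]) simp
        qed
      finally have D: "norm (\<Phi> w u - \<Phi> z u) \<le> (1 + L) * ?h * norm u"
        by (simp add: algebra_simps)
      have "(a + b * w) *\<^sub>C u + (c + d * w) *\<^sub>C \<Phi> w u - ((a + b * z) *\<^sub>C u + (c + d * z) *\<^sub>C \<Phi> z u)
          - (w - z) *\<^sub>C (b *\<^sub>C u + d *\<^sub>C \<Phi> z u + (c + d * z) *\<^sub>C G u)
        = (c + d * z) *\<^sub>C ?r + (d * (w - z)) *\<^sub>C (\<Phi> w u - \<Phi> z u)"
        by (simp add: scaleC_simps algebra_simps)
      also have "norm \<dots> \<le> k * (e1 * ?h * norm u) + (cmod d * ?h) * ((1 + L) * ?h * norm u)"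
        using r D by (intro order_trans[OF norm_triangle_ineq] add_mono)
          (auto simp: k_def norm_mult intro!: mult_left_mono)
      also have "\<dots> = (k * e1 + cmod d * (1 + L) * ?h) * (?h * norm u)" by (simp add: algebra_simps)
      also have "\<dots> \<le> e * (?h * norm u)"
      proof (intro mult_right_mono)
        have "cmod d * (1 + L) * ?h \<le> (cmod d * (1 + L) + 1) * e2"
          using elim(2) pos L by (intro mult_mono) (auto simp: dist_norm)
        also have "\<dots> = e / 2" unfolding e2_def by (rule mult_half_cancel) (use pos in simp)
        finally show "k * e1 + cmod d * (1 + L) * ?h \<le> e" using ke1 by simp
      qed simp
      finally show "norm ((a + b * w) *\<^sub>C u + (c + d * w) *\<^sub>C \<Phi> w u - ((a + b * z) *\<^sub>C u + (c + d * z) *\<^sub>C \<Phi> z u)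
          - (w - z) *\<^sub>C (b *\<^sub>C u + d *\<^sub>C \<Phi> z u + (c + d * z) *\<^sub>C G u)) \<le> e * cmod (w - z) * norm u"
        by (simp add: mult.assoc)
    qed
  qed
qed

text \<open>\<open>E = Q P\<^sup>-\<^sup>1\<close>, where the inverse of \<open>P\<close> is given only implicitly.\<close>

lemma has_op_derivative_quotient:
  fixes P Q E :: "complex \<Rightarrow> 'a::complex_inner \<Rightarrow> 'a"
  assumes P: "has_op_derivative P P' z" "clin P'" "\<And>u. norm (P' u) \<le> Lp * norm u" "Lp \<ge> 0" "clin (P z)"
    and Q: "has_op_derivative Q Q' z" "clin Q'" "\<And>u. norm (Q' u) \<le> Lq * norm u" "Lq \<ge> 0"
    and E: "clin (E z)" "\<And>u. norm (E z u) \<le> Ke * norm u" "Ke \<ge> 0"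
    and K: "K \<ge> 0" "\<And>u. norm u \<le> K * norm (P z u)" "\<And>v. \<exists>u. P z u = v" "\<And>u. E z (P z u) = Q z u"
    and ev: "\<forall>\<^sub>F w in at z. (\<forall>u. norm u \<le> K * norm (P w u)) \<and> (\<forall>v. \<exists>u. P w u = v) \<and> (\<forall>u. E w (P w u) = Q w u)"
  shows "\<exists>G. has_op_derivative E G z"
proof -
  obtain J where J: "\<And>v. P z (J v) = v" using K(3) by metis
  \<comment> \<open>Differentiating E P = Q gives E' P = Q' - E P', so the derivative sought is
    \<open>X\<close> after the inverse of P(z).\<close>
  define X where "X u = Q' u - E z (P' u)" for u
  have X_diff: "X (u - v) = X u - X v" for u v
    by (simp add: X_def clin_diff[OF P(2)] clin_diff[OF Q(2)] clin_diff[OF E(1)])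
  have X_bd: "norm (X u) \<le> (Lq + Ke * Lp) * norm u" for u
  proof -
    have "norm (X u) \<le> norm (Q' u) + norm (E z (P' u))" unfolding X_def by (rule norm_triangle_ineq4)
    also have "\<dots> \<le> Lq * norm u + Ke * (Lp * norm u)"
      using Q(3)[of u] order_trans[OF E(2) mult_left_mono[OF P(3) E(3)], of u] by (intro add_mono) auto
    finally show ?thesis by (simp add: algebra_simps)
  qed
  have "has_op_derivative E (\<lambda>v. X (J v)) z"
    unfolding has_op_derivative_def
  proof (intro allI impI)
    fix e :: real assume e: "e > 0"
    \<comment> \<open>\<open>C1\<close> collects the remainders of P and Q; \<open>C2\<close>
      collects the effect of replacing the preimage of v under P(z) by the preimage u under
      P(w).\<close>
    define C1 where "C1 = (1 + Ke) * K"
    define C2 where "C2 = (Lq + Ke * Lp) * K * (1 + Lp) * K"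
    have C: "C1 \<ge> 0" "C2 \<ge> 0" using P(4) Q(4) E(3) K(1) by (auto simp: C1_def C2_def)
    define e1 where "e1 = min 1 (e / (2 * (C1 + 1)))"
    define e2 where "e2 = e / (2 * (C2 + 1))"
    have e12: "e1 > 0" "e2 > 0" "e1 \<le> 1" using e C by (auto simp: e1_def e2_def)
    have b1: "C1 * e1 \<le> e / 2"
    proof -
      have "C1 * e1 \<le> (C1 + 1) * (e / (2 * (C1 + 1)))"
        using e12 C by (intro mult_mono) (auto simp: e1_def)
      also have "\<dots> = e / 2" by (rule mult_half_cancel) (use C in simp)
      finally show ?thesis .
    qed
    have "\<forall>\<^sub>F w in at z. dist w z < e2" using e12 by (auto simp: eventually_at)
    with has_op_derivativeD[OF P(1) e12(1)] has_op_derivativeD[OF Q(1) e12(1)] ev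
    show "\<forall>\<^sub>F w in at z. \<forall>v. norm (E w v - E z v - (w - z) *\<^sub>C X (J v)) \<le> e * cmod (w - z) * norm v"
    proof eventually_elim
      case (elim w)
      show ?case
      proof
        fix v
        obtain u where u: "P w u = v" using elim(3) by blast
        let ?h = "cmod (w - z)"
        let ?rp = "P w u - P z u - (w - z) *\<^sub>C P' u" and ?rq = "Q w u - Q z u - (w - z) *\<^sub>C Q' u"
        have rp: "norm ?rp \<le> e1 * ?h * norm u" and rq: "norm ?rq \<le> e1 * ?h * norm u"
          using elim(1,2) by blast+
        have nu: "norm u \<le> K * norm v" using elim(3) u by blast
        have "norm (P w u - P z u) \<le> norm ?rp + norm ((w - z) *\<^sub>C P' u)"
          by (metis diff_add_cancel norm_triangle_ineq)
        also have "\<dots> \<le> 1 * ?h * norm u + ?h * (Lp * norm u)"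
        proof (rule add_mono)
          show "norm ?rp \<le> 1 * ?h * norm u"
            by (rule order_trans[OF rp mult_right_mono[OF mult_right_mono[OF e12(3)]]]) auto
          show "norm ((w - z) *\<^sub>C P' u) \<le> ?h * (Lp * norm u)"
            unfolding norm_scaleC by (rule mult_left_mono[OF P(3)]) simp
        qed
        also have "\<dots> = (1 + Lp) * ?h * norm u" by (simp add: algebra_simps)
        finally have D: "norm (P w u - P z u) \<le> (1 + Lp) * ?h * norm u" .
        have "norm (u - J v) \<le> K * norm (P z (u - J v))" by (rule K(2))
        also have "P z (u - J v) = - (P w u - P z u)" by (simp add: clin_diff[OF P(5)] J u)
        also have "norm (- (P w u - P z u)) = norm (P w u - P z u)" by (rule norm_minus_cancel)
        also have "K * norm (P w u - P z u) \<le> K * ((1 + Lp) * ?h * norm u)"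
          using D K(1) by (rule mult_left_mono)
        finally have uJ: "norm (u - J v) \<le> K * ((1 + Lp) * ?h * norm u)" .
        have "E w v - E z v - (w - z) *\<^sub>C X (J v) = ?rq - E z ?rp + (w - z) *\<^sub>C X (u - J v)"
        proof -
          have "E w v = Q w u" "E z v = E z (P w u)" using elim(3) u by auto
          then show ?thesis
            by (simp add: X_diff clin_diff[OF E(1)] clin_scaleC[OF E(1)] K(4) scaleC_simps)
               (simp add: X_def scaleC_simps)
        qed
        also have "norm \<dots> \<le> norm ?rq + norm (E z ?rp) + norm ((w - z) *\<^sub>C X (u - J v))"
          by (meson add_right_mono norm_triangle_ineq norm_triangle_ineq4 order_trans)
        also have "\<dots> \<le> e1 * ?h * norm u + Ke * (e1 * ?h * norm u)
            + ?h * ((Lq + Ke * Lp) * (K * ((1 + Lp) * ?h * norm u)))"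
        proof (intro add_mono rq)
          show "norm (E z ?rp) \<le> Ke * (e1 * ?h * norm u)"
            by (rule order_trans[OF E(2) mult_left_mono[OF rp E(3)]])
          have "norm (X (u - J v)) \<le> (Lq + Ke * Lp) * (K * ((1 + Lp) * ?h * norm u))"
            using P(4) Q(4) E(3) by (intro order_trans[OF X_bd mult_left_mono[OF uJ]]) auto
          then show "norm ((w - z) *\<^sub>C X (u - J v)) \<le> ?h * ((Lq + Ke * Lp) * (K * ((1 + Lp) * ?h * norm u)))"
            by (simp add: mult_left_mono)
        qed
        also have "\<dots> = ((1 + Ke) * e1 + (Lq + Ke * Lp) * K * (1 + Lp) * ?h) * ?h * norm u"
          by (simp add: algebra_simps)
        also have "\<dots> \<le> ((1 + Ke) * e1 + (Lq + Ke * Lp) * K * (1 + Lp) * ?h) * ?h * (K * norm v)"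
          using nu e12 P(4) Q(4) E(3) K(1) by (intro mult_left_mono) auto
        also have "\<dots> = (C1 * e1 + C2 * ?h) * (?h * norm v)"
          by (simp add: C1_def C2_def algebra_simps)
        also have "\<dots> \<le> e * (?h * norm v)"
        proof (intro mult_right_mono)
          have "C2 * ?h \<le> (C2 + 1) * e2" using elim(4) C by (intro mult_mono) (auto simp: dist_norm)
          also have "\<dots> = e / 2" unfolding e2_def by (rule mult_half_cancel) (use C in simp)
          finally show "C1 * e1 + C2 * ?h \<le> e" using b1 by simp
        qed simp
        finally show "norm (E w v - E z v - (w - z) *\<^sub>C X (J v)) \<le> e * ?h * norm v" by (simp add: mult.assoc)
      qed
    qed
  qed
  then show ?thesis by blast
qed

lemma has_op_derivative_cinner:
  assumes "has_op_derivative \<Phi> G z"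
  shows "((\<lambda>w. cinner (\<Phi> w u) v) has_field_derivative cinner (G u) v) (at z)"
proof -
  have "((\<lambda>w. cinner (inverse (w - z) *\<^sub>C (\<Phi> w u - \<Phi> z u)) v) \<longlongrightarrow> cinner (G u) v) (at z)"
    by (intro tendsto_intros has_op_derivative_vector[OF assms])
  moreover have "cinner (inverse (w - z) *\<^sub>C (\<Phi> w u - \<Phi> z u)) v = (cinner (\<Phi> w u) v - cinner (\<Phi> z u) v) / (w - z)" for w
    by (simp add: cinner_simps field_simps)
  ultimately show ?thesis
    by (simp add: has_field_derivative_iff)
qed

section \<open>Quasi-selfadjoint extensions and contractions\<close>

lemma scaleC_comb:
  "a *\<^sub>C (u + c *\<^sub>C r) + b *\<^sub>C (v + d *\<^sub>C (s::'a::complex_inner)) = a *\<^sub>C u + b *\<^sub>C v + ((a * c) *\<^sub>C r + (b * d) *\<^sub>C s)"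
  by (simp add: scaleC_add_right scaleC_scaleC add_ac)

text \<open>For a contraction, |T w| = |w| forces T* T w = w: in the comparison of the norms at w +
  s e v the terms constant in s cancel, and small s decides the sign of the linear term.\<close>

lemma contraction_isometric_vector:
  assumes T: "clin T" "\<And>u. norm (T u) \<le> norm u" and w: "norm (T w) = norm w"
  shows "cinner (T v) (T w) = cinner v (w::'a::complex_inner)"
proof -
  have "cmod (cinner (T v) (T w) - cinner v w) \<le> 0"
  proof (rule cmod_le_of_Re_le)
    fix e :: complex assume e: "cmod e = 1"
    define r where "r = Re (e * (cinner (T v) (T w) - cinner v w))"
    \<comment> \<open>Written as a product with the constant 0 so that the discriminant argument
      yields r <= 0.\<close>
    have "1 * r \<le> 0 * norm v"
    proof (rule le_mult_of_scaled_le)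
      fix s :: real assume "s > 0"
      have "(norm (T (w + (of_real s * e) *\<^sub>C v)))\<^sup>2 \<le> (norm (w + (of_real s * e) *\<^sub>C v))\<^sup>2"
        by (intro power_mono T) auto
      moreover have "(norm (T (w + (of_real s * e) *\<^sub>C v)))\<^sup>2
          = (norm w)\<^sup>2 + s\<^sup>2 * (norm (T v))\<^sup>2 + 2 * s * Re (e * cinner (T v) (T w))"
        unfolding clin_add[OF T(1)] clin_scaleC[OF T(1)] add.commute[of "T w"]
        by (simp add: norm_sq_add e norm_mult power_mult_distrib cinner_simps w right_diff_distrib)
      moreover have "(norm (w + (of_real s * e) *\<^sub>C v))\<^sup>2
          = (norm w)\<^sup>2 + s\<^sup>2 * (norm v)\<^sup>2 + 2 * s * Re (e * cinner v w)"
        unfolding add.commute[of w]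
        by (simp add: norm_sq_add e norm_mult power_mult_distrib cinner_simps right_diff_distrib)
      moreover obtain q where q: "s\<^sup>2 * (norm (T v))\<^sup>2 = q" by simp
      moreover have "q \<ge> 0" unfolding q[symmetric] by simp
      ultimately show "2 * s * (1 * r) \<le> 0\<^sup>2 + s\<^sup>2 * (norm v)\<^sup>2"
        by (simp add: r_def right_diff_distrib)
    qed auto
    then show "Re (e * (cinner (T v) (T w) - cinner v w)) \<le> 0" by (simp add: r_def)
  qed
  then show ?thesis by simp
qed

text \<open>The pair \<open>(T, R)\<close> is a contraction together with the resolvent at \<open>z\<close> of its inverse Cayley
  transform \<open>\<i> (T + 1) (T - 1)\<^sup>-\<^sup>1\<close>, which may be a proper relation.\<close>

definition cayley_pair :: "complex \<Rightarrow> ('a::complex_inner \<Rightarrow> 'a) \<Rightarrow> ('a \<Rightarrow> 'a) \<Rightarrow> bool" where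
  "cayley_pair z T R \<longleftrightarrow> clin T \<and> (\<forall>u. norm (T u) \<le> norm u) \<and> clin R \<and>
    (\<forall>u. T (u + (z - \<i>) *\<^sub>C R u) = u + (z + \<i>) *\<^sub>C R u) \<and> (\<forall>v. \<exists>u. v = u + (z - \<i>) *\<^sub>C R u)"

lemma cayley_pairD:
  assumes "cayley_pair z T R"
  shows "clin T" "norm (T u) \<le> norm u" "clin R" "T (u + (z - \<i>) *\<^sub>C R u) = u + (z + \<i>) *\<^sub>C R u"
    "\<exists>u. v = u + (z - \<i>) *\<^sub>C R u"
  using assms by (auto simp: cayley_pair_def)

text \<open>The equations v = u + (z - \<i>) R u and T v = u + (z + \<i>) R u form a linear system
  for u and R u; these coefficients are the ones that eliminate R u.\<close>

lemma cayley_pair_forward: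
  assumes "cayley_pair z T R"
  shows "((1 - \<i> * z) / 2) *\<^sub>C (u + (z - \<i>) *\<^sub>C R u) + ((1 + \<i> * z) / 2) *\<^sub>C T (u + (z - \<i>) *\<^sub>C R u) = u"
proof -
  have "((1 - \<i> * z) / 2) *\<^sub>C (u + (z - \<i>) *\<^sub>C R u) + ((1 + \<i> * z) / 2) *\<^sub>C T (u + (z - \<i>) *\<^sub>C R u)
     = ((1 - \<i> * z) / 2 + (1 + \<i> * z) / 2) *\<^sub>C u + ((1 - \<i> * z) / 2 * (z - \<i>) + (1 + \<i> * z) / 2 * (z + \<i>)) *\<^sub>C R u"
    unfolding cayley_pairD(4)[OF assms] by (simp only: scaleC_comb, simp only: scaleC_add_left)
  also have "(1 - \<i> * z) / 2 + (1 + \<i> * z) / 2 = 1" by (simp add: field_simps)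
  also have "(1 - \<i> * z) / 2 * (z - \<i>) + (1 + \<i> * z) / 2 * (z + \<i>) = 0" by (simp add: field_simps)
  finally show ?thesis by simp
qed

text \<open>The same system read from v: u is the combination above, and R u comes from T v - v = 2
  \<i> R u.\<close>

lemma cayley_pair_inverse:
  assumes "cayley_pair z T R"
  shows "R (((1 - \<i> * z) / 2) *\<^sub>C v + ((1 + \<i> * z) / 2) *\<^sub>C T v) = (1 / (2 * \<i>)) *\<^sub>C (T v - v)"
    "v = (((1 - \<i> * z) / 2) *\<^sub>C v + ((1 + \<i> * z) / 2) *\<^sub>C T v)
       + (z - \<i>) *\<^sub>C R (((1 - \<i> * z) / 2) *\<^sub>C v + ((1 + \<i> * z) / 2) *\<^sub>C T v)"
proof -
  obtain u where u: "v = u + (z - \<i>) *\<^sub>C R u" using cayley_pairD(5)[OF assms] by blast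
  have T: "T v = u + (z + \<i>) *\<^sub>C R u" unfolding u by (rule cayley_pairD(4)[OF assms])
  have eq: "((1 - \<i> * z) / 2) *\<^sub>C v + ((1 + \<i> * z) / 2) *\<^sub>C T v = u"
    unfolding u by (rule cayley_pair_forward[OF assms])
  have "T v - v = (2 * \<i>) *\<^sub>C R u"
    unfolding T unfolding u by (simp add: scaleC_simps algebra_simps flip: scaleC_add_left)
  then show "R (((1 - \<i> * z) / 2) *\<^sub>C v + ((1 + \<i> * z) / 2) *\<^sub>C T v) = (1 / (2 * \<i>)) *\<^sub>C (T v - v)"
    unfolding eq by (simp add: scaleC_scaleC)
  show "v = (((1 - \<i> * z) / 2) *\<^sub>C v + ((1 + \<i> * z) / 2) *\<^sub>C T v)
       + (z - \<i>) *\<^sub>C R (((1 - \<i> * z) / 2) *\<^sub>C v + ((1 + \<i> * z) / 2) *\<^sub>C T v)"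
    unfolding eq by (rule u)
qed

text \<open>A point of the upper half-plane is nearer to \<i> than to -\<i>. This strictness makes
  the perturbations of the identity invertible in both directions of the transform.\<close>

lemma cmod_add_gt_diff:
  assumes "Im z > 0"
  shows "cmod (z - \<i>) < cmod (z + \<i>)" "cmod ((1 + \<i> * z) / 2) < cmod ((1 - \<i> * z) / 2)"
proof -
  show *: "cmod (z - \<i>) < cmod (z + \<i>)"
    using assms by (simp add: cmod_def power2_eq_square algebra_simps)
  have "1 + \<i> * z = \<i> * (z - \<i>)" "1 - \<i> * z = - \<i> * (z + \<i>)" by (simp_all add: algebra_simps)
  then show "cmod ((1 + \<i> * z) / 2) < cmod ((1 - \<i> * z) / 2)"
    using * by (simp add: norm_divide norm_mult)
qed

text \<open>With P v = u and Q v = R u the operator sought is Q P^-1, and P is bijective as a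
  perturbation of a multiple of the identity by a contraction.\<close>

lemma cayley_pair_of_contraction:
  fixes T :: "'a::complex_hilbert \<Rightarrow> 'a"
  assumes T: "clin T" "\<And>u. norm (T u) \<le> norm u" and z: "Im z > 0"
  shows "\<exists>R. cayley_pair z T R"
proof -
  let ?a = "(1 - \<i> * z) / 2" and ?b = "(1 + \<i> * z) / 2"
  let ?P = "\<lambda>v. ?a *\<^sub>C v + ?b *\<^sub>C T v" and ?Q = "\<lambda>v. (1 / (2 * \<i>)) *\<^sub>C (T v - v)"
  note ab = contraction_perturbation[OF T cmod_add_gt_diff(2)[OF z]]
  have d: "cmod ?a - cmod ?b > 0" using cmod_add_gt_diff(2)[OF z] by simp
  have P_lin: "?P (a *\<^sub>C u + b *\<^sub>C v) = a *\<^sub>C ?P u + b *\<^sub>C ?P v" for a b u v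
    by (simp add: clinD[OF T(1)] scaleC_simps mult_ac)
  have Q_lin: "?Q (a *\<^sub>C u + b *\<^sub>C v) = a *\<^sub>C ?Q u + b *\<^sub>C ?Q v" for a b u v
    by (simp add: clinD[OF T(1)] scaleC_simps mult_ac)
  define G where "G = range (\<lambda>v. (?P v, ?Q v))"
  have "clin_rel G"
    unfolding clin_rel_def
  proof (intro conjI allI impI)
    show "(0, 0) \<in> G"
      unfolding G_def by (rule range_eqI[of _ _ 0]) (simp add: clin_0[OF T(1)])
    fix f g f' g' a b assume "(f, g) \<in> G" "(f', g') \<in> G"
    then obtain u v where "(f, g) = (?P u, ?Q u)" "(f', g') = (?P v, ?Q v)" unfolding G_def by (elim rangeE)
    then have "f = ?P u" "g = ?Q u" "f' = ?P v" "g' = ?Q v" unfolding prod.inject by blast+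
    then show "(a *\<^sub>C f + b *\<^sub>C f', a *\<^sub>C g + b *\<^sub>C g') \<in> G"
      unfolding G_def by (intro range_eqI[of _ _ "a *\<^sub>C u + b *\<^sub>C v"]) (simp only: P_lin Q_lin)
  qed
  moreover have "norm g \<le> (1 / (cmod ?a - cmod ?b)) * norm f" if fg: "(f, g) \<in> G" for f g
  proof -
    obtain v where "(f, g) = (?P v, ?Q v)" using fg unfolding G_def by (elim rangeE)
    then have v: "f = ?P v" "g = ?Q v" unfolding prod.inject by blast+
    have "norm g = norm (T v - v) / 2" unfolding v by (simp add: norm_divide norm_mult)
    also have "\<dots> \<le> norm v" using norm_triangle_ineq4[of "T v" v] T(2)[of v] by linarith
    also have "\<dots> \<le> (1 / (cmod ?a - cmod ?b)) * norm f"
      using ab(1)[of v] d unfolding v by (simp add: pos_le_divide_eq mult.commute)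
    finally show ?thesis .
  qed
  moreover have "\<exists>g. (f, g) \<in> G" for f
    using ab(2)[of f] unfolding G_def by blast
  ultimately have "\<exists>R. clin R \<and> (\<forall>u. norm (R u) \<le> (1 / (cmod ?a - cmod ?b)) * norm u) \<and> (\<forall>f g. (f, g) \<in> G \<longleftrightarrow> g = R f)"
    by (rule operator_of_total_relation)
  then obtain R where R: "clin R" "\<And>f g. (f, g) \<in> G \<longleftrightarrow> g = R f" by metis
  have RP: "R (?P v) = ?Q v" for v
  proof -
    have "(?P v, ?Q v) \<in> G" unfolding G_def by (rule rangeI)
    from R(2)[THEN iffD1, OF this] show ?thesis by (rule sym)
  qed
  have v: "v = ?P v + (z - \<i>) *\<^sub>C R (?P v)" and Tv: "T v = ?P v + (z + \<i>) *\<^sub>C R (?P v)" for v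
  proof -
    have "?P v + (z - \<i>) *\<^sub>C R (?P v) = (?a - (z - \<i>) / (2 * \<i>)) *\<^sub>C v + (?b + (z - \<i>) / (2 * \<i>)) *\<^sub>C T v"
      unfolding RP by (simp add: scaleC_simps mult.commute)
    also have "?a - (z - \<i>) / (2 * \<i>) = 1" by (simp add: field_simps)
    also have "?b + (z - \<i>) / (2 * \<i>) = 0" by (simp add: field_simps)
    finally show "v = ?P v + (z - \<i>) *\<^sub>C R (?P v)" by simp
    have "?P v + (z + \<i>) *\<^sub>C R (?P v) = (?a - (z + \<i>) / (2 * \<i>)) *\<^sub>C v + (?b + (z + \<i>) / (2 * \<i>)) *\<^sub>C T v"
      unfolding RP by (simp add: scaleC_simps mult.commute)
    also have "?a - (z + \<i>) / (2 * \<i>) = 0" by (simp add: field_simps)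
    also have "?b + (z + \<i>) / (2 * \<i>) = 1" by (simp add: field_simps)
    finally show "T v = ?P v + (z + \<i>) *\<^sub>C R (?P v)" by simp
  qed
  have "T (u + (z - \<i>) *\<^sub>C R u) = u + (z + \<i>) *\<^sub>C R u" for u
  proof -
    from ab(2)[of u] obtain v where v0: "?P v = u" ..
    show ?thesis using v[of v] Tv[of v] unfolding v0 by simp
  qed
  then show ?thesis
    using T R(1) v unfolding cayley_pair_def by blast
qed

text \<open>Both vectors have the form w + \<i> r or w - \<i> r with w = u + z r, so only the cross
  term survives. For r = R u it says that T is a contraction exactly when R satisfies the
  dissipativity inequality.\<close>

lemma norm_sq_cayley_diff:
  "(norm (u + (z + \<i>) *\<^sub>C r))\<^sup>2 - (norm (u + (z - \<i>) *\<^sub>C r))\<^sup>2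
     = 4 * (Im z * (norm r)\<^sup>2 - Im (cinner r (u::'a::complex_inner)))"
proof -
  have "(norm (u + (z + \<i>) *\<^sub>C r))\<^sup>2 = (norm ((u + z *\<^sub>C r) + \<i> *\<^sub>C r))\<^sup>2"
    "(norm (u + (z - \<i>) *\<^sub>C r))\<^sup>2 = (norm ((u + z *\<^sub>C r) - \<i> *\<^sub>C r))\<^sup>2"
    by (simp_all add: scaleC_simps algebra_simps)
  then have "(norm (u + (z + \<i>) *\<^sub>C r))\<^sup>2 - (norm (u + (z - \<i>) *\<^sub>C r))\<^sup>2 = 4 * Re (cinner (u + z *\<^sub>C r) (\<i> *\<^sub>C r))"
    by (simp add: norm_sq_add norm_sq_diff)
  also have "Re (cinner (u + z *\<^sub>C r) (\<i> *\<^sub>C r)) = Im (cinner u r) + Im z * (norm r)\<^sup>2"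
    by (simp add: cinner_simps cinner_self)
  finally show ?thesis using Im_cinner_commute[of u r] by simp
qed

lemma cayley_pair_dissipative:
  assumes "cayley_pair z T R"
  shows "Im z * (norm (R u))\<^sup>2 \<le> Im (cinner (R u) u)"
proof -
  have "norm (u + (z + \<i>) *\<^sub>C R u) \<le> norm (u + (z - \<i>) *\<^sub>C R u)"
    using cayley_pairD(2)[OF assms, of "u + (z - \<i>) *\<^sub>C R u"] cayley_pairD(4)[OF assms, of u] by simp
  then have "(norm (u + (z + \<i>) *\<^sub>C R u))\<^sup>2 \<le> (norm (u + (z - \<i>) *\<^sub>C R u))\<^sup>2"
    by (intro power_mono) auto
  then have "4 * (Im z * (norm (R u))\<^sup>2 - Im (cinner (R u) u)) \<le> 0"
    unfolding norm_sq_cayley_diff[symmetric] by simp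
  then show ?thesis by simp
qed

lemma dissipative_bound:
  assumes "Im z * (norm r)\<^sup>2 \<le> Im (cinner r (u::'a::complex_inner))" "Im z > 0"
  shows "norm r \<le> (1 / Im z) * norm u"
proof -
  have "Im z * (norm r)\<^sup>2 \<le> norm r * norm u"
    using assms(1) abs_Im_le_cmod[of "cinner r u"] cinner_Cauchy_Schwarz[of r u] by linarith
  then have "norm r * (Im z * norm r) \<le> norm r * norm u" by (simp add: power2_eq_square mult_ac)
  then have "Im z * norm r \<le> norm u" by (cases "r = 0") (simp_all add: mult_le_cancel_left_pos)
  then show ?thesis using assms(2) by (simp add: pos_le_divide_eq mult.commute)
qed

text \<open>Surjectivity of 1 + (z - \<i>) R has to be derived from the inequality. \<open>W\<close>
  = 1 + (z - cnj z) R, the Cayley transform taken at z instead of \<i>, is a contraction, and 1 + (z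
  - \<i>) R = a + b W with a + b = 1 and |b| < |a|.\<close>

lemma cayley_pair_of_dissipative:
  fixes R :: "'a::complex_hilbert \<Rightarrow> 'a"
  assumes R: "clin R" "\<And>u. Im z * (norm (R u))\<^sup>2 \<le> Im (cinner (R u) u)" and z: "Im z > 0"
  shows "\<exists>T. cayley_pair z T R"
proof -
  define W where "W u = u + (2 * \<i> * of_real (Im z)) *\<^sub>C R u" for u
  have W_lin: "clin W"
    unfolding clin_def W_def by (simp add: clinD[OF R(1)] scaleC_simps mult_ac)
  have W_bd: "norm (W u) \<le> norm u" for u
  proof -
    have "(norm (W u))\<^sup>2 = (norm u)\<^sup>2 + 4 * (Im z)\<^sup>2 * (norm (R u))\<^sup>2 + 4 * Im z * Im (cinner u (R u))"
      unfolding W_def by (simp add: norm_sq_add cinner_simps norm_mult power_mult_distrib)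
    also have "\<dots> = (norm u)\<^sup>2 + 4 * Im z * (Im z * (norm (R u))\<^sup>2 - Im (cinner (R u) u))"
      using Im_cinner_commute[of u "R u"] by (simp add: power2_eq_square algebra_simps)
    also have "\<dots> \<le> (norm u)\<^sup>2"
      using R(2)[of u] z by (simp add: mult_nonneg_nonpos)
    finally show ?thesis by simp
  qed
  define a where "a = (\<i> - cnj z) / (2 * \<i> * of_real (Im z))"
  define b where "b = (z - \<i>) / (2 * \<i> * of_real (Im z))"
  have "cmod (\<i> - cnj z) = cmod (z + \<i>)"
    by (simp add: cmod_def power2_eq_square algebra_simps)
  then have ab: "cmod b < cmod a"
    using cmod_add_gt_diff(1)[OF z] z by (simp add: a_def b_def norm_divide divide_strict_right_mono)
  have P: "a *\<^sub>C u + b *\<^sub>C W u = u + (z - \<i>) *\<^sub>C R u" for u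
  proof -
    have "a *\<^sub>C u + b *\<^sub>C W u = (a + b) *\<^sub>C u + (b * (2 * \<i> * of_real (Im z))) *\<^sub>C R u"
      by (simp add: W_def scaleC_simps)
    also have "a + b = 1"
      using z complex_diff_cnj[of z] by (simp add: a_def b_def add_divide_distrib[symmetric])
    also have "b * (2 * \<i> * of_real (Im z)) = z - \<i>" using z by (simp add: b_def)
    finally show ?thesis by simp
  qed
  note inv = contraction_perturbation[OF W_lin W_bd ab, unfolded P]
  define G where "G = range (\<lambda>u. (u + (z - \<i>) *\<^sub>C R u, u + (z + \<i>) *\<^sub>C R u))"
  have "clin_rel G"
    unfolding clin_rel_def
  proof (intro conjI allI impI)
    show "(0, 0) \<in> G"
      unfolding G_def by (rule range_eqI[of _ _ 0]) (simp add: clin_0[OF R(1)])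
    fix f g f' g' c d assume "(f, g) \<in> G" "(f', g') \<in> G"
    then obtain u v where "(f, g) = (u + (z - \<i>) *\<^sub>C R u, u + (z + \<i>) *\<^sub>C R u)"
        "(f', g') = (v + (z - \<i>) *\<^sub>C R v, v + (z + \<i>) *\<^sub>C R v)" unfolding G_def by (elim rangeE)
    then have "f = u + (z - \<i>) *\<^sub>C R u" "g = u + (z + \<i>) *\<^sub>C R u"
        "f' = v + (z - \<i>) *\<^sub>C R v" "g' = v + (z + \<i>) *\<^sub>C R v" unfolding prod.inject by blast+
    then show "(c *\<^sub>C f + d *\<^sub>C f', c *\<^sub>C g + d *\<^sub>C g') \<in> G"
      unfolding G_def by (intro range_eqI[of _ _ "c *\<^sub>C u + d *\<^sub>C v"])
        (simp add: clinD[OF R(1)] scaleC_add_right scaleC_scaleC add_ac mult.commute[of c] mult.commute[of d])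
  qed
  moreover have "norm g \<le> 1 * norm f" if fg: "(f, g) \<in> G" for f g
  proof -
    obtain u where "(f, g) = (u + (z - \<i>) *\<^sub>C R u, u + (z + \<i>) *\<^sub>C R u)"
      using fg unfolding G_def by (elim rangeE)
    then have u: "f = u + (z - \<i>) *\<^sub>C R u" "g = u + (z + \<i>) *\<^sub>C R u" unfolding prod.inject by blast+
    have "(norm g)\<^sup>2 - (norm f)\<^sup>2 \<le> 0"
      unfolding u norm_sq_cayley_diff using R(2)[of u] by simp
    then show ?thesis by simp
  qed
  moreover have "\<exists>g. (f, g) \<in> G" for f
    using inv(2)[of f] unfolding G_def by blast
  ultimately have "\<exists>T. clin T \<and> (\<forall>u. norm (T u) \<le> 1 * norm u) \<and> (\<forall>f g. (f, g) \<in> G \<longleftrightarrow> g = T f)"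
    by (rule operator_of_total_relation)
  then obtain T where T: "clin T" "\<And>u. norm (T u) \<le> 1 * norm u" "\<And>f g. (f, g) \<in> G \<longleftrightarrow> g = T f" by metis
  have "T (u + (z - \<i>) *\<^sub>C R u) = u + (z + \<i>) *\<^sub>C R u" for u
  proof -
    have "(u + (z - \<i>) *\<^sub>C R u, u + (z + \<i>) *\<^sub>C R u) \<in> G" unfolding G_def by (rule rangeI)
    from T(3)[THEN iffD1, OF this] show ?thesis by (rule sym)
  qed
  moreover have "\<exists>u. v = u + (z - \<i>) *\<^sub>C R u" for v
    using inv(2)[of v] by (elim exE) (rule exI, erule sym)
  ultimately show ?thesis
    using T(1,2) R(1) unfolding cayley_pair_def mult_1 by (intro exI[of _ T] conjI allI)
qed

section \<open>Closed symmetric relations and the contractions extending their Cayley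
  transforms\<close>

locale closed_symmetric_relation =
  fixes B :: "('a::complex_hilbert \<times> 'a) set"
  assumes rel: "clin_rel B" and closed: "closed B"
    and sym: "\<And>f g f' g'. (f, g) \<in> B \<Longrightarrow> (f', g') \<in> B \<Longrightarrow> cinner g f' = cinner f g'"
begin

text \<open>Symmetry makes (g, f) real, so the cross term with \<i> f vanishes. The second identity
  shows that g - \<i> f determines both f and g, so the Cayley transform is an isometric
  operator.\<close>

lemma norm_cayley:
  assumes "(f, g) \<in> B"
  shows "norm (g - \<i> *\<^sub>C f) = norm (g + \<i> *\<^sub>C f)" "(norm (g - \<i> *\<^sub>C f))\<^sup>2 = (norm g)\<^sup>2 + (norm f)\<^sup>2"
proof -
  have "cinner g f = cnj (cinner g f)" using sym[OF assms assms] cinner_commute[of f g] by simp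
  then have "Im (cinner g f) = 0" by (metis complex_In_mult_cnj_zero complex_cnj_cancel_iff cnj.simps(2) neg_equal_zero)
  then have "Re (cinner g (\<i> *\<^sub>C f)) = 0" by (simp add: cinner_simps)
  then have 1: "(norm (g - \<i> *\<^sub>C f))\<^sup>2 = (norm g)\<^sup>2 + (norm f)\<^sup>2"
    and 2: "(norm (g + \<i> *\<^sub>C f))\<^sup>2 = (norm g)\<^sup>2 + (norm f)\<^sup>2"
    by (simp_all add: norm_sq_add norm_sq_diff)
  show "(norm (g - \<i> *\<^sub>C f))\<^sup>2 = (norm g)\<^sup>2 + (norm f)\<^sup>2" by (rule 1)
  from 1 2 show "norm (g - \<i> *\<^sub>C f) = norm (g + \<i> *\<^sub>C f)"
    by (metis norm_ge_zero power2_eq_iff_nonneg)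
qed

abbreviation "cayley_range \<equiv> Range (minus_scalar B \<i>)"

lemma cayley_rangeI: "(f, g) \<in> B \<Longrightarrow> g - \<i> *\<^sub>C f \<in> cayley_range"
  by (force simp: minus_scalar_def)

lemma cayley_rangeI': "(f, g) \<in> B \<Longrightarrow> g + \<i> *\<^sub>C f \<in> Range (minus_scalar B (- \<i>))"
  by (force simp: minus_scalar_def scaleC_minus_left)

lemma csubspace_cayley_range: "csubspace cayley_range"
  unfolding csubspace_def
proof (intro conjI ballI allI)
  have "(0, 0) \<in> B" using rel by (simp add: clin_rel_def)
  from cayley_rangeI[OF this] show "0 \<in> cayley_range" by simp
  fix u v a b assume "u \<in> cayley_range" "v \<in> cayley_range"
  then obtain f g f' g' where fg: "(f, g) \<in> B" "u = g - \<i> *\<^sub>C f" "(f', g') \<in> B" "v = g' - \<i> *\<^sub>C f'"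
    by (auto simp: minus_scalar_def)
  from cayley_rangeI[OF clin_relD[OF rel fg(1,3), of a b]]
  show "a *\<^sub>C u + b *\<^sub>C v \<in> cayley_range"
    unfolding fg by (simp add: scaleC_simps algebra_simps)
qed

text \<open>\<open>G\<close> is the graph of the Cayley transform, closed as a preimage of the
  relation under a continuous linear map; being isometric, it has closed domain.\<close>

lemma closed_cayley_range: "closed cayley_range"
proof -
  let ?m = "\<lambda>(a, b). ((1 / (2 * \<i>)) *\<^sub>C (b - a), (1 / 2) *\<^sub>C (a + b))"
  define G where "G = ?m -` B"
  have "closed G"
    unfolding G_def using closed by (intro closed_vimage) (auto intro!: continuous_intros simp: split_beta)
  moreover have G: "(a, b) \<in> G \<Longrightarrow> \<exists>f g. (f, g) \<in> B \<and> a = g - \<i> *\<^sub>C f \<and> b = g + \<i> *\<^sub>C f" for a b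
  proof -
    assume "(a, b) \<in> G"
    then have 1: "((1 / (2 * \<i>)) *\<^sub>C (b - a), (1 / 2) *\<^sub>C (a + b)) \<in> B" by (simp add: G_def)
    have e: "(1 / 2) *\<^sub>C (a + b) - \<i> *\<^sub>C (1 / (2 * \<i>)) *\<^sub>C (b - a) = (1 / 2 + 1 / 2) *\<^sub>C a"
      "(1 / 2) *\<^sub>C (a + b) + \<i> *\<^sub>C (1 / (2 * \<i>)) *\<^sub>C (b - a) = (1 / 2 + 1 / 2) *\<^sub>C b"
      unfolding scaleC_add_left by (simp_all add: scaleC_add_right scaleC_diff_right scaleC_scaleC)
    have "(1 / 2 + 1 / 2 :: complex) = 1" by simp
    note e = e[unfolded this scaleC_one, symmetric]
    show ?thesis using 1 e by (intro exI conjI)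
  qed
  have G': "(g - \<i> *\<^sub>C f, g + \<i> *\<^sub>C f) \<in> G" if "(f, g) \<in> B" for f g
  proof -
    have "(1 / (2 * \<i>)) *\<^sub>C ((g + \<i> *\<^sub>C f) - (g - \<i> *\<^sub>C f)) = (1 / (2 * \<i>)) *\<^sub>C (\<i> + \<i>) *\<^sub>C f"
      "(1 / 2) *\<^sub>C ((g - \<i> *\<^sub>C f) + (g + \<i> *\<^sub>C f)) = (1 / 2) *\<^sub>C (1 + 1) *\<^sub>C g"
      unfolding scaleC_add_left by (simp_all add: algebra_simps)
    then show ?thesis using that by (simp add: G_def scaleC_scaleC)
  qed
  have "closed (Domain G)"
  proof (rule closed_Domain_of_bounded[OF \<open>closed G\<close>])
    fix a b a' b' assume *: "(a, b) \<in> G" "(a', b') \<in> G"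
    from G[OF *(1)] G[OF *(2)] obtain f g f' g' where
      1: "(f, g) \<in> B" "a = g - \<i> *\<^sub>C f" "b = g + \<i> *\<^sub>C f" "(f', g') \<in> B" "a' = g' - \<i> *\<^sub>C f'" "b' = g' + \<i> *\<^sub>C f'"
      by blast
    have "a - a' = (g - g') - \<i> *\<^sub>C (f - f')" "b - b' = (g - g') + \<i> *\<^sub>C (f - f')"
      unfolding 1 by (simp_all add: scaleC_diff_right)
    then show "(a - a', b - b') \<in> G"
      using G'[OF clin_rel_diff[OF rel 1(1,4)]] by (simp only:)
  next
    fix a b assume "(a, b) \<in> G"
    from G[OF this] show "norm b \<le> 1 * norm a" using norm_cayley(1) by auto
  qed
  moreover have "Domain G = cayley_range"
  proof safe
    fix a b assume "(a, b) \<in> G"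
    from G[OF this] show "a \<in> cayley_range" using cayley_rangeI by blast
  next
    fix a b assume "(b, a) \<in> minus_scalar B \<i>"
    then obtain g where "(b, g) \<in> B" "a = g - \<i> *\<^sub>C b" by (auto simp: minus_scalar_def)
    then show "a \<in> Domain G" using G' by blast
  qed
  ultimately show ?thesis by simp
qed

text \<open>H is the orthogonal sum of the range of B - \<i> and the defect subspace; this rests on
  the closedness of that range.\<close>

lemma cayley_decomposition:
  obtains f g \<psi> where "(f, g) \<in> B" "\<psi> \<in> defect \<i> B" "v = (g - \<i> *\<^sub>C f) + \<psi>"
proof -
  obtain w where w: "w \<in> cayley_range" "v - w \<in> ortho_compl cayley_range"
    using orthogonal_projection[OF csubspace_cayley_range closed_cayley_range] by blast
  then obtain f g where "(f, g) \<in> B" "w = g - \<i> *\<^sub>C f" by (auto simp: minus_scalar_def)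
  then show thesis using that[of f g "v - w"] w(2) by (simp add: defect_def)
qed

lemma norm_sq_orthogonal: "cinner u v = 0 \<Longrightarrow> (norm (u + v))\<^sup>2 = (norm u)\<^sup>2 + (norm (v::'a))\<^sup>2"
  by (simp add: norm_sq_add)

lemma norm_sq_decomposition:
  assumes "(f, g) \<in> B" "\<psi> \<in> defect \<i> B"
  shows "(norm ((g - \<i> *\<^sub>C f) + \<psi>))\<^sup>2 = (norm (g - \<i> *\<^sub>C f))\<^sup>2 + (norm \<psi>)\<^sup>2"
  using ortho_compl_cinner[of \<psi> cayley_range, OF _ cayley_rangeI[OF assms(1)]] assms(2)
  by (intro norm_sq_orthogonal) (simp add: defect_def)

definition extends_cayley :: "('a \<Rightarrow> 'a) \<Rightarrow> bool" where
  "extends_cayley T \<longleftrightarrow> clin T \<and> (\<forall>u. norm (T u) \<le> norm u) \<and>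
    (\<forall>f g. (f, g) \<in> B \<longrightarrow> T (g - \<i> *\<^sub>C f) = g + \<i> *\<^sub>C f)"

lemma extends_cayleyD:
  assumes "extends_cayley T"
  shows "clin T" "norm (T u) \<le> norm u" "(f, g) \<in> B \<Longrightarrow> T (g - \<i> *\<^sub>C f) = g + \<i> *\<^sub>C f"
  using assms by (auto simp: extends_cayley_def)

text \<open>Orthogonal sum of the isometry from the range of B - \<i> onto that of B + \<i> with
  \<open>C\<close> between the complements; Pythagoras on both sides gives the contraction
  bound.\<close>

lemma extends_cayley_of_contraction:
  assumes C: "C \<in> contractions (defect \<i> B) (defect (- \<i>) B)"
  shows "\<exists>T. extends_cayley T \<and> (\<forall>\<psi>\<in>defect \<i> B. T \<psi> = C \<psi>)"
proof -
  have C_lin: "C (a *\<^sub>C \<phi> + b *\<^sub>C \<psi>) = a *\<^sub>C C \<phi> + b *\<^sub>C C \<psi>" if "\<phi> \<in> defect \<i> B" "\<psi> \<in> defect \<i> B" for a b \<phi> \<psi>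
    using C that by (simp add: contractions_def)
  have C_bd: "norm (C \<psi>) \<le> norm \<psi>" "C \<psi> \<in> defect (- \<i>) B" if "\<psi> \<in> defect \<i> B" for \<psi>
    using C that by (auto simp: contractions_def)
  have sub: "csubspace (defect \<i> B)" unfolding defect_def by (rule csubspace_ortho_compl)
  have C0: "C 0 = 0" using C_lin[OF csubspace_0[OF sub] csubspace_0[OF sub], of 0 0] by simp
  have B0: "(0, 0) \<in> B" using rel by (simp add: clin_rel_def)
  define G where "G = {(g - \<i> *\<^sub>C f + \<psi>, g + \<i> *\<^sub>C f + C \<psi>) | f g \<psi>. (f, g) \<in> B \<and> \<psi> \<in> defect \<i> B}"
  have "clin_rel G"
    unfolding clin_rel_def
  proof (intro conjI allI impI)
    show "(0, 0) \<in> G" unfolding G_def using B0 csubspace_0[OF sub] C0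
      by (intro CollectI exI[of _ 0]) simp
    fix a b c d s t assume "(a, b) \<in> G" "(c, d) \<in> G"
    then obtain f g \<psi> f' g' \<psi>' where
      1: "(f, g) \<in> B" "\<psi> \<in> defect \<i> B" "a = g - \<i> *\<^sub>C f + \<psi>" "b = g + \<i> *\<^sub>C f + C \<psi>" and
      2: "(f', g') \<in> B" "\<psi>' \<in> defect \<i> B" "c = g' - \<i> *\<^sub>C f' + \<psi>'" "d = g' + \<i> *\<^sub>C f' + C \<psi>'"
      unfolding G_def by auto
    have "(s *\<^sub>C f + t *\<^sub>C f', s *\<^sub>C g + t *\<^sub>C g') \<in> B" by (rule clin_relD[OF rel 1(1) 2(1)])
    moreover have "s *\<^sub>C \<psi> + t *\<^sub>C \<psi>' \<in> defect \<i> B" by (rule csubspaceD[OF sub 1(2) 2(2)])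
    ultimately show "(s *\<^sub>C a + t *\<^sub>C c, s *\<^sub>C b + t *\<^sub>C d) \<in> G"
      unfolding G_def
      by (intro CollectI exI[of _ "s *\<^sub>C f + t *\<^sub>C f'"] exI[of _ "s *\<^sub>C g + t *\<^sub>C g'"] exI[of _ "s *\<^sub>C \<psi> + t *\<^sub>C \<psi>'"])
        (simp add: 1(3,4) 2(3,4) C_lin[OF 1(2) 2(2)] scaleC_add_right scaleC_diff_right scaleC_scaleC mult.commute[of _ \<i>])
  qed
  moreover have "norm b \<le> 1 * norm a" if ab: "(a, b) \<in> G" for a b
  proof -
    obtain f g \<psi> where 1: "(f, g) \<in> B" "\<psi> \<in> defect \<i> B" "a = g - \<i> *\<^sub>C f + \<psi>" "b = g + \<i> *\<^sub>C f + C \<psi>"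
      using ab unfolding G_def by auto
    have "cinner (g + \<i> *\<^sub>C f) (C \<psi>) = 0"
      using ortho_compl_cinner[OF _ cayley_rangeI'[OF 1(1)]] C_bd(2)[OF 1(2)] unfolding defect_def by blast
    then have "(norm b)\<^sup>2 = (norm (g + \<i> *\<^sub>C f))\<^sup>2 + (norm (C \<psi>))\<^sup>2"
      unfolding 1 by (rule norm_sq_orthogonal)
    also have "\<dots> \<le> (norm (g - \<i> *\<^sub>C f))\<^sup>2 + (norm \<psi>)\<^sup>2"
      using norm_cayley(1)[OF 1(1)] C_bd(1)[OF 1(2)] by (simp add: power_mono)
    also have "\<dots> = (norm a)\<^sup>2" unfolding 1 by (rule norm_sq_decomposition[OF 1(1,2), symmetric])
    finally show ?thesis by simp
  qed
  moreover have "\<exists>b. (a, b) \<in> G" for a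
    by (rule cayley_decomposition[of a]) (auto simp: G_def)
  ultimately have "\<exists>T. clin T \<and> (\<forall>u. norm (T u) \<le> 1 * norm u) \<and> (\<forall>f g. (f, g) \<in> G \<longleftrightarrow> g = T f)"
    by (rule operator_of_total_relation)
  then obtain T where T: "clin T" "\<And>u. norm (T u) \<le> 1 * norm u" "\<And>f g. (f, g) \<in> G \<longleftrightarrow> g = T f" by metis
  have "T (g - \<i> *\<^sub>C f) = g + \<i> *\<^sub>C f" if "(f, g) \<in> B" for f g
  proof -
    have "(g - \<i> *\<^sub>C f, g + \<i> *\<^sub>C f) \<in> G"
      unfolding G_def using that csubspace_0[OF sub] C0
      by (intro CollectI exI[of _ f] exI[of _ g] exI[of _ 0]) simp
    then show ?thesis using T(3) by simp
  qed
  moreover have "T \<psi> = C \<psi>" if "\<psi> \<in> defect \<i> B" for \<psi>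
  proof -
    have "(\<psi>, C \<psi>) \<in> G"
      unfolding G_def using that B0 by (intro CollectI exI[of _ 0] exI[of _ 0] exI[of _ \<psi>]) simp
    then show ?thesis using T(3) by simp
  qed
  ultimately show ?thesis using T(1,2) by (auto simp: extends_cayley_def)
qed

lemma extends_cayley_cinner:
  assumes "extends_cayley T" "(f, g) \<in> B"
  shows "cinner (T v) (g + \<i> *\<^sub>C f) = cinner v (g - \<i> *\<^sub>C f)"
  using contraction_isometric_vector[of T "g - \<i> *\<^sub>C f" v] extends_cayleyD[OF assms(1)] assms(2)
    norm_cayley(1)[OF assms(2)] by simp

text \<open>A contraction that is isometric on the range of B - \<i> preserves inner products
  against it, so it maps the complement of that range into the complement of the range of B +
  \<i>.\<close>

lemma extends_cayley_restrict:
  assumes T: "extends_cayley T"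
  shows "restrict T (defect \<i> B) \<in> contractions (defect \<i> B) (defect (- \<i>) B)"
proof -
  have sub: "csubspace (defect \<i> B)" unfolding defect_def by (rule csubspace_ortho_compl)
  have "T \<psi> \<in> defect (- \<i>) B" if \<psi>: "\<psi> \<in> defect \<i> B" for \<psi>
    unfolding defect_def ortho_compl_def
  proof safe
    fix v f assume "(f, v) \<in> minus_scalar B (- \<i>)"
    then obtain g where g: "(f, g) \<in> B" "v = g + \<i> *\<^sub>C f" by (auto simp: minus_scalar_def scaleC_minus_left)
    then show "cinner (T \<psi>) v = 0"
      using extends_cayley_cinner[OF T g(1), of \<psi>] ortho_compl_cinner[OF _ cayley_rangeI[OF g(1)], of \<psi>] \<psi>
      by (simp add: defect_def)
  qed
  then show ?thesis
    using extends_cayleyD[OF T] csubspaceD[OF sub] by (auto simp: contractions_def clinD)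
qed

text \<open>Let h = f + C \<psi> - \<psi> be in the domain of the extension. Its image minus \<i> h
  is g - \<i> f + 2 \<i> \<psi>, its image plus \<i> h is g + \<i> f + 2 \<i> C \<psi>. Hence T is
  the Cayley transform of the extension, and the first vector runs over the whole space.\<close>

lemma quasi_sa_ext_eq:
  assumes T: "extends_cayley T" and C: "\<And>\<psi>. \<psi> \<in> defect \<i> B \<Longrightarrow> C \<psi> = T \<psi>"
  shows "quasi_sa_ext B C = range (\<lambda>v. ((1 / (2 * \<i>)) *\<^sub>C (T v - v), (1 / 2) *\<^sub>C (T v + v)))"
proof -
  have sub: "csubspace (defect \<i> B)" unfolding defect_def by (rule csubspace_ortho_compl)
  have key: "(f + T \<psi> - \<psi>, g + \<i> *\<^sub>C T \<psi> + \<i> *\<^sub>C \<psi>) = ((1 / (2 * \<i>)) *\<^sub>C (T v - v), (1 / 2) *\<^sub>C (T v + v))"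
    if "(f, g) \<in> B" and v: "v = (g - \<i> *\<^sub>C f) + (2 * \<i>) *\<^sub>C \<psi>" for f g v \<psi>
  proof -
    have Tv: "T v = g + \<i> *\<^sub>C f + (2 * \<i>) *\<^sub>C T \<psi>"
      unfolding v clin_add[OF extends_cayleyD(1)[OF T]] clin_scaleC[OF extends_cayleyD(1)[OF T]]
        extends_cayleyD(3)[OF T that(1)] ..
    have "T v - v = (\<i> + \<i>) *\<^sub>C f + (2 * \<i>) *\<^sub>C (T \<psi> - \<psi>)"
      unfolding Tv unfolding v scaleC_add_left by (simp add: scaleC_diff_right algebra_simps)
    moreover have "T v + v = (1 + 1) *\<^sub>C g + (2 * \<i>) *\<^sub>C (T \<psi> + \<psi>)"
      unfolding Tv unfolding v scaleC_add_left by (simp add: scaleC_add_right algebra_simps)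
    ultimately show ?thesis
      by (simp add: scaleC_add_right scaleC_scaleC add.assoc)
  qed
  show ?thesis
  proof (intro equalityI subsetI)
    fix q assume "q \<in> quasi_sa_ext B C"
    then obtain f g \<psi> where 1: "(f, g) \<in> B" "\<psi> \<in> defect \<i> B" "q = (f + T \<psi> - \<psi>, g + \<i> *\<^sub>C T \<psi> + \<i> *\<^sub>C \<psi>)"
      unfolding quasi_sa_ext_def by (auto simp: C)
    show "q \<in> range (\<lambda>v. ((1 / (2 * \<i>)) *\<^sub>C (T v - v), (1 / 2) *\<^sub>C (T v + v)))"
      unfolding 1(3) key[OF 1(1) refl] by (rule rangeI)
  next
    fix q assume "q \<in> range (\<lambda>v. ((1 / (2 * \<i>)) *\<^sub>C (T v - v), (1 / 2) *\<^sub>C (T v + v)))"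
    then obtain v where v: "q = ((1 / (2 * \<i>)) *\<^sub>C (T v - v), (1 / 2) *\<^sub>C (T v + v))" by (elim rangeE)
    obtain f g \<psi> where 1: "(f, g) \<in> B" "\<psi> \<in> defect \<i> B" "v = (g - \<i> *\<^sub>C f) + \<psi>"
      by (rule cayley_decomposition)
    let ?\<psi> = "(1 / (2 * \<i>)) *\<^sub>C \<psi>"
    have \<psi>: "?\<psi> \<in> defect \<i> B" by (rule csubspace_scaleC[OF sub 1(2)])
    have "v = (g - \<i> *\<^sub>C f) + (2 * \<i>) *\<^sub>C ?\<psi>" using 1(3) by (simp add: scaleC_scaleC)
    from key[OF 1(1) this] show "q \<in> quasi_sa_ext B C"
      unfolding quasi_sa_ext_def v using 1(1) \<psi> C[OF \<psi>] by (intro CollectI exI[of _ f] exI[of _ g] exI[of _ ?\<psi>]) simp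
  qed
qed

lemma resolvent_eq_image: "resolvent D z = (\<lambda>(f, g). (g - z *\<^sub>C f, f)) ` D"
  by (force simp: resolvent_def minus_scalar_def)

text \<open>In the parametrization by v, a pair (h, k) of the extension has k - z h equal to the
  vector u of the Cayley pair, and h = R u.\<close>

lemma resolvent_quasi_sa_ext:
  assumes T: "extends_cayley T" and C: "\<And>\<psi>. \<psi> \<in> defect \<i> B \<Longrightarrow> C \<psi> = T \<psi>" and R: "cayley_pair z T R"
  shows "resolvent (quasi_sa_ext B C) z = {(u, R u) | u. True}"
proof -
  have *: "(1 / 2) *\<^sub>C (T v + v) - z *\<^sub>C (1 / (2 * \<i>)) *\<^sub>C (T v - v)
      = ((1 - \<i> * z) / 2) *\<^sub>C v + ((1 + \<i> * z) / 2) *\<^sub>C T v" for v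
  proof -
    have "(1 / 2) *\<^sub>C (T v + v) - z *\<^sub>C (1 / (2 * \<i>)) *\<^sub>C (T v - v)
      = (1 / 2 + z * (1 / (2 * \<i>))) *\<^sub>C v + (1 / 2 - z * (1 / (2 * \<i>))) *\<^sub>C T v"
      unfolding scaleC_add_left scaleC_diff_left scaleC_scaleC scaleC_add_right scaleC_diff_right
      by (simp only: algebra_simps)
    moreover have "1 / 2 + z * (1 / (2 * \<i>)) = (1 - \<i> * z) / 2" "1 / 2 - z * (1 / (2 * \<i>)) = (1 + \<i> * z) / 2"
      by (simp_all add: field_simps)
    ultimately show ?thesis by (simp only:)
  qed
  have eq: "quasi_sa_ext B C = range (\<lambda>v. ((1 / (2 * \<i>)) *\<^sub>C (T v - v), (1 / 2) *\<^sub>C (T v + v)))"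
    by (rule quasi_sa_ext_eq[OF T C])
  have "resolvent (quasi_sa_ext B C) z
      = range (\<lambda>v. (((1 - \<i> * z) / 2) *\<^sub>C v + ((1 + \<i> * z) / 2) *\<^sub>C T v, (1 / (2 * \<i>)) *\<^sub>C (T v - v)))"
    unfolding resolvent_eq_image eq image_image prod.case * ..
  also have "\<dots> = {(u, R u) | u. True}"
  proof (intro equalityI subsetI)
    fix q assume "q \<in> range (\<lambda>v. (((1 - \<i> * z) / 2) *\<^sub>C v + ((1 + \<i> * z) / 2) *\<^sub>C T v, (1 / (2 * \<i>)) *\<^sub>C (T v - v)))"
    then obtain v where "q = (((1 - \<i> * z) / 2) *\<^sub>C v + ((1 + \<i> * z) / 2) *\<^sub>C T v, (1 / (2 * \<i>)) *\<^sub>C (T v - v))"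
      by (elim rangeE)
    then show "q \<in> {(u, R u) | u. True}"
      using cayley_pair_inverse(1)[OF R, of v] by auto
  next
    fix q assume "q \<in> {(u, R u) | u. True}"
    then obtain u where u: "q = (u, R u)" by blast
    let ?v = "u + (z - \<i>) *\<^sub>C R u"
    have eq: "((1 - \<i> * z) / 2) *\<^sub>C ?v + ((1 + \<i> * z) / 2) *\<^sub>C T ?v = u"
      by (rule cayley_pair_forward[OF R])
    show "q \<in> range (\<lambda>v. (((1 - \<i> * z) / 2) *\<^sub>C v + ((1 + \<i> * z) / 2) *\<^sub>C T v, (1 / (2 * \<i>)) *\<^sub>C (T v - v)))"
      by (rule range_eqI[of _ _ ?v]) (use cayley_pair_inverse(1)[OF R, of ?v] eq u in simp)
  qed
  finally show ?thesis .
qed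

text \<open>R inverts B - z on its range, and the adjoint of R inverts B - cnj z. The second fact
  holds because T preserves inner products against the range of B - \<i>.\<close>

lemma cayley_pair_resolvent:
  assumes T: "extends_cayley T" and R: "cayley_pair z T R" and fg: "(f, g) \<in> B"
  shows "R (g - z *\<^sub>C f) = f" "cinner (R u) (g - cnj z *\<^sub>C f) = cinner u f"
proof -
  let ?v = "g - \<i> *\<^sub>C f"
  have Tv: "T ?v = g + \<i> *\<^sub>C f" by (rule extends_cayleyD(3)[OF T fg])
  have 1: "((1 - \<i> * z) / 2) *\<^sub>C ?v + ((1 + \<i> * z) / 2) *\<^sub>C T ?v = g - z *\<^sub>C f"
  proof -
    have "((1 - \<i> * z) / 2) *\<^sub>C ?v + ((1 + \<i> * z) / 2) *\<^sub>C T ?v =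
      ((1 - \<i> * z) / 2) *\<^sub>C (g + (- \<i>) *\<^sub>C f) + ((1 + \<i> * z) / 2) *\<^sub>C (g + \<i> *\<^sub>C f)"
      unfolding Tv by (simp add: scaleC_minus_left)
    also have "\<dots> = ((1 - \<i> * z) / 2 + (1 + \<i> * z) / 2) *\<^sub>C g
        + ((1 - \<i> * z) / 2 * (- \<i>) + (1 + \<i> * z) / 2 * \<i>) *\<^sub>C f"
      by (simp only: scaleC_comb, simp only: scaleC_add_left)
    also have "(1 - \<i> * z) / 2 + (1 + \<i> * z) / 2 = 1" by (simp add: field_simps)
    also have "(1 - \<i> * z) / 2 * (- \<i>) + (1 + \<i> * z) / 2 * \<i> = - z" by (simp add: field_simps)
    finally show ?thesis by (simp add: scaleC_minus_left)
  qed
  have "T ?v - ?v = (\<i> + \<i>) *\<^sub>C f" unfolding Tv scaleC_add_left by simp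
  then show "R (g - z *\<^sub>C f) = f"
    using cayley_pair_inverse(1)[OF R, of ?v] unfolding 1 by (simp add: scaleC_scaleC)
  have "cinner (u + (z + \<i>) *\<^sub>C R u) (g + \<i> *\<^sub>C f) = cinner (u + (z - \<i>) *\<^sub>C R u) (g - \<i> *\<^sub>C f)"
    using extends_cayley_cinner[OF T fg] cayley_pairD(4)[OF R] by metis
  then have "2 * \<i> * cinner (R u) (g - cnj z *\<^sub>C f) = 2 * \<i> * cinner u f"
    by (simp add: cinner_simps algebra_simps)
  then show "cinner (R u) (g - cnj z *\<^sub>C f) = cinner u f" by simp
qed

text \<open>With u = g - z f and R u = f, the two vectors of the Cayley pair are g - \<i> f and g +
  \<i> f.\<close>

lemma extends_cayley_of_resolvent:
  assumes R: "cayley_pair z T R" and res: "\<And>f g. (f, g) \<in> B \<Longrightarrow> R (g - z *\<^sub>C f) = f"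
  shows "extends_cayley T"
proof -
  have "T (g - \<i> *\<^sub>C f) = g + \<i> *\<^sub>C f" if "(f, g) \<in> B" for f g
    using cayley_pairD(4)[OF R, of "g - z *\<^sub>C f"] res[OF that] by (simp add: scaleC_add_left scaleC_diff_left)
  then show ?thesis using cayley_pairD(1,2)[OF R] by (simp add: extends_cayley_def)
qed

end

lemma cayley_pair_unique:
  assumes "cayley_pair z T R" "cayley_pair z T' R"
  shows "T = T'"
proof
  fix v
  obtain u where u: "v = u + (z - \<i>) *\<^sub>C R u" using cayley_pairD(5)[OF assms(1)] by blast
  show "T v = T' v" unfolding u cayley_pairD(4)[OF assms(1)] cayley_pairD(4)[OF assms(2)] ..
qed

section \<open>Analytic families of extensions and of their resolvents\<close>

lemma open_upper_half_plane: "open upper_half_plane"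
  unfolding upper_half_plane_def by (rule open_halfspace_Im_gt)

lemma eventually_upper_half_plane: "z \<in> upper_half_plane \<Longrightarrow> \<forall>\<^sub>F w in at z. w \<in> upper_half_plane"
  by (rule eventually_at_in_open'[OF open_upper_half_plane])

definition bdd_clin :: "('a::complex_inner \<Rightarrow> 'b::complex_inner) \<Rightarrow> bool" where
  "bdd_clin T \<longleftrightarrow> clin T \<and> (\<exists>K\<ge>0. \<forall>u. norm (T u) \<le> K * norm u)"

lemma bdd_clinI:
  assumes "clin T" "\<And>u. norm (T u) \<le> K * norm u"
  shows "bdd_clin T"
proof -
  have "norm (T u) \<le> \<bar>K\<bar> * norm u" for u
    by (rule order_trans[OF assms(2)]) (simp add: mult_right_mono)
  then show ?thesis using assms(1) unfolding bdd_clin_def by (intro conjI exI[of _ "\<bar>K\<bar>"]) auto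
qed

lemma bdd_clin_scaled_add:
  fixes T :: "'a::complex_inner \<Rightarrow> 'a"
  assumes "bdd_clin T"
  shows "bdd_clin (\<lambda>u. a *\<^sub>C u + b *\<^sub>C T u)"
proof -
  obtain K where K: "clin T" "\<And>u. norm (T u) \<le> K * norm u" using assms by (auto simp: bdd_clin_def)
  show ?thesis
  proof (rule bdd_clinI)
    show "clin (\<lambda>u. a *\<^sub>C u + b *\<^sub>C T u)"
      by (simp add: clin_def clinD[OF K(1)] scaleC_add_right scaleC_scaleC mult.commute add_ac)
    fix u
    have "norm (a *\<^sub>C u + b *\<^sub>C T u) \<le> cmod a * norm u + cmod b * (K * norm u)"
      by (intro order_trans[OF norm_triangle_ineq] add_mono) (auto intro!: mult_left_mono K)
    then show "norm (a *\<^sub>C u + b *\<^sub>C T u) \<le> (cmod a + cmod b * K) * norm u" by (simp add: algebra_simps)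
  qed
qed

lemma has_op_derivative_bdd_clin:
  assumes "has_op_derivative \<Phi> G z" "\<forall>\<^sub>F w in at z. bdd_clin (\<Phi> w)" "bdd_clin (\<Phi> z)"
  shows "bdd_clin G"
proof -
  obtain K0 where K0: "\<And>u. norm (\<Phi> z u) \<le> K0 * norm u" using assms(3) by (auto simp: bdd_clin_def)
  have "\<forall>\<^sub>F w in at z. \<exists>K. \<forall>u. norm (\<Phi> w u) \<le> K * norm u"
    using assms(2) by eventually_elim (auto simp: bdd_clin_def)
  from has_op_derivative_bounded[OF assms(1) this K0] obtain L where L: "\<And>u. norm (G u) \<le> L * norm u"
    by metis
  have "\<forall>\<^sub>F w in at z. clin (\<Phi> w)"
    using assms(2) by eventually_elim (auto simp: bdd_clin_def)
  from has_op_derivative_clin[OF assms(1) this] assms(3) have "clin G" by (simp add: bdd_clin_def)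
  then show ?thesis using L by (rule bdd_clinI)
qed

lemma has_op_derivative_quotient':
  fixes \<Phi> E :: "complex \<Rightarrow> 'a::complex_inner \<Rightarrow> 'a"
  assumes der: "has_op_derivative \<Phi> G z"
    and \<Phi>: "\<forall>\<^sub>F w in at z. bdd_clin (\<Phi> w)" "bdd_clin (\<Phi> z)"
    and E: "bdd_clin (E z)"
    and at_z: "\<And>u. norm u \<le> K * norm ((a + b * z) *\<^sub>C u + (c + d * z) *\<^sub>C \<Phi> z u)"
      "\<And>v. \<exists>u. (a + b * z) *\<^sub>C u + (c + d * z) *\<^sub>C \<Phi> z u = v"
      "\<And>u. E z ((a + b * z) *\<^sub>C u + (c + d * z) *\<^sub>C \<Phi> z u) = (a' + b' * z) *\<^sub>C u + (c' + d' * z) *\<^sub>C \<Phi> z u"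
    and K: "K \<ge> 0"
    and ev: "\<forall>\<^sub>F w in at z. (\<forall>u. norm u \<le> K * norm ((a + b * w) *\<^sub>C u + (c + d * w) *\<^sub>C \<Phi> w u)) \<and>
      (\<forall>v. \<exists>u. (a + b * w) *\<^sub>C u + (c + d * w) *\<^sub>C \<Phi> w u = v) \<and>
      (\<forall>u. E w ((a + b * w) *\<^sub>C u + (c + d * w) *\<^sub>C \<Phi> w u) = (a' + b' * w) *\<^sub>C u + (c' + d' * w) *\<^sub>C \<Phi> w u)"
  shows "\<exists>G. has_op_derivative E G z"
proof -
  have "bdd_clin G" by (rule has_op_derivative_bdd_clin[OF der \<Phi>])
  then obtain L where L: "L \<ge> 0" "\<And>u. norm (G u) \<le> L * norm u" by (auto simp: bdd_clin_def)
  obtain Ke where Ke: "clin (E z)" "\<And>u. norm (E z u) \<le> Ke * norm u" "Ke \<ge> 0"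
    using E by (auto simp: bdd_clin_def)
  have bdd: "\<forall>\<^sub>F w in at z. bdd_clin (\<lambda>u. (a + b * w) *\<^sub>C u + (c + d * w) *\<^sub>C \<Phi> w u)" for a b c d
    using \<Phi>(1) by eventually_elim (rule bdd_clin_scaled_add)
  note P = has_op_derivative_affine[OF der L, of a b c d]
  note Q = has_op_derivative_affine[OF der L, of a' b' c' d']
  from has_op_derivative_bdd_clin[OF P bdd bdd_clin_scaled_add[OF \<Phi>(2)]]
  obtain Lp where Lp: "clin (\<lambda>u. b *\<^sub>C u + d *\<^sub>C \<Phi> z u + (c + d * z) *\<^sub>C G u)" "Lp \<ge> 0"
    "\<And>u. norm (b *\<^sub>C u + d *\<^sub>C \<Phi> z u + (c + d * z) *\<^sub>C G u) \<le> Lp * norm u"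
    unfolding bdd_clin_def by blast
  from has_op_derivative_bdd_clin[OF Q bdd bdd_clin_scaled_add[OF \<Phi>(2)]]
  obtain Lq where Lq: "clin (\<lambda>u. b' *\<^sub>C u + d' *\<^sub>C \<Phi> z u + (c' + d' * z) *\<^sub>C G u)" "Lq \<ge> 0"
    "\<And>u. norm (b' *\<^sub>C u + d' *\<^sub>C \<Phi> z u + (c' + d' * z) *\<^sub>C G u) \<le> Lq * norm u"
    unfolding bdd_clin_def by blast
  have "clin (\<lambda>u. (a + b * z) *\<^sub>C u + (c + d * z) *\<^sub>C \<Phi> z u)"
    using bdd_clin_scaled_add[OF \<Phi>(2)] by (simp add: bdd_clin_def)
  from has_op_derivative_quotient[OF P Lp(1,3,2) this Q Lq(1,3,2) Ke K at_z ev]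
  show ?thesis .
qed

text \<open>Puts the Cayley coefficients into the affine shape of the quotient rule; the terms
  \<open>0 * w\<close> make constants match it.\<close>

lemma half_eqs: "(1 - \<i> * w) / 2 = 1 / 2 + (- \<i> / 2) * w" "(1 + \<i> * w) / 2 = 1 / 2 + (\<i> / 2) * w"
    "(1 / (2 * \<i>)) *\<^sub>C (t - v) = (- 1 / (2 * \<i>) + 0 * w) *\<^sub>C v + (1 / (2 * \<i>) + 0 * w) *\<^sub>C (t::'a::complex_inner)"
  by (simp_all add: field_simps scaleC_simps)

context closed_symmetric_relation
begin

text \<open>Different values of T agree on the range of B - \<i>, so analyticity passes from F to T
  through the orthogonal projection onto the defect subspace, and from T to R by the quotient
  rule.\<close>

lemma resolvent_family:
  assumes F: "F \<in> contractive_analytic (defect \<i> B) (defect (- \<i>) B)"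
  shows "\<exists>T R. \<forall>z\<in>upper_half_plane. extends_cayley (T z) \<and> cayley_pair z (T z) (R z) \<and>
    (\<forall>\<psi>\<in>defect \<i> B. F z \<psi> = T z \<psi>) \<and> resolvent (quasi_sa_ext B (F z)) z = {(u, R z u) | u. True} \<and>
    (\<exists>G. has_op_derivative R G z)"
proof -
  have "\<forall>z\<in>upper_half_plane. \<exists>T. extends_cayley T \<and> (\<forall>\<psi>\<in>defect \<i> B. T \<psi> = F z \<psi>)"
  proof
    fix z assume "z \<in> upper_half_plane"
    then have "F z \<in> contractions (defect \<i> B) (defect (- \<i>) B)"
      using F by (auto simp: contractive_analytic_def)
    then show "\<exists>T. extends_cayley T \<and> (\<forall>\<psi>\<in>defect \<i> B. T \<psi> = F z \<psi>)"
      by (rule extends_cayley_of_contraction)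
  qed
  then obtain T where T: "\<And>z. z \<in> upper_half_plane \<Longrightarrow> extends_cayley (T z)"
    "\<And>z \<psi>. z \<in> upper_half_plane \<Longrightarrow> \<psi> \<in> defect \<i> B \<Longrightarrow> F z \<psi> = T z \<psi>" by metis
  have "\<forall>z\<in>upper_half_plane. \<exists>R. cayley_pair z (T z) R"
    using cayley_pair_of_contraction[OF extends_cayleyD(1,2)[OF T(1)]] by (auto simp: upper_half_plane_def)
  then obtain R where R: "\<And>z. z \<in> upper_half_plane \<Longrightarrow> cayley_pair z (T z) (R z)" by metis
  have res: "resolvent (quasi_sa_ext B (F z)) z = {(u, R z u) | u. True}" if z: "z \<in> upper_half_plane" for z
    by (rule resolvent_quasi_sa_ext[OF T(1)[OF z] _ R[OF z]]) (rule T(2)[OF z])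
  \<comment> \<open>\<open>p\<close> selects the defect component of each vector. It does not
    increase norms, so bounds on the defect subspace become bounds on the whole space.\<close>
  have "\<forall>v. \<exists>\<psi>. \<psi> \<in> defect \<i> B \<and> (\<exists>f g. (f, g) \<in> B \<and> v = (g - \<i> *\<^sub>C f) + \<psi>)"
    by (metis cayley_decomposition)
  then obtain p where p: "\<And>v. p v \<in> defect \<i> B" "\<And>v. \<exists>f g. (f, g) \<in> B \<and> v = (g - \<i> *\<^sub>C f) + p v" by metis
  have p_bd: "norm (p v) \<le> norm v" for v
  proof -
    obtain f g where fg: "(f, g) \<in> B" "v = (g - \<i> *\<^sub>C f) + p v" using p(2) by blast
    have "(norm v)\<^sup>2 = (norm (g - \<i> *\<^sub>C f))\<^sup>2 + (norm (p v))\<^sup>2"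
      by (subst fg(2)) (rule norm_sq_decomposition[OF fg(1) p(1)])
    then have "(norm (p v))\<^sup>2 \<le> (norm v)\<^sup>2" by simp
    then show ?thesis by simp
  qed
  have T_diff: "T w v - T z v = F w (p v) - F z (p v)" if wz: "w \<in> upper_half_plane" "z \<in> upper_half_plane" for w z v
  proof -
    obtain f g where fg: "(f, g) \<in> B" "v = (g - \<i> *\<^sub>C f) + p v" using p(2) by blast
    have "T w v = g + \<i> *\<^sub>C f + F w (p v)" if "w \<in> upper_half_plane" for w
      using fg(2) clin_add[OF extends_cayleyD(1)[OF T(1)[OF that]], of "g - \<i> *\<^sub>C f" "p v"]
        extends_cayleyD(3)[OF T(1)[OF that] fg(1)] T(2)[OF that p(1)] by simp
    then show ?thesis using wz by simp
  qed
  have der: "\<exists>G. has_op_derivative R G z" if z: "z \<in> upper_half_plane" for z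
  proof -
    have "operator_analytic_on (defect \<i> B) F upper_half_plane"
      using F by (simp add: contractive_analytic_def)
    then obtain G where G: "\<And>\<epsilon>. \<epsilon> > 0 \<Longrightarrow> \<forall>\<^sub>F w in at z. \<forall>\<psi>\<in>defect \<i> B.
        norm (inverse (w - z) *\<^sub>C (F w \<psi> - F z \<psi>) - G \<psi>) \<le> \<epsilon> * norm \<psi>"
      using z unfolding operator_analytic_on_def by blast
    have derT: "has_op_derivative T (\<lambda>v. G (p v)) z"
      unfolding has_op_derivative_def
    proof (intro allI impI)
      fix e :: real assume e: "e > 0"
      have "\<forall>\<^sub>F w in at z. w \<noteq> z" by (simp add: eventually_at_filter)
      with G[OF e] eventually_upper_half_plane[OF z]
      show "\<forall>\<^sub>F w in at z. \<forall>v. norm (T w v - T z v - (w - z) *\<^sub>C G (p v)) \<le> e * cmod (w - z) * norm v"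
      proof eventually_elim
        case (elim w)
        show ?case
        proof
          fix v
          have "norm (inverse (w - z) *\<^sub>C (F w (p v) - F z (p v)) - G (p v)) \<le> e * norm (p v)"
            using elim(1) p(1) by blast
          then have "norm (T w v - T z v - (w - z) *\<^sub>C G (p v)) \<le> e * cmod (w - z) * norm (p v)"
            unfolding quotient_remainder[OF elim(3)] T_diff[OF elim(2) z] .
          also have "\<dots> \<le> e * cmod (w - z) * norm v"
            using e by (intro mult_left_mono p_bd) auto
          finally show "norm (T w v - T z v - (w - z) *\<^sub>C G (p v)) \<le> e * cmod (w - z) * norm v" .
        qed
      qed
    qed
    have bdT: "bdd_clin (T w)" if "w \<in> upper_half_plane" for w
      by (rule bdd_clinI[of _ 1]) (use extends_cayleyD(1,2)[OF T(1)[OF that]] in auto)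
    have Rb: "norm (R w u) \<le> (1 / Im w) * norm u" if w: "w \<in> upper_half_plane" for w u
      using dissipative_bound[OF cayley_pair_dissipative[OF R[OF w]]] w by (simp add: upper_half_plane_def)
    have y: "Im z > 0" using z by (simp add: upper_half_plane_def)
    \<comment> \<open>From v = u + (w - \<i>) R(w) u and |R(w)| <= 1 / Im w, where Im w is at least
      Im z / 2 on the disc of radius Im z / 2.\<close>
    define K where "K = 1 + (cmod (z - \<i>) + Im z / 2) * (1 / (Im z / 2))"
    have all: "(\<forall>v. norm v \<le> K * norm ((1 / 2 + (- \<i> / 2) * w) *\<^sub>C v + (1 / 2 + (\<i> / 2) * w) *\<^sub>C T w v)) \<and>
      (\<forall>u. \<exists>v. (1 / 2 + (- \<i> / 2) * w) *\<^sub>C v + (1 / 2 + (\<i> / 2) * w) *\<^sub>C T w v = u) \<and>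
      (\<forall>v. R w ((1 / 2 + (- \<i> / 2) * w) *\<^sub>C v + (1 / 2 + (\<i> / 2) * w) *\<^sub>C T w v)
          = (- 1 / (2 * \<i>) + 0 * w) *\<^sub>C v + (1 / (2 * \<i>) + 0 * w) *\<^sub>C T w v)"
      if w: "w \<in> upper_half_plane" "dist w z < Im z / 2" for w
      unfolding half_eqs[symmetric]
    proof (intro conjI allI)
      fix v
      let ?u = "((1 - \<i> * w) / 2) *\<^sub>C v + ((1 + \<i> * w) / 2) *\<^sub>C T w v"
      show "R w ?u = (1 / (2 * \<i>)) *\<^sub>C (T w v - v)" by (rule cayley_pair_inverse(1)[OF R[OF w(1)]])
      have "\<bar>Im (w - z)\<bar> < Im z / 2" using abs_Im_le_cmod[of "w - z"] w(2) by (simp add: dist_norm)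
      then have Imw: "Im w \<ge> Im z / 2" by (simp add: abs_if split: if_splits)
      have "cmod (w - \<i>) \<le> cmod (z - \<i>) + cmod (w - z)"
        by (metis add.commute diff_add_cancel diff_diff_eq2 norm_triangle_ineq add_diff_eq)
      then have wi: "cmod (w - \<i>) \<le> cmod (z - \<i>) + Im z / 2" using w(2) by (simp add: dist_norm)
      have "norm v = norm (?u + (w - \<i>) *\<^sub>C R w ?u)"
        using cayley_pair_inverse(2)[OF R[OF w(1)], of v] by (rule arg_cong)
      also have "\<dots> \<le> norm ?u + cmod (w - \<i>) * ((1 / Im w) * norm ?u)"
        by (intro order_trans[OF norm_triangle_ineq] add_mono order_refl)
          (simp only: norm_scaleC, intro mult_left_mono Rb w(1) norm_ge_zero)
      also have "\<dots> \<le> norm ?u + (cmod (z - \<i>) + Im z / 2) * ((1 / (Im z / 2)) * norm ?u)"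
      proof -
        have "1 / Im w \<le> 1 / (Im z / 2)" using y Imw by (intro divide_left_mono) auto
        then show ?thesis using y wi w(1)
          by (intro add_mono mult_mono mult_right_mono) (auto simp: upper_half_plane_def)
      qed
      also have "\<dots> = K * norm ?u" by (simp only: K_def distrib_right mult_1 mult.assoc)
      finally show "norm v \<le> K * norm ?u" .
    next
      fix u
      show "\<exists>v. ((1 - \<i> * w) / 2) *\<^sub>C v + ((1 + \<i> * w) / 2) *\<^sub>C T w v = u"
        using cayley_pair_forward[OF R[OF w(1)], of u] by (rule exI)
    qed
    have "\<forall>\<^sub>F w in at z. dist w z < Im z / 2"
      using y by (auto simp: eventually_at intro!: exI[of _ "Im z / 2"])
    with eventually_upper_half_plane[OF z] have ev: "\<forall>\<^sub>F w in at z. w \<in> upper_half_plane \<and> dist w z < Im z / 2"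
      by eventually_elim auto
    have zz: "dist z z < Im z / 2" using y by simp
    show ?thesis
    proof (rule has_op_derivative_quotient'[OF derT _ bdT[OF z]])
      show "\<forall>\<^sub>F w in at z. bdd_clin (T w)"
        using eventually_upper_half_plane[OF z] by eventually_elim (rule bdT)
      show "bdd_clin (R z)" by (rule bdd_clinI[OF cayley_pairD(3)[OF R[OF z]] Rb[OF z]])
      show "K \<ge> 0" using y by (simp add: K_def)
      note a = all[OF z zz]
      from a show "norm v \<le> K * norm ((1 / 2 + (- \<i> / 2) * z) *\<^sub>C v + (1 / 2 + (\<i> / 2) * z) *\<^sub>C T z v)" for v
        by blast
      from a show "\<exists>v. (1 / 2 + (- \<i> / 2) * z) *\<^sub>C v + (1 / 2 + (\<i> / 2) * z) *\<^sub>C T z v = u" for u by blast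
      from a show "R z ((1 / 2 + (- \<i> / 2) * z) *\<^sub>C v + (1 / 2 + (\<i> / 2) * z) *\<^sub>C T z v)
          = (- 1 / (2 * \<i>) + 0 * z) *\<^sub>C v + (1 / (2 * \<i>) + 0 * z) *\<^sub>C T z v" for v by blast
      from ev show "\<forall>\<^sub>F w in at z. (\<forall>v. norm v \<le> K * norm ((1 / 2 + (- \<i> / 2) * w) *\<^sub>C v + (1 / 2 + (\<i> / 2) * w) *\<^sub>C T w v)) \<and>
      (\<forall>u. \<exists>v. (1 / 2 + (- \<i> / 2) * w) *\<^sub>C v + (1 / 2 + (\<i> / 2) * w) *\<^sub>C T w v = u) \<and>
      (\<forall>v. R w ((1 / 2 + (- \<i> / 2) * w) *\<^sub>C v + (1 / 2 + (\<i> / 2) * w) *\<^sub>C T w v)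
          = (- 1 / (2 * \<i>) + 0 * w) *\<^sub>C v + (1 / (2 * \<i>) + 0 * w) *\<^sub>C T w v)"
        by eventually_elim (rule all; blast)
    qed
  qed
  show ?thesis
    by (intro exI[of _ T] exI[of _ R] ballI conjI) (simp_all only: T R res der)
qed

lemma parameter_of_resolvent_family:
  assumes lin: "\<And>z. z \<in> upper_half_plane \<Longrightarrow> clin (R z)"
    and dis: "\<And>z u. z \<in> upper_half_plane \<Longrightarrow> Im z * (norm (R z u))\<^sup>2 \<le> Im (cinner (R z u) u)"
    and res: "\<And>z f g. z \<in> upper_half_plane \<Longrightarrow> (f, g) \<in> B \<Longrightarrow> R z (g - z *\<^sub>C f) = f"
    and der: "\<And>z. z \<in> upper_half_plane \<Longrightarrow> \<exists>G. has_op_derivative R G z"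
  shows "\<exists>F \<in> contractive_analytic (defect \<i> B) (defect (- \<i>) B).
    \<forall>z\<in>upper_half_plane. resolvent (quasi_sa_ext B (F z)) z = {(u, R z u) | u. True}"
proof -
  have "\<forall>z\<in>upper_half_plane. \<exists>T. cayley_pair z T (R z)"
    using cayley_pair_of_dissipative[OF lin dis] by (auto simp: upper_half_plane_def)
  then obtain T where T: "\<And>z. z \<in> upper_half_plane \<Longrightarrow> cayley_pair z (T z) (R z)" by metis
  have ext: "extends_cayley (T z)" if z: "z \<in> upper_half_plane" for z
    by (rule extends_cayley_of_resolvent[OF T[OF z] res[OF z]])
  \<comment> \<open>Restricted twice, in z and on the defect subspace, because parameters are
    extensional.\<close>
  define F where "F = restrict (\<lambda>z. restrict (T z) (defect \<i> B)) upper_half_plane"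
  have F: "F z \<psi> = T z \<psi>" if "z \<in> upper_half_plane" "\<psi> \<in> defect \<i> B" for z \<psi>
    using that by (simp add: F_def)
  have derT: "\<exists>G. has_op_derivative T G z" if z: "z \<in> upper_half_plane" for z
  proof -
    obtain G where G: "has_op_derivative R G z" using der[OF z] by blast
    have bdR: "bdd_clin (R w)" if w: "w \<in> upper_half_plane" for w
    proof (rule bdd_clinI[OF lin[OF w]])
      show "norm (R w u) \<le> (1 / Im w) * norm u" for u
        using dissipative_bound[OF dis[OF w]] w by (simp add: upper_half_plane_def)
    qed
    \<comment> \<open>u is a combination of v and T(w) v with coefficients of modulus at most (1 +
      |w|) / 2 each, and |w| <= |z| + 1 on the unit disc around z.\<close>
    define K where "K = 2 + cmod z"
    have all: "(\<forall>u. norm u \<le> K * norm ((1 + 0 * w) *\<^sub>C u + (- \<i> + 1 * w) *\<^sub>C R w u)) \<and>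
      (\<forall>v. \<exists>u. (1 + 0 * w) *\<^sub>C u + (- \<i> + 1 * w) *\<^sub>C R w u = v) \<and>
      (\<forall>u. T w ((1 + 0 * w) *\<^sub>C u + (- \<i> + 1 * w) *\<^sub>C R w u) = (1 + 0 * w) *\<^sub>C u + (\<i> + 1 * w) *\<^sub>C R w u)"
      if w: "w \<in> upper_half_plane" "dist w z < 1" for w
    proof -
      have eqs: "(1 + 0 * w) *\<^sub>C u + (- \<i> + 1 * w) *\<^sub>C R w u = u + (w - \<i>) *\<^sub>C R w u"
        "(1 + 0 * w) *\<^sub>C u + (\<i> + 1 * w) *\<^sub>C R w u = u + (w + \<i>) *\<^sub>C R w u" for u
        by (simp_all add: add.commute)
      show ?thesis
        unfolding eqs
      proof (intro conjI allI)
        fix u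
        let ?v = "u + (w - \<i>) *\<^sub>C R w u"
        show "T w ?v = u + (w + \<i>) *\<^sub>C R w u" by (rule cayley_pairD(4)[OF T[OF w(1)]])
        have "cmod w \<le> cmod z + cmod (w - z)" by (metis add.commute diff_add_cancel norm_triangle_ineq)
        then have cw: "cmod w \<le> cmod z + 1" using w(2) by (simp add: dist_norm)
        have c: "cmod ((1 - \<i> * w) / 2) \<le> (1 + cmod w) / 2" "cmod ((1 + \<i> * w) / 2) \<le> (1 + cmod w) / 2"
          using norm_triangle_ineq4[of 1 "\<i> * w"] norm_triangle_ineq[of 1 "\<i> * w"]
          by (simp_all add: norm_divide norm_mult)
        have "norm u = norm (((1 - \<i> * w) / 2) *\<^sub>C ?v + ((1 + \<i> * w) / 2) *\<^sub>C T w ?v)"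
          by (simp only: cayley_pair_forward[OF T[OF w(1)]])
        also have "\<dots> \<le> (1 + cmod w) / 2 * norm ?v + (1 + cmod w) / 2 * norm ?v"
        proof (intro order_trans[OF norm_triangle_ineq] add_mono)
          show "norm (((1 - \<i> * w) / 2) *\<^sub>C ?v) \<le> (1 + cmod w) / 2 * norm ?v"
            unfolding norm_scaleC by (rule mult_right_mono[OF c(1)]) simp
          show "norm (((1 + \<i> * w) / 2) *\<^sub>C T w ?v) \<le> (1 + cmod w) / 2 * norm ?v"
            unfolding norm_scaleC by (rule mult_mono[OF c(2) cayley_pairD(2)[OF T[OF w(1)]]]) auto
        qed
        also have "\<dots> = (1 + cmod w) * norm ?v" by (simp add: field_simps)
        also have "\<dots> \<le> K * norm ?v" using cw by (intro mult_right_mono) (auto simp: K_def)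
        finally show "norm u \<le> K * norm ?v" .
      next
        fix v
        show "\<exists>u. u + (w - \<i>) *\<^sub>C R w u = v"
          using cayley_pairD(5)[OF T[OF w(1)], of v] by (simp only: eq_commute)
      qed
    qed
    have "\<forall>\<^sub>F w in at z. dist w z < 1" by (auto simp: eventually_at intro!: exI[of _ 1])
    with eventually_upper_half_plane[OF z] have ev: "\<forall>\<^sub>F w in at z. w \<in> upper_half_plane \<and> dist w z < 1"
      by eventually_elim auto
    have zz: "dist z z < 1" by simp
    show ?thesis
    proof (rule has_op_derivative_quotient'[OF G _ bdR[OF z]])
      show "\<forall>\<^sub>F w in at z. bdd_clin (R w)"
        using eventually_upper_half_plane[OF z] by eventually_elim (rule bdR)
      show "bdd_clin (T z)" by (rule bdd_clinI[of _ 1]) (use cayley_pairD(1,2)[OF T[OF z]] in auto)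
      show "K \<ge> 0" by (simp add: K_def)
      note a = all[OF z zz]
      from a show "norm u \<le> K * norm ((1 + 0 * z) *\<^sub>C u + (- \<i> + 1 * z) *\<^sub>C R z u)" for u by blast
      from a show "\<exists>u. (1 + 0 * z) *\<^sub>C u + (- \<i> + 1 * z) *\<^sub>C R z u = v" for v by blast
      from a show "T z ((1 + 0 * z) *\<^sub>C u + (- \<i> + 1 * z) *\<^sub>C R z u) = (1 + 0 * z) *\<^sub>C u + (\<i> + 1 * z) *\<^sub>C R z u" for u
        by blast
      from ev show "\<forall>\<^sub>F w in at z. (\<forall>u. norm u \<le> K * norm ((1 + 0 * w) *\<^sub>C u + (- \<i> + 1 * w) *\<^sub>C R w u)) \<and>
          (\<forall>v. \<exists>u. (1 + 0 * w) *\<^sub>C u + (- \<i> + 1 * w) *\<^sub>C R w u = v) \<and>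
          (\<forall>u. T w ((1 + 0 * w) *\<^sub>C u + (- \<i> + 1 * w) *\<^sub>C R w u) = (1 + 0 * w) *\<^sub>C u + (\<i> + 1 * w) *\<^sub>C R w u)"
        by eventually_elim (rule all; blast)
    qed
  qed
  have "operator_analytic_on (defect \<i> B) F upper_half_plane"
    unfolding operator_analytic_on_def
  proof
    fix z assume z: "z \<in> upper_half_plane"
    obtain G where G: "has_op_derivative T G z" using derT[OF z] by blast
    show "\<exists>G. \<forall>\<epsilon>>0. \<forall>\<^sub>F w in at z. \<forall>\<psi>\<in>defect \<i> B.
        norm (inverse (w - z) *\<^sub>C (F w \<psi> - F z \<psi>) - G \<psi>) \<le> \<epsilon> * norm \<psi>"
    proof (intro exI allI impI)
      fix e :: real assume e: "e > 0"
      have "\<forall>\<^sub>F w in at z. w \<noteq> z" by (simp add: eventually_at_filter)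
      with has_op_derivativeD[OF G e] eventually_upper_half_plane[OF z]
      show "\<forall>\<^sub>F w in at z. \<forall>\<psi>\<in>defect \<i> B. norm (inverse (w - z) *\<^sub>C (F w \<psi> - F z \<psi>) - G \<psi>) \<le> e * norm \<psi>"
        by eventually_elim (simp add: F z quotient_remainder)
    qed
  qed
  moreover have "F \<in> upper_half_plane \<rightarrow>\<^sub>E contractions (defect \<i> B) (defect (- \<i>) B)"
    using extends_cayley_restrict[OF ext] by (auto simp: F_def)
  ultimately have "F \<in> contractive_analytic (defect \<i> B) (defect (- \<i>) B)"
    by (simp add: contractive_analytic_def)
  moreover have "resolvent (quasi_sa_ext B (F z)) z = {(u, R z u) | u. True}" if z: "z \<in> upper_half_plane" for z
    by (rule resolvent_quasi_sa_ext[OF ext[OF z] _ T[OF z]]) (rule F[OF z])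
  ultimately show ?thesis by blast
qed

lemma parameter_unique:
  assumes F: "F \<in> contractive_analytic (defect \<i> B) (defect (- \<i>) B)"
    and F': "F' \<in> contractive_analytic (defect \<i> B) (defect (- \<i>) B)"
    and eq: "\<And>z. z \<in> upper_half_plane \<Longrightarrow> resolvent (quasi_sa_ext B (F z)) z = resolvent (quasi_sa_ext B (F' z)) z"
  shows "F = F'"
proof -
  obtain T R where T: "\<And>z. z \<in> upper_half_plane \<Longrightarrow> cayley_pair z (T z) (R z)"
    "\<And>z \<psi>. z \<in> upper_half_plane \<Longrightarrow> \<psi> \<in> defect \<i> B \<Longrightarrow> F z \<psi> = T z \<psi>"
    "\<And>z. z \<in> upper_half_plane \<Longrightarrow> resolvent (quasi_sa_ext B (F z)) z = {(u, R z u) | u. True}"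
    using resolvent_family[OF F] by blast
  obtain T' R' where T': "\<And>z. z \<in> upper_half_plane \<Longrightarrow> cayley_pair z (T' z) (R' z)"
    "\<And>z \<psi>. z \<in> upper_half_plane \<Longrightarrow> \<psi> \<in> defect \<i> B \<Longrightarrow> F' z \<psi> = T' z \<psi>"
    "\<And>z. z \<in> upper_half_plane \<Longrightarrow> resolvent (quasi_sa_ext B (F' z)) z = {(u, R' z u) | u. True}"
    using resolvent_family[OF F'] by blast
  have "F z = F' z" if z: "z \<in> upper_half_plane" for z
  proof -
    have "R z u = R' z u" for u
    proof -
      have "(u, R z u) \<in> {(u, R' z u) | u. True}"
        unfolding T'(3)[OF z, symmetric] eq[OF z, symmetric] T(3)[OF z] by blast
      then show ?thesis by blast
    qed
    then have "R z = R' z" by (rule ext)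
    then have TT: "T z = T' z" using cayley_pair_unique T(1)[OF z] T'(1)[OF z] by metis
    have "F z \<in> defect \<i> B \<rightarrow>\<^sub>E defect (- \<i>) B" "F' z \<in> defect \<i> B \<rightarrow>\<^sub>E defect (- \<i>) B"
      using F F' z by (auto simp: contractive_analytic_def contractions_def)
    then show ?thesis
      by (rule PiE_ext) (simp add: T(2)[OF z] T'(2)[OF z] TT)
  qed
  moreover have "F \<in> upper_half_plane \<rightarrow>\<^sub>E contractions (defect \<i> B) (defect (- \<i>) B)"
    "F' \<in> upper_half_plane \<rightarrow>\<^sub>E contractions (defect \<i> B) (defect (- \<i>) B)"
    using F F' by (auto simp: contractive_analytic_def)
  ultimately show ?thesis by (metis PiE_ext)
qed

end

section \<open>Riemann-Stieltjes sums\<close>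

text \<open>Each cell carries its endpoint closest to the origin, so that powers are dominated by their
  values on the cell.\<close>

definition rs_point :: "nat \<Rightarrow> int \<Rightarrow> real" where
  "rs_point i j = of_int (if j \<ge> 0 then j else j + 1) / of_nat (Suc i)"

text \<open>Cells of length 1 / (i + 1) covering the interval from -(i + 1) to i + 1: refinement and
  exhaustion of the line happen together, so a single limit suffices.\<close>

definition rs_cells :: "nat \<Rightarrow> int set" where
  "rs_cells i = {- (int (Suc i) * int (Suc i)) ..< int (Suc i) * int (Suc i)}"

definition rs_incr :: "nat \<Rightarrow> int \<Rightarrow> (real \<Rightarrow> complex) \<Rightarrow> complex" where
  "rs_incr i j m = m (of_int (j + 1) / of_nat (Suc i)) - m (of_int j / of_nat (Suc i))"

definition rs_sum :: "nat \<Rightarrow> (real \<Rightarrow> complex) \<Rightarrow> (real \<Rightarrow> complex) \<Rightarrow> complex" where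
  "rs_sum i f m = (\<Sum>j\<in>rs_cells i. f (rs_point i j) * rs_incr i j m)"

lemma rs_point_floor:
  assumes "j = \<lfloor>t * of_nat (Suc i)\<rfloor>"
  shows "\<bar>rs_point i j\<bar> \<le> \<bar>t\<bar>" "\<bar>t - rs_point i j\<bar> \<le> 1 / of_nat (Suc i)"
proof -
  have n: "real (Suc i) > 0" by simp
  have 1: "of_int j \<le> t * of_nat (Suc i)" "t * of_nat (Suc i) < of_int j + 1"
    unfolding assms by linarith+
  then have 2: "of_int j / of_nat (Suc i) \<le> t" "t < (of_int j + 1) / of_nat (Suc i)"
    using n by (simp_all only: pos_divide_le_eq pos_less_divide_eq)
  have 3: "(of_int j + 1) / of_nat (Suc i) = of_int j / of_nat (Suc i) + 1 / real (Suc i)"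
    by (rule add_divide_distrib)
  show "\<bar>t - rs_point i j\<bar> \<le> 1 / of_nat (Suc i)"
    using 2 3 by (auto simp: rs_point_def simp del: of_nat_Suc)
  show "\<bar>rs_point i j\<bar> \<le> \<bar>t\<bar>"
  proof (cases "j \<ge> 0")
    case True
    then have "of_int j / real (Suc i) \<ge> 0" by simp
    moreover have "rs_point i j = of_int j / real (Suc i)" using True by (simp add: rs_point_def)
    ultimately show ?thesis using 2 by linarith
  next
    case False
    then have "(of_int j + 1) / real (Suc i) \<le> 0" by (intro divide_nonpos_pos n) linarith
    moreover have "rs_point i j = (of_int j + 1) / real (Suc i)" using False by (simp add: rs_point_def)
    ultimately show ?thesis using 2 by linarith
  qed
qed

section \<open>Convergence of the sums to the integral\<close>

lemma sets_stieltjes_measure [simp, measurable_cong]: "sets (stieltjes_measure g) = sets borel"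
  by (simp add: stieltjes_measure_def)

lemma space_stieltjes_measure [simp]: "space (stieltjes_measure g) = UNIV"
  by (simp add: stieltjes_measure_def)

text \<open>Each sum is the integral of a step function taking the value of f at the marked point of
  each cell. Dominated convergence applies: the marked point of the cell of t lies within distance 1
  of t and no farther from 0.\<close>

lemma rs_sum_tendsto_stieltjes_measure:
  fixes f :: "real \<Rightarrow> complex"
  assumes g: "mono g" "\<And>t. continuous (at_left t) g"
    and f: "\<And>t. isCont f t" and h: "integrable (stieltjes_measure g) h"
    and dom: "\<And>c t. \<bar>c\<bar> \<le> \<bar>t\<bar> \<Longrightarrow> \<bar>t - c\<bar> \<le> 1 \<Longrightarrow> cmod (f c) \<le> h t"
  shows "(\<lambda>i. rs_sum i f (\<lambda>t. of_real (g t))) \<longlonglongrightarrow> (LINT t|stieltjes_measure g. f t)"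
proof -
  let ?\<mu> = "stieltjes_measure g"
  define A where "A i j = {of_int j / real (Suc i) ..< of_int (j + 1) / real (Suc i)}" for i and j :: int
  define s where "s i t = (\<Sum>j\<in>rs_cells i. indicat_real (A i j) t *\<^sub>R f (rs_point i j))" for i t
  have A: "t \<in> A i j \<longleftrightarrow> j = \<lfloor>t * of_nat (Suc i)\<rfloor>" for t i j
  proof -
    have "t \<in> A i j \<longleftrightarrow> of_int j \<le> t * of_nat (Suc i) \<and> t * of_nat (Suc i) < of_int j + 1"
      by (simp only: A_def atLeastLessThan_iff pos_divide_le_eq pos_less_divide_eq of_nat_0_less_iff zero_less_Suc
          of_int_add of_int_1)
    then show ?thesis by (simp only: floor_eq_iff eq_commute[of j])
  qed
  have s: "s i t = (if \<lfloor>t * of_nat (Suc i)\<rfloor> \<in> rs_cells i then f (rs_point i \<lfloor>t * of_nat (Suc i)\<rfloor>) else 0)" for i t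
  proof -
    have "s i t = (\<Sum>j\<in>rs_cells i. if j = \<lfloor>t * of_nat (Suc i)\<rfloor> then f (rs_point i j) else 0)"
      unfolding s_def by (intro sum.cong refl) (simp add: A indicator_def del: of_nat_Suc)
    then show ?thesis by (simp add: rs_cells_def del: of_nat_Suc)
  qed
  have le: "of_int j / real (Suc i) \<le> of_int (j + 1) / real (Suc i)" for j i
    by (intro divide_right_mono) auto
  have em: "emeasure ?\<mu> (A i j) = ennreal (g (of_int (j + 1) / real (Suc i)) - g (of_int j / real (Suc i)))" for i j
    unfolding A_def by (rule emeasure_stieltjes_measure[OF g le])
  have m: "measure ?\<mu> (A i j) = g (of_int (j + 1) / real (Suc i)) - g (of_int j / real (Suc i))" for i j
    unfolding measure_def em by (rule enn2real_ennreal) (use monoD[OF g(1) le] in simp)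
  have sets: "A i j \<in> sets ?\<mu>" for i j by (simp add: A_def)
  have integ: "integrable ?\<mu> (\<lambda>t. indicat_real (A i j) t *\<^sub>R f (rs_point i j))" for i j
    using sets by (intro integrable_scaleR_left integrable_real_indicator) (auto simp: em)
  have "(LINT t|?\<mu>. s i t) = rs_sum i f (\<lambda>t. of_real (g t))" for i
  proof -
    have "(LINT t|?\<mu>. s i t) = (\<Sum>j\<in>rs_cells i. (LINT t|?\<mu>. indicat_real (A i j) t *\<^sub>R f (rs_point i j)))"
      unfolding s_def by (rule Bochner_Integration.integral_sum) (rule integ)
    also have "\<dots> = rs_sum i f (\<lambda>t. of_real (g t))"
      unfolding rs_sum_def rs_incr_def
      by (intro sum.cong refl) (use sets in \<open>simp add: m scaleR_conv_of_real mult.commute del: of_nat_Suc of_int_add\<close>)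
    finally show ?thesis .
  qed
  moreover have "(\<lambda>i. LINT t|?\<mu>. s i t) \<longlonglongrightarrow> (LINT t|?\<mu>. f t)"
  proof (rule integral_dominated_convergence[where w=h])
    have [measurable]: "f \<in> borel_measurable borel"
      by (intro borel_measurable_continuous_onI continuous_at_imp_continuous_on) (simp add: f)
    show "f \<in> borel_measurable ?\<mu>" by simp
    show "s i \<in> borel_measurable ?\<mu>" for i
      unfolding s_def[abs_def] by (intro borel_measurable_sum borel_measurable_integrable integ)
    show "AE t in ?\<mu>. (\<lambda>i. s i t) \<longlonglongrightarrow> f t"
    proof (intro always_eventually allI)
      fix t
      have "(\<lambda>i. rs_point i \<lfloor>t * of_nat (Suc i)\<rfloor>) \<longlonglongrightarrow> t"
      proof (rule LIMSEQ_I)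
        fix r :: real assume "r > 0"
        then obtain k where k: "inverse (of_nat (Suc k)) < r" using reals_Archimedean by blast
        have "norm (rs_point i \<lfloor>t * of_nat (Suc i)\<rfloor> - t) < r" if "i \<ge> k" for i
        proof -
          have "norm (rs_point i \<lfloor>t * of_nat (Suc i)\<rfloor> - t) \<le> 1 / of_nat (Suc i)"
            using rs_point_floor(2)[OF refl, where t=t and i=i] by (simp add: abs_minus_commute del: of_nat_Suc)
          also have "\<dots> \<le> 1 / of_nat (Suc k)" using that by (intro divide_left_mono) auto
          also have "\<dots> < r" using k by (simp add: inverse_eq_divide del: of_nat_Suc)
          finally show ?thesis .
        qed
        then show "\<exists>no. \<forall>i\<ge>no. norm (rs_point i \<lfloor>t * of_nat (Suc i)\<rfloor> - t) < r" by blast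
      qed
      then have "(\<lambda>i. f (rs_point i \<lfloor>t * of_nat (Suc i)\<rfloor>)) \<longlonglongrightarrow> f t"
        by (rule isCont_tendsto_compose[OF f])
      moreover have "\<forall>\<^sub>F i in sequentially. f (rs_point i \<lfloor>t * of_nat (Suc i)\<rfloor>) = s i t"
      proof -
        obtain k :: nat where k: "\<bar>t\<bar> < k" using reals_Archimedean2 by blast
        have "\<lfloor>t * of_nat (Suc i)\<rfloor> \<in> rs_cells i" if "i \<ge> k" for i
        proof -
          have n: "real (Suc i) > 0" by simp
          have "\<bar>t\<bar> < real (Suc i)" using k that by simp
          then have "\<bar>t\<bar> * real (Suc i) < real (Suc i) * real (Suc i)"
            using n by (rule mult_strict_right_mono)
          then have "\<bar>t * real (Suc i)\<bar> < real (Suc i) * real (Suc i)"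
            by (simp add: abs_mult del: of_nat_Suc)
          then have "- (real (Suc i) * real (Suc i)) \<le> t * real (Suc i)" "t * real (Suc i) < real (Suc i) * real (Suc i)"
            by linarith+
          then show ?thesis
            unfolding rs_cells_def atLeastLessThan_iff le_floor_iff floor_less_iff by simp
        qed
        then show ?thesis unfolding eventually_sequentially s by (intro exI[of _ k]) auto
      qed
      ultimately show "(\<lambda>i. s i t) \<longlonglongrightarrow> f t" by (rule Lim_transform_eventually)
    qed
    show "AE t in ?\<mu>. norm (s i t) \<le> h t" for i
    proof (intro always_eventually allI)
      fix t
      have "1 / real (Suc i) \<le> 1" by simp
      then have "\<bar>t - rs_point i \<lfloor>t * of_nat (Suc i)\<rfloor>\<bar> \<le> 1"
        using rs_point_floor(2)[OF refl, where t=t and i=i] by linarith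
      with rs_point_floor(1)[OF refl, where t=t and i=i] have "cmod (f (rs_point i \<lfloor>t * of_nat (Suc i)\<rfloor>)) \<le> h t"
        by (rule dom)
      moreover have "0 \<le> h t" using order_trans[OF norm_ge_zero dom[of t t]] by simp
      ultimately show "norm (s i t) \<le> h t" unfolding s by simp
    qed
  qed (rule h)
  ultimately show ?thesis by simp
qed

lemma rs_incr_combination:
  "rs_incr i j (\<lambda>t. Complex (g1 t - g2 t) (g3 t - g4 t)) =
     rs_incr i j (\<lambda>t. of_real (g1 t)) - rs_incr i j (\<lambda>t. of_real (g2 t))
     + \<i> * (rs_incr i j (\<lambda>t. of_real (g3 t)) - rs_incr i j (\<lambda>t. of_real (g4 t)))"
  by (simp add: rs_incr_def complex_eq_iff del: of_nat_Suc)

lemma rs_sum_tendsto_of_decomposition: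
  fixes f :: "real \<Rightarrow> complex"
  assumes g: "\<forall>g\<in>{g1, g2, g3, g4}. mono g \<and> (\<forall>t. continuous (at_left t) g) \<and> integrable (stieltjes_measure g) h"
    and m: "\<forall>t. m t = Complex (g1 t - g2 t) (g3 t - g4 t)"
    and f: "\<And>t. isCont f t" and dom: "\<And>c t. \<bar>c\<bar> \<le> \<bar>t\<bar> \<Longrightarrow> \<bar>t - c\<bar> \<le> 1 \<Longrightarrow> cmod (f c) \<le> h t"
  shows "(\<lambda>i. rs_sum i f m) \<longlonglongrightarrow>
    ((LINT t|stieltjes_measure g1. f t) - (LINT t|stieltjes_measure g2. f t))
         + \<i> * ((LINT t|stieltjes_measure g3. f t) - (LINT t|stieltjes_measure g4. f t))"
proof -
  have lim: "(\<lambda>i. rs_sum i f (\<lambda>t. of_real (g t))) \<longlonglongrightarrow> (LINT t|stieltjes_measure g. f t)"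
    if "g \<in> {g1, g2, g3, g4}" for g
    using g that by (intro rs_sum_tendsto_stieltjes_measure[OF _ _ f _ dom]) auto
  have "m = (\<lambda>t. Complex (g1 t - g2 t) (g3 t - g4 t))" using m by auto
  then have "rs_sum i f m = rs_sum i f (\<lambda>t. of_real (g1 t)) - rs_sum i f (\<lambda>t. of_real (g2 t))
    + \<i> * (rs_sum i f (\<lambda>t. of_real (g3 t)) - rs_sum i f (\<lambda>t. of_real (g4 t)))" for i
    by (simp add: rs_sum_def rs_incr_combination sum_subtractf sum.distrib sum_distrib_left algebra_simps)
  then show ?thesis by (auto intro!: tendsto_intros lim)
qed

text \<open>What is known is the integrability of f itself, so the domination is asked in terms of
  |f| up to a constant.\<close>

lemma has_stieltjes_integral_imp_rs:
  assumes I: "has_stieltjes_integral f m I" and f: "\<And>t. isCont f t"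
    and dom: "\<And>c t. \<bar>c\<bar> \<le> \<bar>t\<bar> \<Longrightarrow> \<bar>t - c\<bar> \<le> 1 \<Longrightarrow> cmod (f c) \<le> C * cmod (f t)"
  shows "(\<lambda>i. rs_sum i f m) \<longlonglongrightarrow> I"
proof -
  obtain g1 g2 g3 g4 where g: "\<forall>g\<in>{g1, g2, g3, g4}. mono g \<and> (\<forall>t. continuous (at_left t) g) \<and>
          integrable (stieltjes_measure g) f" "\<forall>t. m t = Complex (g1 t - g2 t) (g3 t - g4 t)"
    "I = ((LINT t|stieltjes_measure g1. f t) - (LINT t|stieltjes_measure g2. f t))
         + \<i> * ((LINT t|stieltjes_measure g3. f t) - (LINT t|stieltjes_measure g4. f t))"
    using I unfolding has_stieltjes_integral_def by blast
  show ?thesis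
    unfolding g(3)
    by (rule rs_sum_tendsto_of_decomposition[OF _ g(2) f dom]) (use g(1) in auto)
qed

text \<open>A decomposition that serves the n-th moment serves the product as well, so the integral
  and the limit of the sums are read off the same four measures.\<close>

lemma has_stieltjes_integral_times_bounded:
  fixes \<phi> :: "real \<Rightarrow> complex"
  assumes I: "has_stieltjes_integral (\<lambda>t. of_real (t ^ n)) m I" and \<phi>: "\<And>t. isCont \<phi> t" "\<And>t. cmod (\<phi> t) \<le> K"
  shows "\<exists>J. has_stieltjes_integral (\<lambda>t. \<phi> t * of_real (t ^ n)) m J \<and> (\<lambda>i. rs_sum i (\<lambda>t. \<phi> t * of_real (t ^ n)) m) \<longlonglongrightarrow> J"
proof -
  let ?f = "\<lambda>t. \<phi> t * complex_of_real (t ^ n)" and ?h = "\<lambda>t. K * \<bar>t\<bar> ^ n"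
  obtain g1 g2 g3 g4 where g: "\<forall>g\<in>{g1, g2, g3, g4}. mono g \<and> (\<forall>t. continuous (at_left t) g) \<and>
          integrable (stieltjes_measure g) (\<lambda>t. complex_of_real (t ^ n))" "\<forall>t. m t = Complex (g1 t - g2 t) (g3 t - g4 t)"
    using I unfolding has_stieltjes_integral_def by blast
  have cont: "isCont ?f t" for t using \<phi>(1) by (intro continuous_intros) auto
  have [measurable]: "?f \<in> borel_measurable borel"
    by (intro borel_measurable_continuous_onI continuous_at_imp_continuous_on ballI cont)
  have ints: "integrable (stieltjes_measure g) ?h \<and> integrable (stieltjes_measure g) ?f" if "g \<in> {g1, g2, g3, g4}" for g
  proof -
    have "integrable (stieltjes_measure g) (\<lambda>t. complex_of_real (t ^ n))" using g(1) that by blast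
    then have "integrable (stieltjes_measure g) (\<lambda>t. norm (complex_of_real (t ^ n)))" by (rule integrable_norm)
    then have h: "integrable (stieltjes_measure g) ?h"
      by (intro integrable_mult_right) (simp add: norm_power)
    moreover have "integrable (stieltjes_measure g) ?f"
    proof (rule Bochner_Integration.integrable_bound[OF h])
      show "?f \<in> borel_measurable (stieltjes_measure g)" by measurable
      have "cmod (?f t) \<le> norm (?h t)" for t
        using mult_right_mono[OF order_trans[OF \<phi>(2) abs_ge_self], of "\<bar>t\<bar> ^ n" t]
        by (simp add: norm_mult norm_power abs_mult)
      then show "AE t in stieltjes_measure g. norm (?f t) \<le> norm (?h t)" by simp
    qed
    ultimately show ?thesis by blast
  qed
  have K: "K \<ge> 0" using order_trans[OF norm_ge_zero \<phi>(2)] .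
  define J where "J = ((LINT t|stieltjes_measure g1. ?f t) - (LINT t|stieltjes_measure g2. ?f t))
         + \<i> * ((LINT t|stieltjes_measure g3. ?f t) - (LINT t|stieltjes_measure g4. ?f t))"
  have "has_stieltjes_integral ?f m J"
    unfolding has_stieltjes_integral_def
    by (intro exI[of _ g1] exI[of _ g2] exI[of _ g3] exI[of _ g4]) (use g ints J_def in auto)
  moreover have "(\<lambda>i. rs_sum i ?f m) \<longlonglongrightarrow> J"
    unfolding J_def
  proof (rule rs_sum_tendsto_of_decomposition[OF _ g(2) cont])
    show "\<forall>g\<in>{g1, g2, g3, g4}. mono g \<and> (\<forall>t. continuous (at_left t) g) \<and> integrable (stieltjes_measure g) ?h"
      using g(1) ints by blast
    fix c t :: real assume "\<bar>c\<bar> \<le> \<bar>t\<bar>"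
    then show "cmod (?f c) \<le> ?h t"
      using K \<phi>(2)[of c] by (auto simp: norm_mult norm_power intro!: mult_mono power_mono)
  qed
  ultimately show ?thesis by blast
qed

lemma rs_sum_linear:
  "rs_sum i (\<lambda>t. a * f t + b * g t) m = a * rs_sum i f m + b * rs_sum i g m"
  by (simp add: rs_sum_def sum.distrib sum_distrib_left algebra_simps)

section \<open>The functional calculus of a solution\<close>

lemma hermitian_mat_index:
  assumes "A \<in> carrier_mat N N" "hermitian_mat A" "k < N" "j < N"
  shows "A $$ (j, k) = cnj (A $$ (k, j))"
proof -
  have "mat_adjoint A $$ (j, k) = cnj (A $$ (k, j))"
    using assms by (simp add: mat_adjoint_def mat_of_rows_def)
  then show ?thesis using assms(2) by (simp add: hermitian_mat_def)
qed

lemma psd_mat_sum_nonneg: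
  assumes A: "psd_mat N A"
  shows "0 \<le> (\<Sum>k<N. \<Sum>j<N. a k * cnj (a j) * A $$ (k, j))"
proof -
  have dim: "A \<in> carrier_mat N N" using A by (simp add: psd_mat_def)
  \<comment> \<open>Conjugated entries, because the scalar product conjugates its second factor and
    the entry (k, j) is to carry a k * cnj (a j).\<close>
  let ?v = "vec N (\<lambda>k. cnj (a k))"
  have "0 \<le> (A *\<^sub>v ?v) \<bullet>c ?v" using A by (simp add: psd_mat_def)
  also have "(A *\<^sub>v ?v) \<bullet>c ?v = (\<Sum>k<N. \<Sum>j<N. a k * cnj (a j) * A $$ (k, j))"
    using dim by (auto simp: scalar_prod_def sum_distrib_left sum_distrib_right atLeast0LessThan mult_ac intro!: sum.cong)
  finally show ?thesis .
qed

locale hamburger_data =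
  fixes N :: nat and S :: "nat \<Rightarrow> complex mat" and x :: "nat \<Rightarrow> 'h::complex_hilbert"
  assumes N: "N \<ge> 1"
    and S: "\<And>n. S n \<in> carrier_mat N N"
    and herm: "\<And>n. hermitian_mat (S n)"
    and gram: "\<And>n m. cinner (x n) (x m) = hankel_entry N S n m"
    and dense: "closure (Modules.module.span scaleC (range x)) = UNIV"

lemma (in hamburger_data) bdd_clin_eq:
  assumes T: "clin T" "\<And>u. norm (T u) \<le> K * norm u" and T': "clin T'" "\<And>u. norm (T' u) \<le> K' * norm u"
    and eq: "\<And>n m. cinner (T (x n)) (x m) = cinner (T' (x n)) (x m)"
  shows "T u = T' u"
proof (rule clin_eq_on_dense[OF T T' dense])
  fix n
  have "cinner (T (x n) - T' (x n)) (lincomb x p \<beta>) = 0" for p \<beta>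
    by (simp add: lincomb_def cinner_sum_right cinner_simps eq)
  then have "norm (T (x n) - T' (x n)) \<le> 0"
    by (intro norm_le_of_dense_cinner[OF dense]) auto
  then show "T (x n) = T' (x n)" by simp
qed

locale hamburger_solution_data = hamburger_data N S x
  for N :: nat and S :: "nat \<Rightarrow> complex mat" and x :: "nat \<Rightarrow> 'h::complex_hilbert" +
  fixes M :: "real \<Rightarrow> complex mat"
  assumes sol: "hamburger_solution N S M"
begin

section \<open>Positivity of the increments of a solution\<close>

definition kern :: "nat \<Rightarrow> int \<Rightarrow> nat \<Rightarrow> nat \<Rightarrow> complex" where
  "kern i j n m = of_real (rs_point i j ^ (n div N + m div N)) * rs_incr i j (\<lambda>t. M t $$ (n mod N, m mod N))"

definition cell_form :: "nat \<Rightarrow> int \<Rightarrow> nat \<Rightarrow> (nat \<Rightarrow> complex) \<Rightarrow> (nat \<Rightarrow> complex) \<Rightarrow> complex" where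
  "cell_form i j p \<alpha> \<beta> = (\<Sum>n<p. \<Sum>m<p. \<alpha> n * cnj (\<beta> m) * kern i j n m)"

lemma mod_N: "n mod N < N"
  using N by simp

text \<open>Collecting the coefficients of the same residue modulo \<open>N\<close> turns the form into a value of the
  quadratic form of one increment of \<open>M\<close>.\<close>

lemma cell_form_nonneg: "0 \<le> cell_form i j p \<alpha> \<alpha>"
proof -
  let ?c = "rs_point i j"
  define a where "a k = (\<Sum>n\<in>{n\<in>{..<p}. n mod N = k}. \<alpha> n * of_real (?c ^ (n div N)))" for k
  define D where "D = M (of_int (j + 1) / of_nat (Suc i)) - M (of_int j / of_nat (Suc i))"
  have "of_int j / real (Suc i) \<le> of_int (j + 1) / real (Suc i)" by (intro divide_right_mono) auto
  then have D: "psd_mat N D" using sol by (simp add: hamburger_solution_def D_def del: of_nat_Suc)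
  have car: "M t \<in> carrier_mat N N" for t using sol by (simp add: hamburger_solution_def)
  have D_index: "rs_incr i j (\<lambda>t. M t $$ (k, l)) = D $$ (k, l)" if "k < N" "l < N" for k l
    using that car[of "of_int (j + 1) / of_nat (Suc i)"] car[of "of_int j / of_nat (Suc i)"]
    by (simp add: rs_incr_def D_def del: of_nat_Suc)
  have grp: "(\<Sum>k<N. a k * h k) = (\<Sum>n<p. \<alpha> n * of_real (?c ^ (n div N)) * h (n mod N))" for h
  proof -
    have "(\<Sum>k<N. a k * h k) = (\<Sum>k<N. \<Sum>n\<in>{n\<in>{..<p}. n mod N = k}. \<alpha> n * of_real (?c ^ (n div N)) * h (n mod N))"
      unfolding a_def sum_distrib_right by (intro sum.cong refl) auto
    also have "\<dots> = (\<Sum>n<p. \<alpha> n * of_real (?c ^ (n div N)) * h (n mod N))"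
      by (rule sum.group) (use mod_N in auto)
    finally show ?thesis .
  qed
  have "(\<Sum>k<N. \<Sum>l<N. a k * cnj (a l) * D $$ (k, l)) = (\<Sum>k<N. a k * (\<Sum>l<N. cnj (a l) * D $$ (k, l)))"
    by (simp add: sum_distrib_left mult.assoc)
  also have "\<dots> = (\<Sum>n<p. \<alpha> n * of_real (?c ^ (n div N)) * (\<Sum>l<N. cnj (a l) * D $$ (n mod N, l)))"
    by (rule grp)
  also have "\<dots> = (\<Sum>n<p. \<alpha> n * of_real (?c ^ (n div N)) *
      (\<Sum>m<p. cnj (\<alpha> m) * of_real (?c ^ (m div N)) * D $$ (n mod N, m mod N)))"
  proof -
    have "(\<Sum>l<N. cnj (a l) * D $$ (n mod N, l)) = (\<Sum>m<p. cnj (\<alpha> m) * of_real (?c ^ (m div N)) * D $$ (n mod N, m mod N))" for n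
    proof -
      \<comment> \<open>The regrouping rule is stated for unconjugated weights, so it is applied to
        the conjugate of the inner sum.\<close>
      have "cnj (\<Sum>l<N. cnj (a l) * D $$ (n mod N, l)) = (\<Sum>l<N. a l * cnj (D $$ (n mod N, l)))" by simp
      also have "\<dots> = (\<Sum>m<p. \<alpha> m * of_real (?c ^ (m div N)) * cnj (D $$ (n mod N, m mod N)))" by (rule grp)
      also have "\<dots> = cnj (\<Sum>m<p. cnj (\<alpha> m) * of_real (?c ^ (m div N)) * D $$ (n mod N, m mod N))" by simp
      finally show ?thesis by (simp only: complex_cnj_cancel_iff)
    qed
    then show ?thesis by (simp only:)
  qed
  also have "\<dots> = cell_form i j p \<alpha> \<alpha>"
    unfolding cell_form_def kern_def sum_distrib_left
    by (intro sum.cong refl) (simp add: D_index mod_N power_add mult_ac)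
  finally show ?thesis using psd_mat_sum_nonneg[OF D, of a] by simp
qed

lemma cell_form_hermitian: "cell_form i j p \<beta> \<alpha> = cnj (cell_form i j p \<alpha> \<beta>)"
proof -
  have k: "kern i j m n = cnj (kern i j n m)" for n m
    using sol hermitian_mat_index[of _ N "n mod N" "m mod N"] mod_N
    by (simp add: kern_def rs_incr_def hamburger_solution_def add.commute del: of_nat_Suc)
  show ?thesis
    unfolding cell_form_def
    by (subst sum.swap) (auto simp: k[symmetric] mult_ac intro!: sum.cong)
qed

lemma cell_form_diff:
  "cell_form i j p (\<lambda>n. f * \<alpha> n - \<beta> n) (\<lambda>n. f * \<alpha> n - \<beta> n)
    = f * cnj f * cell_form i j p \<alpha> \<alpha> - f * cell_form i j p \<alpha> \<beta> - cnj f * cell_form i j p \<beta> \<alpha> + cell_form i j p \<beta> \<beta>"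
  by (simp add: cell_form_def sum_subtractf sum.distrib sum_distrib_left algebra_simps)

text \<open>Positivity of the form of one cell at f \<alpha> - \<beta>. The factor f may differ from
  cell to cell, which is how functions of the integration variable enter the estimates.\<close>

lemma cell_form_square:
  "0 \<le> (cmod f)\<^sup>2 * Re (cell_form i j p \<alpha> \<alpha>) - 2 * Re (f * cell_form i j p \<alpha> \<beta>) + Re (cell_form i j p \<beta> \<beta>)"
proof -
  have "0 \<le> Re (cell_form i j p (\<lambda>n. f * \<alpha> n - \<beta> n) (\<lambda>n. f * \<alpha> n - \<beta> n))"
    using cell_form_nonneg by (simp add: less_eq_complex_def)
  also have "\<dots> = (cmod f)\<^sup>2 * Re (cell_form i j p \<alpha> \<alpha>) - 2 * Re (f * cell_form i j p \<alpha> \<beta>) + Re (cell_form i j p \<beta> \<beta>)"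
    unfolding cell_form_diff complex_norm_square[symmetric] cell_form_hermitian[of i j p \<beta> \<alpha>]
    by simp
  finally show ?thesis .
qed

text \<open>In the space L^2(dM), where x_n stands for t^(n div N) times the unit vector of index n
  mod N, \<open>b\<close> is the matrix of multiplication by \<phi> compressed to H; that space
  itself is never formed.\<close>

definition represents :: "(real \<Rightarrow> complex) \<Rightarrow> (nat \<Rightarrow> nat \<Rightarrow> complex) \<Rightarrow> bool" where
  "represents \<phi> b \<longleftrightarrow> (\<forall>n m. (\<lambda>i. rs_sum i (\<lambda>t. \<phi> t * of_real (t ^ (n div N + m div N))) (\<lambda>t. M t $$ (n mod N, m mod N)))
      \<longlonglongrightarrow> b n m)"

section \<open>Operators of bounded continuous functions\<close>

lemma represents_exists:
  assumes "\<And>t. isCont \<phi> t" "\<And>t. cmod (\<phi> t) \<le> K"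
  shows "\<exists>b. represents \<phi> b"
proof -
  have "\<exists>J. (\<lambda>i. rs_sum i (\<lambda>t. \<phi> t * of_real (t ^ (n div N + m div N))) (\<lambda>t. M t $$ (n mod N, m mod N))) \<longlonglongrightarrow> J" for n m
  proof -
    have "has_stieltjes_integral (\<lambda>t. of_real (t ^ (n div N + m div N))) (\<lambda>t. M t $$ (n mod N, m mod N))
        (S (n div N + m div N) $$ (n mod N, m mod N))"
      using sol mod_N by (simp add: hamburger_solution_def)
    from has_stieltjes_integral_times_bounded[OF this assms] show ?thesis by blast
  qed
  then show ?thesis unfolding represents_def by metis
qed

lemma represents_one: "represents (\<lambda>_. 1) (\<lambda>n m. cinner (x n) (x m))"
  unfolding represents_def
proof (intro allI)
  fix n m
  have "has_stieltjes_integral (\<lambda>t. of_real (t ^ (n div N + m div N))) (\<lambda>t. M t $$ (n mod N, m mod N))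
      (S (n div N + m div N) $$ (n mod N, m mod N))"
    using sol mod_N by (simp add: hamburger_solution_def)
  then have "(\<lambda>i. rs_sum i (\<lambda>t. of_real (t ^ (n div N + m div N))) (\<lambda>t. M t $$ (n mod N, m mod N)))
      \<longlonglongrightarrow> S (n div N + m div N) $$ (n mod N, m mod N)"
    by (rule has_stieltjes_integral_imp_rs[where C=1]) (auto simp: norm_power power_abs intro!: power_mono)
  then show "(\<lambda>i. rs_sum i (\<lambda>t. 1 * of_real (t ^ (n div N + m div N))) (\<lambda>t. M t $$ (n mod N, m mod N)))
      \<longlonglongrightarrow> cinner (x n) (x m)"
    by (simp add: gram hankel_entry_def)
qed

lemma represents_linear:
  assumes "represents \<phi> b" "represents \<psi> c"
  shows "represents (\<lambda>t. u * \<phi> t + v * \<psi> t) (\<lambda>n m. u * b n m + v * c n m)"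
proof -
  have "rs_sum i (\<lambda>t. (u * \<phi> t + v * \<psi> t) * of_real (t ^ r)) m
      = u * rs_sum i (\<lambda>t. \<phi> t * of_real (t ^ r)) m + v * rs_sum i (\<lambda>t. \<psi> t * of_real (t ^ r)) m" for i r m
    unfolding rs_sum_linear[symmetric] by (simp add: algebra_simps)
  then show ?thesis using assms unfolding represents_def by (auto intro!: tendsto_intros)
qed

lemma represents_form_tendsto:
  assumes "represents \<phi> b"
  shows "(\<lambda>i. \<Sum>j\<in>rs_cells i. \<phi> (rs_point i j) * cell_form i j p \<alpha> \<beta>) \<longlonglongrightarrow> (\<Sum>n<p. \<Sum>m<p. \<alpha> n * cnj (\<beta> m) * b n m)"
proof -
  have "(\<Sum>j\<in>rs_cells i. \<phi> (rs_point i j) * cell_form i j p \<alpha> \<beta>)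
    = (\<Sum>n<p. \<Sum>m<p. \<alpha> n * cnj (\<beta> m) * rs_sum i (\<lambda>t. \<phi> t * of_real (t ^ (n div N + m div N))) (\<lambda>t. M t $$ (n mod N, m mod N)))" for i
  proof -
    have "(\<Sum>j\<in>rs_cells i. \<phi> (rs_point i j) * cell_form i j p \<alpha> \<beta>)
      = (\<Sum>j\<in>rs_cells i. \<Sum>n<p. \<Sum>m<p. \<alpha> n * cnj (\<beta> m) * (\<phi> (rs_point i j) * kern i j n m))"
      unfolding cell_form_def sum_distrib_left by (intro sum.cong refl) (simp add: mult_ac)
    also have "\<dots> = (\<Sum>n<p. \<Sum>m<p. \<Sum>j\<in>rs_cells i. \<alpha> n * cnj (\<beta> m) * (\<phi> (rs_point i j) * kern i j n m))"
      by (subst sum.swap) (intro sum.cong refl sum.swap)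
    finally show ?thesis
      by (simp add: rs_sum_def kern_def sum_distrib_left mult.assoc)
  qed
  then show ?thesis using assms unfolding represents_def by (auto intro!: tendsto_intros)
qed

lemma norm_lincomb_tendsto:
  "(\<lambda>i. \<Sum>j\<in>rs_cells i. Re (cell_form i j p \<alpha> \<alpha>)) \<longlonglongrightarrow> (norm (lincomb x p \<alpha>))\<^sup>2"
  using tendsto_Re[OF represents_form_tendsto[OF represents_one, of p \<alpha> \<alpha>]]
  by (simp add: norm_sq_cinner cinner_lincomb)

text \<open>Sums the cellwise inequality with f the value of \<phi> and passes to the limit. The
  last hypothesis is met in two ways: |\<phi>| <= K gives boundedness, and Im \<phi> = y |\<phi>|^2
  gives dissipativity.\<close>

lemma represents_square_le:
  assumes b: "represents \<phi> b" and q: "q \<longlonglongrightarrow> Q"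
    and le: "\<And>i. (\<Sum>j\<in>rs_cells i. (cmod (\<phi> (rs_point i j)))\<^sup>2 * Re (cell_form i j p \<alpha> \<alpha>)) \<le> q i"
  shows "2 * Re (\<Sum>n<p. \<Sum>m<p. \<alpha> n * cnj (\<beta> m) * b n m) \<le> Q + (norm (lincomb x p \<beta>))\<^sup>2"
proof (rule LIMSEQ_le)
  show "(\<lambda>i. 2 * Re (\<Sum>j\<in>rs_cells i. \<phi> (rs_point i j) * cell_form i j p \<alpha> \<beta>))
      \<longlonglongrightarrow> 2 * Re (\<Sum>n<p. \<Sum>m<p. \<alpha> n * cnj (\<beta> m) * b n m)"
    by (intro tendsto_intros represents_form_tendsto b)
  show "(\<lambda>i. q i + (\<Sum>j\<in>rs_cells i. Re (cell_form i j p \<beta> \<beta>))) \<longlonglongrightarrow> Q + (norm (lincomb x p \<beta>))\<^sup>2"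
    by (intro tendsto_intros q norm_lincomb_tendsto)
  show "\<exists>k. \<forall>i\<ge>k. 2 * Re (\<Sum>j\<in>rs_cells i. \<phi> (rs_point i j) * cell_form i j p \<alpha> \<beta>)
      \<le> q i + (\<Sum>j\<in>rs_cells i. Re (cell_form i j p \<beta> \<beta>))"
  proof (intro exI allI impI)
    fix i
    have "(\<Sum>j\<in>rs_cells i. 2 * Re (\<phi> (rs_point i j) * cell_form i j p \<alpha> \<beta>))
      \<le> (\<Sum>j\<in>rs_cells i. (cmod (\<phi> (rs_point i j)))\<^sup>2 * Re (cell_form i j p \<alpha> \<alpha>) + Re (cell_form i j p \<beta> \<beta>))"
    proof (rule sum_mono)
      fix j show "2 * Re (\<phi> (rs_point i j) * cell_form i j p \<alpha> \<beta>)
          \<le> (cmod (\<phi> (rs_point i j)))\<^sup>2 * Re (cell_form i j p \<alpha> \<alpha>) + Re (cell_form i j p \<beta> \<beta>)"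
        using cell_form_square[of "\<phi> (rs_point i j)" i j p \<alpha> \<beta>] by linarith
    qed
    then show "2 * Re (\<Sum>j\<in>rs_cells i. \<phi> (rs_point i j) * cell_form i j p \<alpha> \<beta>)
      \<le> q i + (\<Sum>j\<in>rs_cells i. Re (cell_form i j p \<beta> \<beta>))"
      using le[of i] by (simp add: sum_distrib_left sum.distrib Re_sum del: times_complex.sel)
  qed
qed

text \<open>Scaling \<beta> by s and rotating \<alpha> by e turns the additive estimate into a bound
  by a product.\<close>

lemma represents_bound:
  assumes b: "represents \<phi> b" and K: "\<And>t. cmod (\<phi> t) \<le> K"
  shows "cmod (\<Sum>n<p. \<Sum>m<p. \<alpha> n * cnj (\<beta> m) * b n m) \<le> K * norm (lincomb x p \<alpha>) * norm (lincomb x p \<beta>)"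
proof (rule cmod_le_of_Re_le)
  fix e :: complex assume e: "cmod e = 1"
  have K0: "K \<ge> 0" by (rule order_trans[OF norm_ge_zero K])
  show "Re (e * (\<Sum>n<p. \<Sum>m<p. \<alpha> n * cnj (\<beta> m) * b n m)) \<le> K * norm (lincomb x p \<alpha>) * norm (lincomb x p \<beta>)"
  proof (rule le_mult_of_scaled_le)
    fix s :: real assume "s > 0"
    let ?a = "\<lambda>n. e * \<alpha> n" and ?b = "\<lambda>n. of_real s * \<beta> n"
    have n: "lincomb x p ?a = e *\<^sub>C lincomb x p \<alpha>" "lincomb x p ?b = of_real s *\<^sub>C lincomb x p \<beta>"
      by (simp_all add: lincomb_def scaleC_sum_right scaleC_scaleC)
    have "2 * Re (\<Sum>n<p. \<Sum>m<p. ?a n * cnj (?b m) * b n m) \<le> K\<^sup>2 * (norm (lincomb x p ?a))\<^sup>2 + (norm (lincomb x p ?b))\<^sup>2"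
    proof (rule represents_square_le[OF b])
      show "(\<lambda>i. K\<^sup>2 * (\<Sum>j\<in>rs_cells i. Re (cell_form i j p ?a ?a))) \<longlonglongrightarrow> K\<^sup>2 * (norm (lincomb x p ?a))\<^sup>2"
        by (intro tendsto_intros norm_lincomb_tendsto)
      fix i
      show "(\<Sum>j\<in>rs_cells i. (cmod (\<phi> (rs_point i j)))\<^sup>2 * Re (cell_form i j p ?a ?a))
        \<le> K\<^sup>2 * (\<Sum>j\<in>rs_cells i. Re (cell_form i j p ?a ?a))"
        unfolding sum_distrib_left
        by (intro sum_mono mult_right_mono power_mono K) (use cell_form_nonneg in \<open>auto simp: less_eq_complex_def\<close>)
    qed
    moreover have "(\<Sum>n<p. \<Sum>m<p. ?a n * cnj (?b m) * b n m) = of_real s * (e * (\<Sum>n<p. \<Sum>m<p. \<alpha> n * cnj (\<beta> m) * b n m))"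
      by (simp add: sum_distrib_left mult_ac)
    moreover have "Re (of_real s * w) = s * Re w" for w by simp
    ultimately show "2 * s * Re (e * (\<Sum>n<p. \<Sum>m<p. \<alpha> n * cnj (\<beta> m) * b n m))
      \<le> (K * norm (lincomb x p \<alpha>))\<^sup>2 + s\<^sup>2 * (norm (lincomb x p \<beta>))\<^sup>2"
      by (simp only: n norm_scaleC norm_of_real e mult_1 power_mult_distrib mult.assoc power2_abs)
  qed (use K0 in auto)
qed

lemma operator_exists:
  assumes "\<And>t. isCont \<phi> t" and K: "\<And>t. cmod (\<phi> t) \<le> K"
  shows "\<exists>T. clin T \<and> (\<forall>u. norm (T u) \<le> K * norm u) \<and> represents \<phi> (\<lambda>n m. cinner (T (x n)) (x m))"
proof -
  obtain b where b: "represents \<phi> b" using represents_exists[OF assms] by blast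
  have K0: "K \<ge> 0" by (rule order_trans[OF norm_ge_zero K])
  from bounded_operator_of_kernel[OF dense K0 represents_bound[OF b K]]
  obtain T where T: "clin T" "\<And>u. norm (T u) \<le> K * norm u" "\<And>n m. cinner (T (x n)) (x m) = b n m" by blast
  then show ?thesis using b by (intro exI[of _ T]) simp
qed

lemma represents_unique:
  assumes "represents \<phi> b" "represents \<phi> c"
  shows "b n m = c n m"
  using assms LIMSEQ_unique unfolding represents_def by blast

text \<open>The kernel determines the operator, so a crude bound K' improves to any bound K of
  |\<phi>|. Remainders of resolvents are estimated in this way.\<close>

lemma represents_operator_bound:
  assumes "\<And>t. isCont \<phi> t" "\<And>t. cmod (\<phi> t) \<le> K"
    and T: "clin T" "\<And>u. norm (T u) \<le> K' * norm u" "represents \<phi> (\<lambda>n m. cinner (T (x n)) (x m))"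
  shows "norm (T u) \<le> K * norm u"
proof -
  obtain T' where T': "clin T'" "\<And>u. norm (T' u) \<le> K * norm u" "represents \<phi> (\<lambda>n m. cinner (T' (x n)) (x m))"
    using operator_exists[OF assms(1,2)] by blast
  have "T u = T' u"
    by (rule bdd_clin_eq[OF T(1,2) T'(1,2)]) (rule represents_unique[OF T(3) T'(3)])
  then show ?thesis using T'(2) by simp
qed

text \<open>The estimate 2 Re (T u, v) <= Im (T u, u) / y + |v|^2 extends by density to all pairs,
  and v = T u gives the claim. The condition on \<phi> is satisfied by 1 / (t - z) with y = Im
  z.\<close>

lemma dissipative_operator:
  assumes T: "clin T" "\<And>u. norm (T u) \<le> K * norm u" "represents \<phi> (\<lambda>n m. cinner (T (x n)) (x m))"
    and y: "y > 0" "\<And>t. Im (\<phi> t) = y * (cmod (\<phi> t))\<^sup>2"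
  shows "y * (norm (T u))\<^sup>2 \<le> Im (cinner (T u) u)"
proof -
  let ?L = "Modules.module.span scaleC (range x)"
  have cT: "continuous_on A T" for A
    unfolding continuous_on_def using clin_tendsto[OF T(1,2) tendsto_ident_at] by blast
  have 1: "2 * Re (cinner (T u) v) \<le> (1 / y) * Im (cinner (T u) u) + (norm v)\<^sup>2" if "u \<in> ?L" "v \<in> ?L" for u v
  proof -
    obtain p \<alpha> q \<beta> where "u = lincomb x p \<alpha>" "v = lincomb x q \<beta>"
      using \<open>u \<in> ?L\<close> \<open>v \<in> ?L\<close> unfolding span_eq_lincombs by blast
    then obtain r \<alpha> \<beta> where uv: "u = lincomb x r \<alpha>" "v = lincomb x r \<beta>"
      using lincomb_pad[of p "max p q"] lincomb_pad[of q "max p q"] by (metis max.cobounded1 max.cobounded2)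
    have form: "cinner (T (lincomb x r \<alpha>)) (lincomb x r \<beta>) = (\<Sum>n<r. \<Sum>m<r. \<alpha> n * cnj (\<beta> m) * cinner (T (x n)) (x m))" for \<alpha> \<beta>
    proof -
      have "T (lincomb x r \<alpha>) = lincomb (\<lambda>n. T (x n)) r \<alpha>"
        by (simp add: lincomb_def clin_sum[OF T(1)] clin_scaleC[OF T(1)])
      then show ?thesis by (simp add: cinner_lincomb)
    qed
    show ?thesis
      unfolding uv form
    proof (rule represents_square_le[OF T(3)])
      show "(\<lambda>i. (1 / y) * Im (\<Sum>j\<in>rs_cells i. \<phi> (rs_point i j) * cell_form i j r \<alpha> \<alpha>))
        \<longlonglongrightarrow> (1 / y) * Im (\<Sum>n<r. \<Sum>m<r. \<alpha> n * cnj (\<alpha> m) * cinner (T (x n)) (x m))"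
        by (intro tendsto_intros represents_form_tendsto T(3))
      fix i
      have "Im (cell_form i j r \<alpha> \<alpha>) = 0" for j
        using cell_form_nonneg[of i j r \<alpha>] by (simp add: less_eq_complex_def)
      then have "(1 / y) * Im (\<Sum>j\<in>rs_cells i. \<phi> (rs_point i j) * cell_form i j r \<alpha> \<alpha>)
          = (\<Sum>j\<in>rs_cells i. (cmod (\<phi> (rs_point i j)))\<^sup>2 * Re (cell_form i j r \<alpha> \<alpha>))"
        using y(1) by (simp add: sum_distrib_left y(2))
      then show "(\<Sum>j\<in>rs_cells i. (cmod (\<phi> (rs_point i j)))\<^sup>2 * Re (cell_form i j r \<alpha> \<alpha>))
        \<le> (1 / y) * Im (\<Sum>j\<in>rs_cells i. \<phi> (rs_point i j) * cell_form i j r \<alpha> \<alpha>)" by simp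
    qed
  qed
  let ?P = "{(u, v). 2 * Re (cinner (T u) v) \<le> (1 / y) * Im (cinner (T u) u) + (norm v)\<^sup>2}"
  have cTf: "continuous_on UNIV (\<lambda>p::'h \<times> 'h. T (fst p))"
    by (rule continuous_on_compose2[OF cT]) (auto intro!: continuous_intros)
  have "closed ?P"
    unfolding split_beta by (intro closed_Collect_le continuous_intros cTf)
  moreover have "?L \<times> ?L \<subseteq> ?P" using 1 by blast
  ultimately have "closure (?L \<times> ?L) \<subseteq> ?P" by (rule closure_minimal[rotated])
  then have "(u, T u) \<in> ?P" unfolding closure_Times dense by blast
  then have "2 * (norm (T u))\<^sup>2 \<le> (1 / y) * Im (cinner (T u) u) + (norm (T u))\<^sup>2"
    by (simp add: norm_sq_cinner)
  then show ?thesis using y(1) by (simp add: field_simps)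
qed

end

section \<open>Stieltjes transforms of finite measures\<close>

text \<open>Cauchy's formula on the rectangle of height n over [-n, n]. The decay of h makes the
  other three sides contribute O(1 / n); for \<zeta> below the axis the rectangle encloses no
  pole.\<close>

lemma half_plane_cauchy_integral:
  fixes h :: "complex \<Rightarrow> complex"
  assumes h: "h holomorphic_on {w. Im w > - e}" and e: "e > 0"
    and bd: "\<And>w. Im w \<ge> 0 \<Longrightarrow> cmod w \<ge> 1 \<Longrightarrow> cmod (h w) \<le> C / cmod w" and \<zeta>: "Im \<zeta> \<noteq> 0"
  shows "(\<lambda>n. integral {- real n..real n} (\<lambda>t. h (of_real t) / (of_real t - \<zeta>)))
    \<longlonglongrightarrow> (if Im \<zeta> > 0 then 2 * pi * \<i> * h \<zeta> else 0)"
proof -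
  define L where "L = (if Im \<zeta> > 0 then 2 * pi * \<i> * h \<zeta> else 0)"
  \<comment> \<open>For \<zeta> below the axis the half-plane is cut down so that it excludes
    \<zeta> and still contains the real line.\<close>
  define d where "d = (if Im \<zeta> > 0 then e else min e (- Im \<zeta>))"
  have d: "d > 0" "d \<le> e" using e \<zeta> by (auto simp: d_def)
  let ?H = "{w. Im w > - d}"
  have hH: "h holomorphic_on ?H" using d by (intro holomorphic_on_subset[OF h]) auto
  have convex: "convex ?H" by (rule convex_halfspace_Im_gt)
  have "open ?H" by (rule open_halfspace_Im_gt)
  have C: "C \<ge> 0"
    using order_trans[OF norm_ge_zero bd[of 1]] by simp
  have est: "cmod (integral {- real n..real n} (\<lambda>t. h (of_real t) / (of_real t - \<zeta>)) - L) \<le> 8 * C / real n"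
    if n: "real n \<ge> 1" "real n \<ge> 2 * cmod \<zeta> + 1" for n
  proof -
    define R where "R = real n"
    have R: "R \<ge> 1" "R \<ge> 2 * cmod \<zeta> + 1" using n by (auto simp: R_def)
    let ?g = "\<lambda>w. h w / (w - \<zeta>)"
    let ?a1 = "complex_of_real (- R)" and ?a2 = "complex_of_real R" and ?a3 = "Complex R R" and ?a4 = "Complex (- R) R"
    let ?\<gamma> = "rectpath ?a1 ?a3"
    have R\<zeta>: "R > 2 * \<bar>Re \<zeta>\<bar>" "R > 2 * \<bar>Im \<zeta>\<bar>"
      using R abs_Re_le_cmod[of \<zeta>] abs_Im_le_cmod[of \<zeta>] by linarith+
    have img: "path_image ?\<gamma> \<subseteq> {w. Im w \<ge> 0} - {\<zeta>}"
      using R R\<zeta> \<zeta> by (subst path_image_rectpath) (auto simp: complex_eq_iff)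
    have contour: "(?g has_contour_integral L) ?\<gamma>"
    proof (cases "Im \<zeta> > 0")
      case True
      have "\<zeta> \<in> box ?a1 ?a3" using True R\<zeta> by (auto simp: in_box_complex_iff)
      then have w: "winding_number ?\<gamma> \<zeta> = 1" by (rule winding_number_rectpath)
      have "(?g has_contour_integral (2 * pi * \<i> * winding_number ?\<gamma> \<zeta> * h \<zeta>)) ?\<gamma>"
      proof (rule Cauchy_integral_formula_convex_simple[OF convex hH])
        show "\<zeta> \<in> interior ?H" using True d \<open>open ?H\<close> by (simp add: interior_open)
        show "path_image ?\<gamma> \<subseteq> ?H - {\<zeta>}" using img d by auto
      qed auto
      then show ?thesis using True unfolding w by (simp add: L_def)
    next
      case False
      have "(?g has_contour_integral 0) ?\<gamma>"
      proof (rule Cauchy_theorem_convex_simple[OF _ convex])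
        show "?g holomorphic_on ?H"
          using False \<zeta> by (intro holomorphic_intros hH) (auto simp: d_def)
        show "path_image ?\<gamma> \<subseteq> ?H" using img d by auto
      qed auto
      then show ?thesis using False by (simp add: L_def)
    qed
    have ci: "?g contour_integrable_on linepath a b"
      if "closed_segment a b \<subseteq> {w. Im w \<ge> 0} - {\<zeta>}" for a b
    proof (rule contour_integrable_continuous_linepath)
      show "continuous_on (closed_segment a b) ?g"
        using that d by (intro continuous_intros continuous_on_subset[OF holomorphic_on_imp_continuous_on[OF hH]]) auto
    qed
    have seg: "closed_segment ?a1 ?a2 \<subseteq> {w. Im w \<ge> 0} - {\<zeta>}" "closed_segment ?a2 ?a3 \<subseteq> {w. Im w \<ge> 0} - {\<zeta>}"
      "closed_segment ?a3 ?a4 \<subseteq> {w. Im w \<ge> 0} - {\<zeta>}" "closed_segment ?a4 ?a1 \<subseteq> {w. Im w \<ge> 0} - {\<zeta>}"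
      using img by (auto simp: rectpath_def Let_def path_image_join complex_of_real_def)
    have sum: "L = contour_integral (linepath ?a1 ?a2) ?g + (contour_integral (linepath ?a2 ?a3) ?g
        + (contour_integral (linepath ?a3 ?a4) ?g + contour_integral (linepath ?a4 ?a1) ?g))"
    proof -
      have "(?g has_contour_integral (contour_integral (linepath ?a1 ?a2) ?g + (contour_integral (linepath ?a2 ?a3) ?g
        + (contour_integral (linepath ?a3 ?a4) ?g + contour_integral (linepath ?a4 ?a1) ?g))))
        (linepath ?a1 ?a2 +++ linepath ?a2 ?a3 +++ linepath ?a3 ?a4 +++ linepath ?a4 ?a1)"
        by (intro has_contour_integral_join has_contour_integral_integral ci seg) auto
      moreover have "?\<gamma> = linepath ?a1 ?a2 +++ linepath ?a2 ?a3 +++ linepath ?a3 ?a4 +++ linepath ?a4 ?a1"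
        by (simp add: rectpath_def Let_def complex_of_real_def)
      ultimately show ?thesis using has_contour_integral_unique[OF contour] by (simp only:)
    qed
    \<comment> \<open>Since R >= 2 |\<zeta>|, the distance to \<zeta> is at least R / 2, whence the
      factor 2; the three sides have total length 4 R, which gives 8 C / R.\<close>
    have far: "cmod (?g w) \<le> 2 * C / R\<^sup>2" if "cmod w \<ge> R" "Im w \<ge> 0" for w
    proof -
      have "cmod (h w) \<le> C / cmod w" using that R by (intro bd) auto
      also have "\<dots> \<le> C / R" using that R C by (intro frac_le) auto
      finally have 1: "cmod (h w) \<le> C / R" .
      have "cmod (w - \<zeta>) \<ge> cmod w - cmod \<zeta>" by (rule norm_triangle_ineq2)
      then have 2: "cmod (w - \<zeta>) \<ge> R / 2" using that R by linarith
      have "cmod (?g w) \<le> (C / R) / (R / 2)"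
        unfolding norm_divide using 1 2 R C by (intro frac_le) auto
      then show ?thesis by (simp add: power2_eq_square mult.commute)
    qed
    have bound: "cmod (contour_integral (linepath a b) ?g) \<le> 2 * C / R\<^sup>2 * cmod (b - a)"
      if "closed_segment a b \<subseteq> {w. Im w \<ge> 0} - {\<zeta>}" "\<And>w. w \<in> closed_segment a b \<Longrightarrow> cmod w \<ge> R" for a b
    proof (rule has_contour_integral_bound_linepath)
      show "(?g has_contour_integral contour_integral (linepath a b) ?g) (linepath a b)"
        by (rule has_contour_integral_integral[OF ci[OF that(1)]])
      show "cmod (?g w) \<le> 2 * C / R\<^sup>2" if "w \<in> closed_segment a b" for w
        using that \<open>\<And>w. w \<in> closed_segment a b \<Longrightarrow> cmod w \<ge> R\<close> \<open>closed_segment a b \<subseteq> _\<close> by (intro far) auto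
    qed (use C in simp)
    have cR: "R \<le> cmod w" if "\<bar>Re w\<bar> = R \<or> \<bar>Im w\<bar> = R" for w
      using that abs_Re_le_cmod[of w] abs_Im_le_cmod[of w] by auto
    have diffs: "?a3 - ?a2 = \<i> * of_real R" "?a4 - ?a3 = of_real (- 2 * R)" "?a1 - ?a4 = - \<i> * of_real R"
      by (simp_all add: complex_eq_iff)
    have b2: "cmod (contour_integral (linepath ?a2 ?a3) ?g) \<le> 2 * C / R\<^sup>2 * R"
    proof -
      have "R \<le> cmod w" if "w \<in> closed_segment ?a2 ?a3" for w
        using that cR R by (auto simp: closed_segment_same_Re)
      from bound[OF seg(2) this] show ?thesis unfolding diffs using R by (simp add: norm_mult)
    qed
    have b3: "cmod (contour_integral (linepath ?a3 ?a4) ?g) \<le> 2 * C / R\<^sup>2 * (2 * R)"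
    proof -
      have "R \<le> cmod w" if "w \<in> closed_segment ?a3 ?a4" for w
        using that cR R by (auto simp: closed_segment_same_Im)
      from bound[OF seg(3) this] show ?thesis unfolding diffs norm_of_real using R by simp
    qed
    have b4: "cmod (contour_integral (linepath ?a4 ?a1) ?g) \<le> 2 * C / R\<^sup>2 * R"
    proof -
      have "R \<le> cmod w" if "w \<in> closed_segment ?a4 ?a1" for w
        using that cR R by (auto simp: closed_segment_same_Re)
      from bound[OF seg(4) this] show ?thesis unfolding diffs using R by (simp add: norm_mult)
    qed
    have "(?g has_contour_integral contour_integral (linepath ?a1 ?a2) ?g) (linepath ?a1 ?a2)"
      by (rule has_contour_integral_integral[OF ci[OF seg(1)]])
    then have "((\<lambda>t. ?g (of_real t)) has_integral contour_integral (linepath ?a1 ?a2) ?g) {- R..R}"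
      using R by (subst (asm) has_contour_integral_linepath_Reals_iff) auto
    then have i1: "integral {- R..R} (\<lambda>t. ?g (of_real t)) = contour_integral (linepath ?a1 ?a2) ?g"
      by (rule integral_unique)
    have "cmod (integral {- R..R} (\<lambda>t. ?g (of_real t)) - L)
      = cmod (contour_integral (linepath ?a2 ?a3) ?g + (contour_integral (linepath ?a3 ?a4) ?g + contour_integral (linepath ?a4 ?a1) ?g))"
    proof -
      have "cmod (x - (x + q)) = cmod q" for x q :: complex by simp
      then show ?thesis unfolding i1 sum .
    qed
    also have "\<dots> \<le> 2 * C / R\<^sup>2 * R + (2 * C / R\<^sup>2 * (2 * R) + 2 * C / R\<^sup>2 * R)"
      by (intro order_trans[OF norm_triangle_ineq] add_mono b2 b3 b4)
    also have "\<dots> = 8 * C / R" using R by (simp add: power2_eq_square field_simps)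
    finally show ?thesis by (simp add: R_def)
  qed
  have "(\<lambda>n. integral {- real n..real n} (\<lambda>t. h (of_real t) / (of_real t - \<zeta>)) - L) \<longlonglongrightarrow> 0"
  proof (rule Lim_null_comparison)
    show "(\<lambda>n. 8 * C / real n) \<longlonglongrightarrow> 0" by (rule lim_const_over_n)
    obtain m :: nat where "2 * cmod \<zeta> + 1 \<le> m" using real_arch_simple by blast
    moreover have "1 \<le> 2 * cmod \<zeta> + 1" by simp
    ultimately show "\<forall>\<^sub>F n in sequentially. cmod (integral {- real n..real n} (\<lambda>t. h (of_real t) / (of_real t - \<zeta>)) - L) \<le> 8 * C / real n"
      unfolding eventually_sequentially by (intro exI[of _ m] allI impI est) linarith+
  qed
  then show ?thesis unfolding L_def[symmetric] by (rule LIM_zero_cancel)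
qed

lemma integrable_inverse_quadratic: "integrable lborel (\<lambda>t::real. D / (1 + t\<^sup>2))"
proof -
  have "set_integrable lborel (einterval (- \<infinity>) \<infinity>) (\<lambda>x::real. inverse (1 + x\<^sup>2))"
    by (rule integrable_inverse_1_plus_square)
  then have "integrable lborel (\<lambda>x::real. inverse (1 + x\<^sup>2))"
    by (simp add: set_integrable_def einterval_def)
  then have "integrable lborel (\<lambda>t::real. D * inverse (1 + t\<^sup>2))" by simp
  then show ?thesis by (simp add: divide_inverse)
qed

text \<open>Subtracting the conjugate of Cauchy's formula at the reflected point cnj z, where the
  formula gives 0, replaces h on the axis by 2 \<i> Im h.\<close>

lemma half_plane_representation:
  fixes h :: "complex \<Rightarrow> complex" and z :: complex
  assumes h: "h holomorphic_on {w. Im w > - e}" and e: "e > 0"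
    and bd: "\<And>w. Im w \<ge> 0 \<Longrightarrow> cmod w \<ge> 1 \<Longrightarrow> cmod (h w) \<le> C / cmod w"
    and D: "\<And>t. \<bar>Im (h (of_real t))\<bar> \<le> D / (1 + t\<^sup>2)"
  shows "integrable lborel (\<lambda>t. Im (h (of_real t)))"
    and "Im z > 0 \<Longrightarrow> h z = (1 / pi) * (LINT t|lborel. of_real (Im (h (of_real t))) / (of_real t - z))"
proof -
  have cont: "continuous_on UNIV (\<lambda>t. h (of_real t))"
    using e by (intro continuous_on_compose2[OF holomorphic_on_imp_continuous_on[OF h]] continuous_intros) auto
  have contI: "continuous_on A (\<lambda>t. Im (h (of_real t)))" for A
    by (intro continuous_intros continuous_on_subset[OF cont]) auto
  have [measurable]: "(\<lambda>t. Im (h (of_real t))) \<in> borel_measurable borel"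
    by (rule borel_measurable_continuous_onI[OF contI])
  show int: "integrable lborel (\<lambda>t. Im (h (of_real t)))"
    by (rule Bochner_Integration.integrable_bound[OF integrable_inverse_quadratic[of D]])
       (use order_trans[OF D abs_ge_self] in auto)
  show "h z = (1 / pi) * (LINT t|lborel. of_real (Im (h (of_real t))) / (of_real t - z))" if z: "Im z > 0"
  proof -
    let ?k = "\<lambda>t. of_real (Im (h (of_real t))) / (of_real t - z)"
    have tz: "of_real t \<noteq> z" "of_real t \<noteq> cnj z" for t using z by (auto simp: complex_eq_iff)
    have tz': "cmod (of_real t - z) \<ge> Im z" for t using abs_Im_le_cmod[of "of_real t - z"] z by simp
    have contk: "continuous_on A ?k" for A
      using tz by (intro continuous_intros contI) auto
    have [measurable]: "?k \<in> borel_measurable borel"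
      by (rule borel_measurable_continuous_onI[OF contk])
    have intk: "integrable lborel ?k"
    proof (rule Bochner_Integration.integrable_bound[where f="\<lambda>t. Im (h (of_real t)) / Im z"])
      show "AE t in lborel. cmod (?k t) \<le> norm (Im (h (of_real t)) / Im z)"
        using z tz' by (intro always_eventually allI)
          (auto simp: norm_divide intro!: frac_le)
    qed (use int in auto)
    have lim1: "(\<lambda>n. integral {- real n..real n} ?k) \<longlonglongrightarrow> (LINT t|lborel. ?k t)"
    proof -
      have "(\<lambda>n. LINT t|lborel. indicator {- real n..real n} t *\<^sub>R ?k t) \<longlonglongrightarrow> (LINT t|lborel. ?k t)"
      proof (rule integral_dominated_convergence[where w="\<lambda>t. cmod (?k t)"])
        show "AE t in lborel. (\<lambda>n. indicator {- real n..real n} t *\<^sub>R ?k t) \<longlonglongrightarrow> ?k t"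
        proof (intro always_eventually allI)
          fix t :: real
          obtain m :: nat where m: "\<bar>t\<bar> \<le> m" using real_arch_simple by blast
          have "\<forall>\<^sub>F n in sequentially. ?k t = indicator {- real n..real n} t *\<^sub>R ?k t"
            unfolding eventually_sequentially
          proof (intro exI[of _ m] allI impI)
            fix n assume "n \<ge> m"
            then have "\<bar>t\<bar> \<le> real n" using m by linarith
            then have "t \<in> {- real n..real n}" by auto
            then show "?k t = indicator {- real n..real n} t *\<^sub>R ?k t" by simp
          qed
          then show "(\<lambda>n. indicator {- real n..real n} t *\<^sub>R ?k t) \<longlonglongrightarrow> ?k t"
            by (rule Lim_transform_eventually[OF tendsto_const])
        qed
        show "AE t in lborel. norm (indicator {- real n..real n} t *\<^sub>R ?k t) \<le> cmod (?k t)" for n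
          by (intro always_eventually allI) (auto split: split_indicator)
      qed (use intk in auto)
      moreover have "(LINT t|lborel. indicator {- real n..real n} t *\<^sub>R ?k t) = integral {- real n..real n} ?k" for n
      proof -
        have "set_integrable lborel {- real n..real n} ?k"
          unfolding set_integrable_def using intk by (intro integrable_mult_indicator) auto
        from set_borel_integral_eq_integral(2)[OF this] show ?thesis
          by (simp add: set_lebesgue_integral_def)
      qed
      ultimately show ?thesis by simp
    qed
    have 1: "(\<lambda>n. integral {- real n..real n} (\<lambda>t. h (of_real t) / (of_real t - z))) \<longlonglongrightarrow> 2 * pi * \<i> * h z"
      using half_plane_cauchy_integral[OF h e bd, of z] z by simp
    have 2: "(\<lambda>n. integral {- real n..real n} (\<lambda>t. h (of_real t) / (of_real t - cnj z))) \<longlonglongrightarrow> 0"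
      using half_plane_cauchy_integral[OF h e bd, of "cnj z"] z by simp
    have "(\<lambda>n. integral {- real n..real n} (\<lambda>t. h (of_real t) / (of_real t - z))
          - cnj (integral {- real n..real n} (\<lambda>t. h (of_real t) / (of_real t - cnj z)))) \<longlonglongrightarrow> 2 * pi * \<i> * h z - cnj 0"
      by (intro tendsto_intros 1 2)
    moreover have "integral {- real n..real n} (\<lambda>t. h (of_real t) / (of_real t - z))
          - cnj (integral {- real n..real n} (\<lambda>t. h (of_real t) / (of_real t - cnj z)))
        = 2 * \<i> * integral {- real n..real n} ?k" for n
    proof -
      let ?I = "{- real n..real n}"
      have i1: "(\<lambda>t. h (of_real t) / (of_real t - z)) integrable_on ?I"
        using tz by (intro integrable_continuous_interval continuous_intros continuous_on_subset[OF cont]) auto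
      have i2: "(\<lambda>t. cnj (h (of_real t) / (of_real t - cnj z))) integrable_on ?I"
        using tz by (intro integrable_continuous_interval continuous_intros continuous_on_subset[OF cont]) auto
      have "integral ?I (\<lambda>t. h (of_real t) / (of_real t - z)) - cnj (integral ?I (\<lambda>t. h (of_real t) / (of_real t - cnj z)))
        = integral ?I (\<lambda>t. h (of_real t) / (of_real t - z)) - integral ?I (\<lambda>t. cnj (h (of_real t) / (of_real t - cnj z)))"
        by (simp only: integral_cnj)
      also have "\<dots> = integral ?I (\<lambda>t. h (of_real t) / (of_real t - z) - cnj (h (of_real t) / (of_real t - cnj z)))"
        by (rule Henstock_Kurzweil_Integration.integral_diff[OF i1 i2, symmetric])
      also have "\<dots> = integral ?I (\<lambda>t. 2 * \<i> * ?k t)"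
      proof (rule arg_cong[where f="integral ?I"], rule ext)
        fix t
        have "h (of_real t) / (of_real t - z) - cnj (h (of_real t) / (of_real t - cnj z))
          = (h (of_real t) - cnj (h (of_real t))) / (of_real t - z)" by (simp add: diff_divide_distrib)
        also have "h (of_real t) - cnj (h (of_real t)) = 2 * \<i> * of_real (Im (h (of_real t)))"
          by (simp add: complex_eq_iff)
        finally show "h (of_real t) / (of_real t - z) - cnj (h (of_real t) / (of_real t - cnj z)) = 2 * \<i> * ?k t" by simp
      qed
      also have "\<dots> = 2 * \<i> * integral ?I ?k"
        by (rule Henstock_Kurzweil_Integration.integral_mult_right)
      finally show ?thesis .
    qed
    ultimately have "(\<lambda>n. 2 * \<i> * integral {- real n..real n} ?k) \<longlonglongrightarrow> 2 * pi * \<i> * h z" by simp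
    moreover have "(\<lambda>n. 2 * \<i> * integral {- real n..real n} ?k) \<longlonglongrightarrow> 2 * \<i> * (LINT t|lborel. ?k t)"
      by (intro tendsto_intros lim1)
    ultimately have "2 * pi * \<i> * h z = 2 * \<i> * (LINT t|lborel. ?k t)" by (rule LIMSEQ_unique)
    then show ?thesis by (simp add: field_simps)
  qed
qed

section \<open>The Cauchy kernel against a finite measure\<close>

lemma cauchy_kernel_continuous:
  assumes "Im z > 0"
  shows "continuous_on A (\<lambda>t. 1 / (complex_of_real t - z))" "isCont (\<lambda>t. 1 / (complex_of_real t - z)) t"
    "cmod (1 / (of_real t - z)) \<le> 1 / Im z"
proof -
  have tz: "of_real t \<noteq> z" for t using assms by (auto simp: complex_eq_iff)
  show "continuous_on A (\<lambda>t. 1 / (complex_of_real t - z))" using tz by (intro continuous_intros) auto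
  show "isCont (\<lambda>t. 1 / (complex_of_real t - z)) t" using tz by (intro continuous_intros) auto
  have "cmod (of_real t - z) \<ge> Im z" using abs_Im_le_cmod[of "of_real t - z"] assms by simp
  moreover from this have "cmod (of_real t - z) > 0" using assms by linarith
  ultimately show "cmod (1 / (of_real t - z)) \<le> 1 / Im z"
    using assms by (simp add: norm_divide frac_le)
qed

lemma Im_cauchy_kernel:
  "Im (1 / (complex_of_real t - z)) = Im z / ((t - Re z)\<^sup>2 + (Im z)\<^sup>2)"
  by (simp add: Im_divide)

lemma cauchy_kernel_borel [measurable]:
  "(\<lambda>t. 1 / (complex_of_real t - z)) \<in> borel_measurable borel"
  by measurable

context finite_borel_measure
begin

lemmas [measurable_cong] = M_is_borel

lemma integrable_cauchy_kernel:
  assumes "Im z > 0"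
  shows "integrable M (\<lambda>t. 1 / (complex_of_real t - z))"
proof (rule integrable_const_bound[where B="1 / Im z"])
  show "(\<lambda>t. 1 / (complex_of_real t - z)) \<in> borel_measurable M" by measurable
qed (use cauchy_kernel_continuous(3)[OF assms] in auto)

lemma Im_stieltjes_transform:
  assumes "Im z > 0"
  shows "Im (LINT t|M. 1 / (complex_of_real t - z)) = (LINT t|M. Im z / ((t - Re z)\<^sup>2 + (Im z)\<^sup>2))"
    "integrable M (\<lambda>t. Im z / ((t - Re z)\<^sup>2 + (Im z)\<^sup>2))"
proof -
  note i = integrable_cauchy_kernel[OF assms]
  show "Im (LINT t|M. 1 / (complex_of_real t - z)) = (LINT t|M. Im z / ((t - Re z)\<^sup>2 + (Im z)\<^sup>2))"
    using integral_Im[OF i] by (simp only: Im_cauchy_kernel)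
  show "integrable M (\<lambda>t. Im z / ((t - Re z)\<^sup>2 + (Im z)\<^sup>2))"
    using integrable_Im[OF i] by (simp only: Im_cauchy_kernel)
qed

text \<open>The integrand \<i> y / (t - \<i> y) has modulus at most 1 and tends to -1, so the
  transform determines the total mass.\<close>

lemma stieltjes_transform_at_infinity:
  "(\<lambda>n. \<i> * of_nat (Suc n) * (LINT t|M. 1 / (complex_of_real t - \<i> * of_nat (Suc n)))) \<longlonglongrightarrow> - of_real (measure M UNIV)"
proof -
  have "(\<lambda>n. LINT t|M. \<i> * of_nat (Suc n) / (complex_of_real t - \<i> * of_nat (Suc n))) \<longlonglongrightarrow> (LINT t|M. - 1)"
  proof (rule integral_dominated_convergence[where w="\<lambda>_. 1"])
    show "AE t in M. (\<lambda>n. \<i> * of_nat (Suc n) / (complex_of_real t - \<i> * of_nat (Suc n))) \<longlonglongrightarrow> - 1"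
    proof (intro always_eventually allI)
      fix t
      have "(\<lambda>n. \<i> / (complex_of_real t / of_nat (Suc n) - \<i>)) \<longlonglongrightarrow> \<i> / (0 - \<i>)"
        by (intro tendsto_intros LIMSEQ_Suc[OF lim_const_over_n]) auto
      moreover have "\<i> / (complex_of_real t / of_nat (Suc n) - \<i>) = \<i> * of_nat (Suc n) / (complex_of_real t - \<i> * of_nat (Suc n))" for n
      proof -
        have "complex_of_real t / of_nat (Suc n) - \<i> = (complex_of_real t - \<i> * of_nat (Suc n)) / of_nat (Suc n)"
          by (simp add: diff_divide_distrib del: of_nat_Suc)
        then show ?thesis by simp
      qed
      ultimately show "(\<lambda>n. \<i> * of_nat (Suc n) / (complex_of_real t - \<i> * of_nat (Suc n))) \<longlonglongrightarrow> - 1"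
        by (simp del: of_nat_Suc)
    qed
    show "AE t in M. norm (\<i> * of_nat (Suc n) / (complex_of_real t - \<i> * of_nat (Suc n))) \<le> 1" for n
    proof (intro always_eventually allI)
      fix t
      have "cmod (1 / (of_real t - \<i> * of_nat (Suc n))) \<le> 1 / Im (\<i> * of_nat (Suc n))"
        by (rule cauchy_kernel_continuous(3)) simp
      then show "norm (\<i> * of_nat (Suc n) / (complex_of_real t - \<i> * of_nat (Suc n))) \<le> 1"
        by (simp add: norm_divide norm_mult divide_simps del: of_nat_Suc split: if_splits)
    qed
    show "(\<lambda>t. \<i> * of_nat (Suc n) / (complex_of_real t - \<i> * of_nat (Suc n))) \<in> borel_measurable M" for n
      by measurable
  qed auto
  moreover have "(LINT t|M. \<i> * of_nat (Suc n) / (complex_of_real t - \<i> * of_nat (Suc n)))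
      = \<i> * of_nat (Suc n) * (LINT t|M. 1 / (complex_of_real t - \<i> * of_nat (Suc n)))" for n
    by (subst integral_mult_right_zero[symmetric]) simp
  ultimately show ?thesis by (simp add: borel_UNIV scaleR_conv_of_real)
qed

text \<open>Im F(t + \<i> e) is a Poisson integral with primitive arctan ((t - s) / e). With n for
  \<open>Suc n\<close>, the height 1 / n^2 is of smaller order than the offset 1 / n of the right
  endpoint, so a point mass at b contributes 0 in the limit and the open ray comes out exactly, as
  left-continuity requires.\<close>

lemma stieltjes_inversion:
  defines "F \<equiv> \<lambda>z. LINT t|M. 1 / (complex_of_real t - z)"
  shows "(\<lambda>n. integral {- real (Suc n)..b - 1 / real (Suc n)} (\<lambda>t. Im (F (Complex t (1 / (real (Suc n))\<^sup>2)))))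
    \<longlonglongrightarrow> pi * measure M {..<b}"
proof -
  \<comment> \<open>The order of integration is exchanged for nonnegative integrals, the Poisson
    kernel being positive.\<close>
  have step: "integral {a..c} (\<lambda>t. Im (F (Complex t e))) = (LINT s|M. arctan ((c - s) / e) - arctan ((a - s) / e))"
    if e: "e > 0" and ac: "a \<le> c" for a c e
  proof -
    let ?p = "\<lambda>s t. e / ((s - t)\<^sup>2 + e\<^sup>2)"
    have pos: "(s - t)\<^sup>2 + e\<^sup>2 > 0" for s t :: real using e by (simp add: add_nonneg_pos)
    have ImF: "Im (F (Complex t e)) = (LINT s|M. ?p s t)" for t
      using Im_stieltjes_transform(1)[of "Complex t e"] e by (simp add: F_def)
    have intp: "integrable M (\<lambda>s. ?p s t)" for t
      using Im_stieltjes_transform(2)[of "Complex t e"] e by simp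
    have p0: "0 \<le> ?p s t" for s t using e pos[of s t] by simp
    have [measurable]: "(\<lambda>t. LINT s|M. ?p s t) \<in> borel_measurable borel"
      by measurable
    interpret P: pair_sigma_finite M lborel ..
    have inner: "(\<integral>\<^sup>+t. ennreal (?p s t) * indicator {a..c} t \<partial>lborel) = ennreal (arctan ((c - s) / e) - arctan ((a - s) / e))" for s
    proof -
      have "(\<integral>\<^sup>+t. ennreal (?p s t) * indicator {a..c} t \<partial>lborel) = ennreal ((\<lambda>t. arctan ((t - s) / e)) c - (\<lambda>t. arctan ((t - s) / e)) a)"
      proof (rule nn_integral_FTC_Icc)
        fix t
        have "((\<lambda>t. arctan ((t - s) / e)) has_real_derivative (1 / e) * (1 / (1 + ((t - s) / e)\<^sup>2))) (at t)"
          using e by (auto intro!: derivative_eq_intros simp: divide_simps)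
        also have "(1 / e) * (1 / (1 + ((t - s) / e)\<^sup>2)) = ?p s t"
          using e pos[of s t] by (simp add: divide_simps power2_eq_square) (simp add: algebra_simps)
        finally show "((\<lambda>t. arctan ((t - s) / e)) has_real_derivative ?p s t) (at t)" .
      qed (use p0 ac in auto)
      then show ?thesis by simp
    qed
    have "(\<integral>\<^sup>+t. ennreal (LINT s|M. ?p s t) * indicator {a..c} t \<partial>lborel)
        = (\<integral>\<^sup>+t. (\<integral>\<^sup>+s. ennreal (?p s t) * indicator {a..c} t \<partial>M) \<partial>lborel)"
      by (intro nn_integral_cong) (simp add: nn_integral_multc nn_integral_eq_integral[OF intp] p0)
    also have "\<dots> = (\<integral>\<^sup>+s. (\<integral>\<^sup>+t. ennreal (?p s t) * indicator {a..c} t \<partial>lborel) \<partial>M)"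
      by (rule P.Fubini') measurable
    also have "\<dots> = (\<integral>\<^sup>+s. ennreal (arctan ((c - s) / e) - arctan ((a - s) / e)) \<partial>M)"
      by (simp only: inner)
    also have "\<dots> = ennreal (LINT s|M. arctan ((c - s) / e) - arctan ((a - s) / e))"
    proof (rule nn_integral_eq_integral)
      have b: "norm (arctan ((c - s) / e) - arctan ((a - s) / e)) \<le> pi" for s
        using arctan_bounded[of "(c - s) / e"] arctan_bounded[of "(a - s) / e"] by (auto simp: abs_le_iff)
      show "integrable M (\<lambda>s. arctan ((c - s) / e) - arctan ((a - s) / e))"
        by (rule integrable_const_bound[where B=pi]) (use b in auto)
      show "AE s in M. 0 \<le> arctan ((c - s) / e) - arctan ((a - s) / e)"
        using e ac by (intro always_eventually allI) (simp add: arctan_le_iff divide_right_mono)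
    qed
    finally have nn: "(\<integral>\<^sup>+t. ennreal (LINT s|M. ?p s t) * indicator {a..c} t \<partial>lborel)
        = ennreal (LINT s|M. arctan ((c - s) / e) - arctan ((a - s) / e))" .
    have q0: "0 \<le> (LINT s|M. ?p s t)" for t by (rule Bochner_Integration.integral_nonneg) (rule p0)
    have r0: "0 \<le> (LINT s|M. arctan ((c - s) / e) - arctan ((a - s) / e))"
      using e ac by (intro Bochner_Integration.integral_nonneg) (simp add: arctan_le_iff divide_right_mono)
    have "(\<integral>\<^sup>+t. ennreal ((LINT s|M. ?p s t) * indicator {a..c} t) \<partial>lborel)
        = ennreal (LINT s|M. arctan ((c - s) / e) - arctan ((a - s) / e))"
      unfolding nn[symmetric] by (intro nn_integral_cong) (auto split: split_indicator)
    then have "has_bochner_integral lborel (\<lambda>t. (LINT s|M. ?p s t) * indicator {a..c} t)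
        (LINT s|M. arctan ((c - s) / e) - arctan ((a - s) / e))"
      using q0 r0 by (intro has_bochner_integral_nn_integral) auto
    then have "integrable lborel (\<lambda>t. indicator {a..c} t *\<^sub>R (LINT s|M. ?p s t))"
      "(LINT t|lborel. indicator {a..c} t *\<^sub>R (LINT s|M. ?p s t)) = (LINT s|M. arctan ((c - s) / e) - arctan ((a - s) / e))"
      by (simp_all add: has_bochner_integral_iff mult.commute)
    then show ?thesis
      using set_borel_integral_eq_integral(2)[of "{a..c}" "\<lambda>t. LINT s|M. ?p s t"]
      by (simp add: ImF set_integrable_def set_lebesgue_integral_def)
  qed
  have "(\<lambda>n. LINT s|M. arctan ((b - 1 / real (Suc n) - s) / (1 / (real (Suc n))\<^sup>2)) - arctan ((- real (Suc n) - s) / (1 / (real (Suc n))\<^sup>2)))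
    \<longlonglongrightarrow> (LINT s|M. pi * indicator {..<b} s)"
  proof (rule integral_dominated_convergence[where w="\<lambda>_. pi"])
    show "AE s in M. norm (arctan ((b - 1 / real (Suc n) - s) / (1 / (real (Suc n))\<^sup>2)) - arctan ((- real (Suc n) - s) / (1 / (real (Suc n))\<^sup>2))) \<le> pi" for n
    proof (intro always_eventually allI)
      fix s
      show "norm (arctan ((b - 1 / real (Suc n) - s) / (1 / (real (Suc n))\<^sup>2)) - arctan ((- real (Suc n) - s) / (1 / (real (Suc n))\<^sup>2))) \<le> pi"
        using arctan_bounded[of "(b - 1 / real (Suc n) - s) / (1 / (real (Suc n))\<^sup>2)"] arctan_bounded[of "(- real (Suc n) - s) / (1 / (real (Suc n))\<^sup>2)"]
        by (auto simp: abs_le_iff simp del: of_nat_Suc)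
    qed
    show "AE s in M. (\<lambda>n. arctan ((b - 1 / real (Suc n) - s) / (1 / (real (Suc n))\<^sup>2)) - arctan ((- real (Suc n) - s) / (1 / (real (Suc n))\<^sup>2)))
        \<longlonglongrightarrow> pi * indicator {..<b} s"
    proof (intro always_eventually allI)
      fix s
      have "(\<lambda>n::nat. arctan ((b - 1 / real n - s) / (1 / (real n)\<^sup>2)) - arctan ((- real n - s) / (1 / (real n)\<^sup>2)))
        \<longlonglongrightarrow> pi * indicator {..<b} s"
      proof -
        have neg: "filterlim (\<lambda>n::nat. (- real n - s) / (1 / (real n)\<^sup>2)) at_bot sequentially" by real_asymp
        have 2: "(\<lambda>n::nat. arctan ((- real n - s) / (1 / (real n)\<^sup>2))) \<longlonglongrightarrow> - (pi / 2)"
          using filterlim_compose[OF tendsto_arctan_at_bot neg] by simp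
        show ?thesis
        proof (cases "s < b")
          case True
          then have "filterlim (\<lambda>n::nat. (b - 1 / real n - s) / (1 / (real n)\<^sup>2)) at_top sequentially" by real_asymp
          from filterlim_compose[OF tendsto_arctan_at_top this]
          have "(\<lambda>n::nat. arctan ((b - 1 / real n - s) / (1 / (real n)\<^sup>2))) \<longlonglongrightarrow> pi / 2" by simp
          from tendsto_diff[OF this 2] show ?thesis using True by simp
        next
          case False
          then have "b - s < 0 \<or> b - s = 0" by linarith
          then have "filterlim (\<lambda>n::nat. (b - 1 / real n - s) / (1 / (real n)\<^sup>2)) at_bot sequentially"
          proof
            assume "b - s < 0" then show ?thesis by real_asymp
          next
            assume "b - s = 0"
            then have "b = s" by simp
            have "filterlim (\<lambda>n::nat. (- 1 / real n) / (1 / (real n)\<^sup>2)) at_bot sequentially" by real_asymp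
            then show ?thesis unfolding \<open>b = s\<close> by simp
          qed
          from filterlim_compose[OF tendsto_arctan_at_bot this]
          have "(\<lambda>n::nat. arctan ((b - 1 / real n - s) / (1 / (real n)\<^sup>2))) \<longlonglongrightarrow> - (pi / 2)" by simp
          from tendsto_diff[OF this 2] show ?thesis using False by simp
        qed
      qed
      then show "(\<lambda>n. arctan ((b - 1 / real (Suc n) - s) / (1 / (real (Suc n))\<^sup>2)) - arctan ((- real (Suc n) - s) / (1 / (real (Suc n))\<^sup>2)))
        \<longlonglongrightarrow> pi * indicator {..<b} s" by (rule LIMSEQ_Suc)
    qed
  qed auto
  also have "(LINT s|M. pi * indicator {..<b} s) = pi * measure M {..<b}" by simp
  finally have lim: "(\<lambda>n. LINT s|M. arctan ((b - 1 / real (Suc n) - s) / (1 / (real (Suc n))\<^sup>2)) - arctan ((- real (Suc n) - s) / (1 / (real (Suc n))\<^sup>2)))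
    \<longlonglongrightarrow> pi * measure M {..<b}" .
  have "\<forall>\<^sub>F n in sequentially. (LINT s|M. arctan ((b - 1 / real (Suc n) - s) / (1 / (real (Suc n))\<^sup>2)) - arctan ((- real (Suc n) - s) / (1 / (real (Suc n))\<^sup>2)))
    = integral {- real (Suc n)..b - 1 / real (Suc n)} (\<lambda>t. Im (F (Complex t (1 / (real (Suc n))\<^sup>2))))"
  proof -
    \<comment> \<open>From this index on the left endpoint does not exceed the right one, as
      \<open>step\<close> asks.\<close>
    obtain m :: nat where m: "1 - b \<le> m" using real_arch_simple by blast
    show ?thesis
      unfolding eventually_sequentially
    proof (intro exI[of _ m] allI impI)
      fix n assume "n \<ge> m"
      then have "1 - b \<le> real (Suc n)" using m by simp
      moreover have "1 / real (Suc n) \<le> 1" by simp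
      ultimately show "(LINT s|M. arctan ((b - 1 / real (Suc n) - s) / (1 / (real (Suc n))\<^sup>2)) - arctan ((- real (Suc n) - s) / (1 / (real (Suc n))\<^sup>2)))
        = integral {- real (Suc n)..b - 1 / real (Suc n)} (\<lambda>t. Im (F (Complex t (1 / (real (Suc n))\<^sup>2))))"
        by (intro step[symmetric]) (simp, linarith)
    qed
  qed
  with lim show ?thesis by (rule Lim_transform_eventually)
qed

end

section \<open>Densities and the integral representation of Nevanlinna functions\<close>

lemma integrable_density_power:
  fixes g :: "real \<Rightarrow> 'a::{banach, second_countable_topology}"
  assumes [measurable_cong]: "sets M = sets borel" and [measurable]: "g \<in> borel_measurable borel"
  shows "integrable (density M (\<lambda>t. ennreal (t ^ (2 * n)))) g \<longleftrightarrow> integrable M (\<lambda>t. t ^ (2 * n) *\<^sub>R g t)"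
    "(LINT t|density M (\<lambda>t. ennreal (t ^ (2 * n))). g t) = (LINT t|M. t ^ (2 * n) *\<^sub>R g t)"
proof -
  have m: "g \<in> borel_measurable M" "(\<lambda>t. t ^ (2 * n)) \<in> borel_measurable M" by measurable
  have ae: "AE t in M. 0 \<le> t ^ (2 * n)" by simp
  show "integrable (density M (\<lambda>t. ennreal (t ^ (2 * n)))) g \<longleftrightarrow> integrable M (\<lambda>t. t ^ (2 * n) *\<^sub>R g t)"
    "(LINT t|density M (\<lambda>t. ennreal (t ^ (2 * n))). g t) = (LINT t|M. t ^ (2 * n) *\<^sub>R g t)"
    by (rule integrable_density[OF m ae], rule integral_density[OF m ae])
qed

lemma finite_borel_measure_density:
  assumes [measurable_cong]: "sets M = sets borel" and p: "integrable M p" "\<And>t. 0 \<le> p t"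
  shows "finite_borel_measure (density M (\<lambda>t. ennreal (p t)))"
    "measure (density M (\<lambda>t. ennreal (p t))) UNIV = (LINT t|M. p t)"
proof -
  have sp: "space M = UNIV" using sets_eq_imp_space_eq[OF assms(1)] by simp
  have [measurable]: "p \<in> borel_measurable M" using p(1) by (rule borel_measurable_integrable)
  have em: "emeasure (density M (\<lambda>t. ennreal (p t))) UNIV = ennreal (LINT t|M. p t)"
  proof -
    have "emeasure (density M (\<lambda>t. ennreal (p t))) UNIV = (\<integral>\<^sup>+t. ennreal (p t) \<partial>M)"
      using sets.top[of M] by (subst emeasure_density) (auto simp: sp)
    also have "\<dots> = ennreal (LINT t|M. p t)"
      by (rule nn_integral_eq_integral[OF p(1)]) (use p(2) in simp)
    finally show ?thesis .
  qed
  have "finite_measure (density M (\<lambda>t. ennreal (p t)))"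
    by (rule finite_measureI) (simp add: sp em)
  then show "finite_borel_measure (density M (\<lambda>t. ennreal (p t)))"
    unfolding finite_borel_measure_def finite_borel_measure_axioms_def using assms(1) by simp
  show "measure (density M (\<lambda>t. ennreal (p t))) UNIV = (LINT t|M. p t)"
    unfolding measure_def em by (rule enn2real_ennreal) (rule Bochner_Integration.integral_nonneg, rule p(2))
qed

text \<open>The shifts of f by \<i> e_n satisfy the half-plane formula with density Im f(t + \<i>
  e_n) / \<pi>. The expansion at infinity fixes their total mass s0 and makes them tight uniformly
  in n, so a weak limit represents f.\<close>

lemma nevanlinna_representation:
  fixes f g :: "complex \<Rightarrow> complex" and s0 s1 K :: real
  assumes hol: "f holomorphic_on {z. Im z > 0}" and pos: "\<And>z. Im z > 0 \<Longrightarrow> Im (f z) \<ge> 0"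
    and f: "\<And>z. Im z > 0 \<Longrightarrow> f z = - of_real s0 / z - of_real s1 / z\<^sup>2 + g z / z\<^sup>2"
    and g: "\<And>z. Im z > 0 \<Longrightarrow> cmod (g z) \<le> K / Im z" and s0: "s0 > 0"
  shows "\<exists>M. finite_borel_measure M \<and> (\<forall>z. Im z > 0 \<longrightarrow> f z = (LINT t|M. 1 / (of_real t - z)))"
proof -
  have K: "K \<ge> 0" using order_trans[OF norm_ge_zero g[of \<i>]] by simp
  define e where "e n = 1 / real (Suc n)" for n
  have e: "e n > 0" "e n \<le> 1" for n by (auto simp: e_def)
  define h where "h n w = f (w + \<i> * of_real (e n))" for n w
  have hh: "h n holomorphic_on {w. Im w > - e n}" for n
    unfolding h_def[abs_def]
    by (rule holomorphic_on_compose_gen[OF _ hol, unfolded o_def]) (auto intro!: holomorphic_intros)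
  have fb: "cmod (f w + of_real s0 / w) \<le> (\<bar>s1\<bar> + K / Im w) / (cmod w)\<^sup>2" if "Im w > 0" for w
  proof -
    have "f w + of_real s0 / w = (g w - of_real s1) / w\<^sup>2" using f[OF that] by (simp add: diff_divide_distrib)
    moreover have "cmod (g w - of_real s1) \<le> K / Im w + \<bar>s1\<bar>"
      using norm_triangle_ineq4[of "g w" "of_real s1"] g[OF that] by simp
    ultimately show ?thesis by (simp add: norm_divide norm_power divide_right_mono)
  qed
  have bd: "cmod (h n w) \<le> (s0 + \<bar>s1\<bar> + K / e n) / cmod w" if w: "Im w \<ge> 0" "cmod w \<ge> 1" for n w
  proof -
    let ?W = "w + \<i> * of_real (e n)"
    have ImW: "Im ?W \<ge> e n" "Im ?W > 0" using w e[of n] by auto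
    have "(Im w)\<^sup>2 \<le> (Im w + e n)\<^sup>2" using w e[of n] by (intro power_mono) auto
    then have cW: "cmod w \<le> cmod ?W" by (simp add: cmod_def)
    have "cmod w * 1 \<le> cmod ?W * cmod ?W" using cW w by (intro mult_mono) auto
    then have cW2: "cmod w \<le> (cmod ?W)\<^sup>2" by (simp add: power2_eq_square)
    have "cmod (h n w) \<le> cmod (f ?W + of_real s0 / ?W) + cmod (of_real s0 / ?W)"
      unfolding h_def by (metis add_diff_cancel_right' norm_triangle_ineq4)
    also have "\<dots> \<le> (\<bar>s1\<bar> + K / e n) / cmod w + s0 / cmod w"
    proof (rule add_mono)
      have "(\<bar>s1\<bar> + K / Im ?W) / (cmod ?W)\<^sup>2 \<le> (\<bar>s1\<bar> + K / e n) / cmod w"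
        using K e[of n] ImW w cW2 by (intro frac_le add_mono order_refl divide_left_mono) auto
      then show "cmod (f ?W + of_real s0 / ?W) \<le> (\<bar>s1\<bar> + K / e n) / cmod w"
        using fb[OF ImW(2)] by simp
      show "cmod (of_real s0 / ?W) \<le> s0 / cmod w"
        using s0 cW w by (auto simp: norm_divide intro!: frac_le)
    qed
    also have "\<dots> = (s0 + \<bar>s1\<bar> + K / e n) / cmod w" by (simp add: add_divide_distrib)
    finally show ?thesis .
  qed
  \<comment> \<open>The leading term s0 / z decays only like 1 / |t|, but as s0 is real its
    imaginary part on the shifted line is of order 1 / |z|^2; this makes the density
    integrable.\<close>
  have D: "\<bar>Im (h n (of_real t))\<bar> \<le> ((s0 * e n + \<bar>s1\<bar> + K / e n) / (e n)\<^sup>2) / (1 + t\<^sup>2)" for n t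
  proof -
    let ?W = "of_real t + \<i> * of_real (e n) :: complex"
    have ImW: "Im ?W = e n" by simp
    have cW: "(cmod ?W)\<^sup>2 = t\<^sup>2 + (e n)\<^sup>2" by (simp add: cmod_power2)
    have "Im (of_real s0 / ?W) = - (s0 * e n) / (cmod ?W)\<^sup>2" by (simp add: Im_divide cW)
    then have "\<bar>Im (of_real s0 / ?W)\<bar> = s0 * e n / (cmod ?W)\<^sup>2" using s0 e[of n] by (simp add: abs_mult)
    moreover have "\<bar>Im (f ?W + of_real s0 / ?W)\<bar> \<le> (\<bar>s1\<bar> + K / e n) / (cmod ?W)\<^sup>2"
      using order_trans[OF abs_Im_le_cmod fb[of ?W]] e[of n] by simp
    ultimately have "\<bar>Im (f ?W)\<bar> \<le> (\<bar>s1\<bar> + K / e n) / (cmod ?W)\<^sup>2 + s0 * e n / (cmod ?W)\<^sup>2"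
    proof -
      have "\<bar>u\<bar> \<le> A + B" if "\<bar>v\<bar> = B" "\<bar>u + v\<bar> \<le> A" for u v A B :: real
        using that by linarith
      then show "\<bar>Im (f ?W)\<bar> \<le> (\<bar>s1\<bar> + K / e n) / (cmod ?W)\<^sup>2 + s0 * e n / (cmod ?W)\<^sup>2"
        if "\<bar>Im (of_real s0 / ?W)\<bar> = s0 * e n / (cmod ?W)\<^sup>2"
          "\<bar>Im (f ?W + of_real s0 / ?W)\<bar> \<le> (\<bar>s1\<bar> + K / e n) / (cmod ?W)\<^sup>2"
        using that unfolding plus_complex.sel by blast
    qed
    also have "\<dots> = (s0 * e n + \<bar>s1\<bar> + K / e n) / (cmod ?W)\<^sup>2"
      by (simp add: add_divide_distrib)
    also have "\<dots> \<le> (s0 * e n + \<bar>s1\<bar> + K / e n) / ((e n)\<^sup>2 * (1 + t\<^sup>2))"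
    proof (rule divide_left_mono)
      have "(e n)\<^sup>2 * t\<^sup>2 \<le> 1 * t\<^sup>2" using e[of n] by (intro mult_right_mono) (auto simp: power_le_one)
      then show "(e n)\<^sup>2 * (1 + t\<^sup>2) \<le> (cmod ?W)\<^sup>2" unfolding cW by (simp add: algebra_simps)
      have "1 + t\<^sup>2 > 0" by (simp add: add_pos_nonneg)
      moreover have "(e n)\<^sup>2 > 0" using e(1)[of n] by simp
      moreover from this have "t\<^sup>2 + (e n)\<^sup>2 > 0" by (simp add: add_nonneg_pos)
      ultimately show "0 < (cmod ?W)\<^sup>2 * ((e n)\<^sup>2 * (1 + t\<^sup>2))"
        unfolding cW by (intro mult_pos_pos)
    qed (use s0 K e[of n] in \<open>auto intro!: add_nonneg_nonneg\<close>)
    finally show ?thesis by (simp add: h_def)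
  qed
  note rep = half_plane_representation[OF hh e(1) bd D]
  \<comment> \<open>Division by s0 makes the measures probabilities, the form in which tightness
    yields convergent subsequences; s0 is multiplied back at the end.\<close>
  define p where "p n t = Im (h n (of_real t)) / (pi * s0)" for n t
  have p: "integrable lborel (p n)" "0 \<le> p n t" for n t
  proof -
    show "integrable lborel (p n)" unfolding p_def[abs_def] using rep(1)[of n] by simp
    have "0 \<le> Im (h n (of_real t))" unfolding h_def by (rule pos) (simp add: e)
    then show "0 \<le> p n t" unfolding p_def using s0 by simp
  qed
  define \<mu> where "\<mu> n = density lborel (\<lambda>t. ennreal (p n t))" for n
  have fin: "finite_borel_measure (\<mu> n)" for n
    unfolding \<mu>_def by (rule finite_borel_measure_density(1)) (use p in auto)
  have [measurable]: "p n \<in> borel_measurable borel" for n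
    using borel_measurable_integrable[OF p(1)] by simp
  have tr: "(LINT t|\<mu> n. 1 / (complex_of_real t - z)) = h n z / of_real s0" if z: "Im z > 0" for n z
  proof -
    have "(LINT t|\<mu> n. 1 / (complex_of_real t - z)) = (LINT t|lborel. p n t *\<^sub>R (1 / (complex_of_real t - z)))"
      unfolding \<mu>_def by (rule integral_density) (use p(2) in \<open>auto intro: cauchy_kernel_borel\<close>)
    also have "\<dots> = (LINT t|lborel. (1 / (pi * s0)) *\<^sub>R (of_real (Im (h n (of_real t))) / (of_real t - z)))"
      by (intro Bochner_Integration.integral_cong refl) (simp add: p_def scaleR_conv_of_real)
    also have "\<dots> = (1 / (pi * s0)) *\<^sub>R (LINT t|lborel. of_real (Im (h n (of_real t))) / (of_real t - z))"
      by (rule integral_scaleR_right)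
    also have "\<dots> = h n z / of_real s0"
      using rep(2)[OF _ _ z, of n] by (simp add: scaleR_conv_of_real)
    finally show ?thesis .
  qed
  \<comment> \<open>One constant for all shifts: \<open>s1\<close> and \<open>K\<close> come from
    the expansion, \<open>s0\<close> from moving the argument by e_n <= 1.\<close>
  define C where "C = s0 + \<bar>s1\<bar> + K"
  have asym: "cmod (\<i> * of_real y * h n (\<i> * of_real y) + of_real s0) \<le> C / y" if y: "y \<ge> 1" for n y
  proof -
    let ?Y = "y + e n"
    let ?W = "\<i> * of_real y + \<i> * of_real (e n) :: complex"
    have W: "?W = \<i> * of_real ?Y" by (simp add: algebra_simps)
    have Y: "?Y \<ge> y" "?Y \<ge> 1" "Im ?W = ?Y" using y e[of n] by (auto simp: W)
    have "cmod ?W = ?Y" unfolding W norm_mult norm_of_real using Y by simp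
    note Y = Y this
    have "\<i> * of_real y * h n (\<i> * of_real y) + of_real s0
        = \<i> * of_real y * (f ?W + of_real s0 / ?W) + of_real s0 * (1 - \<i> * of_real y / ?W)"
      by (simp add: h_def algebra_simps)
    also have "1 - \<i> * of_real y / ?W = of_real (e n / ?Y)"
      using Y by (simp add: W divide_simps) (simp add: complex_eq_iff)
    also have "cmod (\<i> * of_real y * (f ?W + of_real s0 / ?W) + of_real s0 * of_real (e n / ?Y))
        \<le> y * ((\<bar>s1\<bar> + K / ?Y) / ?Y\<^sup>2) + s0 * (e n / ?Y)"
    proof (rule order_trans[OF norm_triangle_ineq], rule add_mono)
      show "cmod (\<i> * of_real y * (f ?W + of_real s0 / ?W)) \<le> y * ((\<bar>s1\<bar> + K / ?Y) / ?Y\<^sup>2)"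
      proof -
        have fW: "cmod (f ?W + of_real s0 / ?W) \<le> (\<bar>s1\<bar> + K / ?Y) / ?Y\<^sup>2"
          by (rule fb[of ?W, unfolded Y(3,4)]) (use Y(2) in linarith)
        have ay: "\<bar>y\<bar> = y" using y by simp
        show ?thesis
          unfolding norm_mult norm_ii norm_of_real mult_1 ay by (rule mult_left_mono[OF fW]) (use y in simp)
      qed
      show "cmod (of_real s0 * of_real (e n / ?Y)) \<le> s0 * (e n / ?Y)"
      proof -
        have nn: "e n / ?Y \<ge> 0" using e(1)[of n] Y(2) by simp
        show ?thesis unfolding norm_mult norm_of_real abs_of_pos[OF s0] abs_of_nonneg[OF nn] by (rule order_refl)
      qed
    qed
    also have "\<dots> \<le> (\<bar>s1\<bar> + K) / y + s0 / y"
    proof (rule add_mono)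
      have "y * ((\<bar>s1\<bar> + K / ?Y) / ?Y\<^sup>2) \<le> y * ((\<bar>s1\<bar> + K / 1) / y\<^sup>2)"
        using y Y K by (intro mult_left_mono frac_le add_mono power_mono order_refl) auto
      also have "\<dots> = (\<bar>s1\<bar> + K) / y" using y by (simp add: power2_eq_square)
      finally show "y * ((\<bar>s1\<bar> + K / ?Y) / ?Y\<^sup>2) \<le> (\<bar>s1\<bar> + K) / y" .
      have "s0 * (e n / ?Y) \<le> s0 * (1 / y)" using s0 e[of n] y Y by (intro mult_left_mono frac_le) auto
      then show "s0 * (e n / ?Y) \<le> s0 / y" by simp
    qed
    finally show ?thesis by (simp add: C_def add_divide_distrib)
  qed
  have mass: "measure (\<mu> n) UNIV = 1" for n
  proof -
    interpret finite_borel_measure "\<mu> n" by (rule fin)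
    have "(\<lambda>m. \<i> * of_nat (Suc m) * h n (\<i> * of_nat (Suc m)) + of_real s0) \<longlonglongrightarrow> 0"
    proof (rule Lim_null_comparison)
      show "(\<lambda>m. C / real (Suc m)) \<longlonglongrightarrow> 0" by (rule LIMSEQ_Suc[OF lim_const_over_n])
      have "cmod (\<i> * of_nat (Suc m) * h n (\<i> * of_nat (Suc m)) + of_real s0) \<le> C / real (Suc m)" for m
        using asym[where n=n and y="real (Suc m)"] by (simp del: of_nat_Suc)
      then show "\<forall>\<^sub>F m in sequentially. cmod (\<i> * of_nat (Suc m) * h n (\<i> * of_nat (Suc m)) + of_real s0) \<le> C / real (Suc m)"
        by simp
    qed
    then have "(\<lambda>m. (\<i> * of_nat (Suc m) * h n (\<i> * of_nat (Suc m)) + of_real s0) / of_real s0 - 1) \<longlonglongrightarrow> 0 / of_real s0 - 1"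
      using s0 by (intro tendsto_intros) auto
    moreover have "(\<i> * of_nat (Suc m) * h n (\<i> * of_nat (Suc m)) + of_real s0) / of_real s0 - 1
        = \<i> * of_nat (Suc m) * (LINT t|\<mu> n. 1 / (complex_of_real t - \<i> * of_nat (Suc m)))" for m
      using s0 by (subst tr) (simp_all add: add_divide_distrib)
    ultimately have "(\<lambda>m. \<i> * of_nat (Suc m) * (LINT t|\<mu> n. 1 / (complex_of_real t - \<i> * of_nat (Suc m)))) \<longlonglongrightarrow> - 1"
      by (simp only: div_0 diff_0)
    then have "- complex_of_real (measure (\<mu> n) UNIV) = - 1"
      using stieltjes_transform_at_infinity LIMSEQ_unique by blast
    then show ?thesis by (simp add: complex_eq_iff)
  qed
  have dist: "real_distribution (\<mu> n)" for n
  proof -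
    interpret finite_borel_measure "\<mu> n" by (rule fin)
    have "prob_space (\<mu> n)"
      by (rule prob_spaceI) (simp add: borel_UNIV emeasure_eq_measure mass)
    then show ?thesis
      unfolding real_distribution_def real_distribution_axioms_def using M_is_borel by simp
  qed
  have "tight \<mu>"
    unfolding tight_def
  proof (intro conjI allI impI dist)
    fix \<epsilon> :: real assume \<epsilon>: "\<epsilon> > 0"
    \<comment> \<open>Chosen so that 2 C / (s0 y) < \<epsilon>. Off the interval y^2 / (t^2 + y^2)
      is at most 1/2, so the mass inside is at least 1 - 2 C / (s0 y).\<close>
    define y where "y = 2 * (C / s0) / \<epsilon> + 1"
    have C: "C \<ge> 0" using s0 K by (simp add: C_def)
    then have y: "y \<ge> 1" using s0 \<epsilon> by (simp add: y_def)
    have ey: "2 * (C / s0) / y < \<epsilon>"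
    proof -
      have "2 * (C / s0) = (y - 1) * \<epsilon>" using \<epsilon> by (simp add: y_def)
      also have "\<dots> < y * \<epsilon>" using \<epsilon> by simp
      finally have "2 * (C / s0) < y * \<epsilon>" .
      moreover have "y > 0" using y by linarith
      ultimately show ?thesis by (simp only: pos_divide_less_eq mult.commute)
    qed
    have "measure (\<mu> n) {- y<..y} > 1 - \<epsilon>" for n
    proof -
      interpret real_distribution "\<mu> n" by (rule dist)
      have fb: "finite_borel_measure (\<mu> n)" by (rule fin)
      let ?I = "LINT t|\<mu> n. y / (t\<^sup>2 + y\<^sup>2)"
      have I: "Im (h n (\<i> * of_real y) / of_real s0) = ?I" "integrable (\<mu> n) (\<lambda>t. y / (t\<^sup>2 + y\<^sup>2))"
        using finite_borel_measure.Im_stieltjes_transform[OF fb, of "\<i> * of_real y"] tr[of "\<i> * of_real y" n] y by simp_all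
      have "\<bar>Re (\<i> * of_real y * h n (\<i> * of_real y) + of_real s0)\<bar> \<le> C / y"
        using order_trans[OF abs_Re_le_cmod asym[OF y]] .
      then have "s0 - y * Im (h n (\<i> * of_real y)) \<le> C / y" by (simp add: abs_le_iff)
      moreover have "Im (h n (\<i> * of_real y)) = s0 * ?I"
      proof -
        have "Im (h n (\<i> * of_real y) / of_real s0) = Im (h n (\<i> * of_real y)) / s0" by simp
        then show ?thesis unfolding I(1)[symmetric] using s0 by simp
      qed
      ultimately have "s0 * (1 - y * ?I) \<le> C / y" by (simp add: algebra_simps)
      then have "1 - y * ?I \<le> C / y / s0" using s0 by (simp only: pos_le_divide_eq mult.commute)
      then have 1: "1 - y * ?I \<le> (C / s0) / y" by (simp add: mult.commute)
      have "(LINT t|\<mu> n. 2 * y * (y / (t\<^sup>2 + y\<^sup>2)) - 1) \<le> (LINT t|\<mu> n. indicator {- y<..y} t)"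
      proof (rule integral_mono)
        show "integrable (\<mu> n) (\<lambda>t. 2 * y * (y / (t\<^sup>2 + y\<^sup>2)) - 1)"
          by (intro Bochner_Integration.integrable_diff integrable_mult_right I(2)) simp
        show "integrable (\<mu> n) (indicat_real {- y<..y})" by (intro integrable_real_indicator) (auto simp: emeasure_eq_measure)
        fix t
        have pos: "t\<^sup>2 + y\<^sup>2 > 0" using y by (intro add_nonneg_pos) auto
        show "2 * y * (y / (t\<^sup>2 + y\<^sup>2)) - 1 \<le> indicator {- y<..y} t"
        proof (cases "t \<in> {- y<..y}")
          case True
          have "y\<^sup>2 \<le> t\<^sup>2 + y\<^sup>2" by simp
          then have "y\<^sup>2 / (t\<^sup>2 + y\<^sup>2) \<le> 1" using pos by (simp add: pos_divide_le_eq)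
          then show ?thesis using True by (simp add: power2_eq_square)
        next
          case False
          then have "\<bar>y\<bar> \<le> \<bar>t\<bar>" using y by auto
          then have "y\<^sup>2 \<le> t\<^sup>2" by (rule abs_le_square_iff[THEN iffD1])
          then have "2 * y\<^sup>2 / (t\<^sup>2 + y\<^sup>2) \<le> 1" using pos by (simp add: pos_divide_le_eq)
          then show ?thesis using False by (simp add: power2_eq_square)
        qed
      qed
      also have "(LINT t|\<mu> n. 2 * y * (y / (t\<^sup>2 + y\<^sup>2)) - 1) = 2 * (y * ?I) - 1"
      proof -
        have "(LINT t|\<mu> n. 2 * y * (y / (t\<^sup>2 + y\<^sup>2)) - 1) = (LINT t|\<mu> n. 2 * y * (y / (t\<^sup>2 + y\<^sup>2))) - (LINT t|\<mu> n. 1)"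
          by (intro Bochner_Integration.integral_diff integrable_mult_right I(2)) simp
        also have "(LINT t|\<mu> n. 2 * y * (y / (t\<^sup>2 + y\<^sup>2))) = 2 * y * ?I"
          by (rule Bochner_Integration.integral_mult_right_zero)
        also have "(LINT t|\<mu> n. (1::real)) = 1" using prob_space by simp
        finally show ?thesis by simp
      qed
      also have "(LINT t|\<mu> n. indicat_real {- y<..y} t) = measure (\<mu> n) {- y<..y}" by simp
      finally have "2 * (y * ?I) - 1 \<le> measure (\<mu> n) {- y<..y}" .
      moreover have "2 * (C / s0 / y) < \<epsilon>" using ey by simp
      ultimately show ?thesis using 1 by linarith
    qed
    then show "\<exists>a b. a < b \<and> (\<forall>n. 1 - \<epsilon> < measure (\<mu> n) {a<..b})"
      using y by (intro exI[of _ "- y"] exI[of _ y]) auto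
  qed
  \<comment> \<open>The compactness theorem refines a given subsequence; \<open>id\<close> supplies
    the whole sequence.\<close>
  moreover have "strict_mono (id :: nat \<Rightarrow> nat)" by (simp add: strict_mono_def)
  ultimately have "\<exists>r M. strict_mono (r :: nat \<Rightarrow> nat) \<and> real_distribution M \<and> weak_conv_m (\<mu> \<circ> id \<circ> r) M"
    by (rule tight_imp_convergent_subsubsequence)
  then obtain r M where r: "strict_mono (r :: nat \<Rightarrow> nat)" "real_distribution M" "weak_conv_m (\<mu> \<circ> r) M"
    unfolding comp_id by blast
  interpret M: real_distribution M by (rule r(2))
  have lim: "f z = of_real s0 * (LINT t|M. 1 / (complex_of_real t - z))" if z: "Im z > 0" for z
  proof -
    have "(\<lambda>n. LINT t|(\<mu> \<circ> r) n. 1 / (complex_of_real t - z)) \<longlonglongrightarrow> (LINT t|M. 1 / (complex_of_real t - z))"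
    proof (rule weak_conv_imp_integral_bdd_continuous_conv[where B="1 / Im z"])
      show "real_distribution ((\<mu> \<circ> r) n)" for n by (simp add: dist)
    qed (rule r cauchy_kernel_continuous(2,3)[OF z])+
    then have 1: "(\<lambda>n. f (z + \<i> * of_real (e (r n))) / of_real s0) \<longlonglongrightarrow> (LINT t|M. 1 / (complex_of_real t - z))"
      by (simp add: tr[OF z] h_def)
    have "e \<longlonglongrightarrow> 0" unfolding e_def[abs_def] by (rule LIMSEQ_Suc[OF lim_const_over_n])
    then have "(\<lambda>n. e (r n)) \<longlonglongrightarrow> 0"
      using LIMSEQ_subseq_LIMSEQ[OF _ r(1), of e] by (simp add: o_def)
    then have "(\<lambda>n. z + \<i> * of_real (e (r n))) \<longlonglongrightarrow> z + \<i> * of_real 0" by (intro tendsto_intros)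
    moreover have "isCont f z"
      using holomorphic_on_imp_continuous_on[OF hol] z
      by (simp add: continuous_on_eq_continuous_at open_halfspace_Im_gt)
    ultimately have "(\<lambda>n. f (z + \<i> * of_real (e (r n)))) \<longlonglongrightarrow> f z"
      using isCont_tendsto_compose[of z f "\<lambda>n. z + \<i> * of_real (e (r n))"] by simp
    then have "(\<lambda>n. f (z + \<i> * of_real (e (r n))) / of_real s0) \<longlonglongrightarrow> f z / of_real s0"
      using s0 by (intro tendsto_intros) auto
    from LIMSEQ_unique[OF this 1] show ?thesis using s0 by (simp add: field_simps)
  qed
  let ?M = "density M (\<lambda>t. ennreal s0)"
  have "finite_borel_measure ?M"
    by (rule finite_borel_measure_density(1)) (use s0 in auto)
  moreover have "(LINT t|?M. 1 / (complex_of_real t - z)) = of_real s0 * (LINT t|M. 1 / (complex_of_real t - z))" for z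
  proof -
    have "(LINT t|?M. 1 / (complex_of_real t - z)) = (LINT t|M. s0 *\<^sub>R (1 / (complex_of_real t - z)))"
      by (rule integral_density) (use s0 in auto)
    also have "\<dots> = s0 *\<^sub>R (LINT t|M. 1 / (complex_of_real t - z))" by (rule integral_scaleR_right)
    finally show ?thesis by (simp add: scaleR_conv_of_real)
  qed
  ultimately show ?thesis using lim by (intro exI[of _ ?M]) auto
qed

section \<open>Moments from the expansion at infinity\<close>

context finite_borel_measure
begin

text \<open>Since h is O(1 / y) at \<i> y, dividing h = a + c z + z^2 F by z gives the mass c. Then
  y Im h(\<i> y) is the integral of y^2 t^2 / (t^2 + y^2), which is bounded by K and increases to
  the second moment. Finally t^2 / (t - z) = t + z + z^2 / (t - z) yields a and the last
  claim.\<close>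

lemma moment_step:
  defines "F \<equiv> \<lambda>z. LINT t|M. 1 / (complex_of_real t - z)"
  assumes h: "\<And>z. Im z > 0 \<Longrightarrow> h z = of_real a + z * of_real c + z\<^sup>2 * F z"
    and K: "\<And>y. y > 0 \<Longrightarrow> cmod (h (\<i> * of_real y)) \<le> K / y"
  shows "measure M UNIV = c" "integrable M (\<lambda>t. t\<^sup>2)" "integrable M (\<lambda>t. t)" "(LINT t|M. t) = a"
    "\<And>z. Im z > 0 \<Longrightarrow> h z = (LINT t|M. of_real (t\<^sup>2) / (of_real t - z))"
proof -
  let ?y = "\<lambda>n. real (Suc n)"
  have yp: "?y n > 0" for n by simp
  have h0: "(\<lambda>n. h (\<i> * of_real (?y n))) \<longlonglongrightarrow> 0"
  proof (rule Lim_null_comparison)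
    show "(\<lambda>n. K / ?y n) \<longlonglongrightarrow> 0" by (rule LIMSEQ_Suc[OF lim_const_over_n])
    show "\<forall>\<^sub>F n in sequentially. cmod (h (\<i> * of_real (?y n))) \<le> K / ?y n"
      by (intro always_eventually allI K yp)
  qed
  have inv0: "(\<lambda>n. 1 / (\<i> * complex_of_real (?y n))) \<longlonglongrightarrow> 0"
  proof (rule Lim_null_comparison)
    show "(\<lambda>n. 1 / ?y n) \<longlonglongrightarrow> 0" by (rule LIMSEQ_Suc[OF lim_const_over_n])
    have "cmod (1 / (\<i> * complex_of_real (?y n))) \<le> 1 / ?y n" for n
      unfolding norm_divide norm_mult norm_of_real by simp
    then show "\<forall>\<^sub>F n in sequentially. cmod (1 / (\<i> * complex_of_real (?y n))) \<le> 1 / ?y n" by simp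
  qed
  have "(\<lambda>n. (h (\<i> * of_real (?y n)) - of_real a) * (1 / (\<i> * complex_of_real (?y n))) - of_real c) \<longlonglongrightarrow> (0 - of_real a) * 0 - of_real c"
    by (intro tendsto_intros h0 inv0)
  moreover have "(h (\<i> * of_real (?y n)) - of_real a) * (1 / (\<i> * complex_of_real (?y n))) - of_real c
      = \<i> * of_nat (Suc n) * F (\<i> * of_nat (Suc n))" for n
  proof -
    have alg: "(x + w * y + w\<^sup>2 * v - x) * (1 / w) - y = w * v" if "w \<noteq> 0" for x y v w :: complex
      using that by (simp add: field_simps power2_eq_square)
    have w: "\<i> * of_nat (Suc n) \<noteq> (0 :: complex)" by (simp del: of_nat_Suc)
    show ?thesis unfolding of_real_of_nat_eq by (subst h) (simp del: of_nat_Suc, rule alg[OF w])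
  qed
  ultimately have "(\<lambda>n. \<i> * of_nat (Suc n) * F (\<i> * of_nat (Suc n))) \<longlonglongrightarrow> - of_real c" by simp
  then have "- complex_of_real (measure M UNIV) = - of_real c"
    using stieltjes_transform_at_infinity LIMSEQ_unique unfolding F_def by blast
  then show c: "measure M UNIV = c" by (metis neg_equal_iff_equal of_real_eq_iff)
  let ?q = "\<lambda>n t. (?y n)\<^sup>2 * t\<^sup>2 / (t\<^sup>2 + (?y n)\<^sup>2)"
  have pos: "t\<^sup>2 + (?y n)\<^sup>2 > 0" for n t using yp[of n] by (intro add_nonneg_pos) auto
  have q_eq: "?q n t = (?y n)\<^sup>2 * (1 - ?y n * (?y n / (t\<^sup>2 + (?y n)\<^sup>2)))" for n t
    using pos[of t n] by (simp add: field_simps power2_eq_square)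
  have ImI: "Im (F (\<i> * of_real (?y n))) = (LINT t|M. ?y n / (t\<^sup>2 + (?y n)\<^sup>2))"
    "integrable M (\<lambda>t. ?y n / (t\<^sup>2 + (?y n)\<^sup>2))" for n
    using Im_stieltjes_transform[of "\<i> * of_real (?y n)"] yp[of n] by (simp_all add: F_def del: of_nat_Suc)
  have intq: "integrable M (?q n)" for n
    unfolding q_eq using ImI(2)[of n] by (intro integrable_mult_right Bochner_Integration.integrable_diff) auto
  have q_bd: "(LINT t|M. ?q n t) \<le> K" for n
  proof -
    have "(LINT t|M. ?q n t) = (?y n)\<^sup>2 * (measure M UNIV - ?y n * Im (F (\<i> * of_real (?y n))))"
    proof -
      have "(LINT t|M. 1 - ?y n * (?y n / (t\<^sup>2 + (?y n)\<^sup>2))) = (LINT t|M. 1) - (LINT t|M. ?y n * (?y n / (t\<^sup>2 + (?y n)\<^sup>2)))"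
        using ImI(2)[of n] by (intro Bochner_Integration.integral_diff integrable_mult_right) auto
      also have "(LINT t|M. ?y n * (?y n / (t\<^sup>2 + (?y n)\<^sup>2))) = ?y n * (LINT t|M. ?y n / (t\<^sup>2 + (?y n)\<^sup>2))"
        by (rule Bochner_Integration.integral_mult_right_zero)
      finally show ?thesis
        unfolding q_eq ImI(1) Bochner_Integration.integral_mult_right_zero by (simp add: borel_UNIV)
    qed
    also have "\<dots> = ?y n * Im (h (\<i> * of_real (?y n)))"
      using yp[of n] by (subst h) (simp_all add: c power2_eq_square algebra_simps del: of_nat_Suc)
    also have "\<dots> \<le> ?y n * (K / ?y n)"
      using order_trans[OF abs_Im_le_cmod K[OF yp[of n]]] yp[of n] by (intro mult_left_mono) auto
    also have "\<dots> = K" using yp[of n] by (simp del: of_nat_Suc)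
    finally show ?thesis .
  qed
  have q_mono: "?q n t \<le> ?q m t" if "n \<le> m" for n m t
  proof -
    have "(?y n)\<^sup>2 \<le> (?y m)\<^sup>2" using that by (intro power_mono) auto
    then have "(?y n)\<^sup>2 * t\<^sup>2 * t\<^sup>2 \<le> (?y m)\<^sup>2 * t\<^sup>2 * t\<^sup>2" by (intro mult_right_mono) auto
    then have "(?y n)\<^sup>2 * t\<^sup>2 * (t\<^sup>2 + (?y m)\<^sup>2) \<le> (?y m)\<^sup>2 * t\<^sup>2 * (t\<^sup>2 + (?y n)\<^sup>2)" by (simp add: algebra_simps)
    then show ?thesis using pos[of t n] pos[of t m] by (simp add: frac_le_eq divide_le_eq_1 pos_divide_le_eq pos_le_divide_eq)
  qed
  have q_lim: "(\<lambda>n. ?q n t) \<longlonglongrightarrow> t\<^sup>2" for t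
  proof -
    have "(\<lambda>n::nat. (real n)\<^sup>2 * t\<^sup>2 / (t\<^sup>2 + (real n)\<^sup>2)) \<longlonglongrightarrow> t\<^sup>2" by real_asymp
    then show ?thesis by (rule LIMSEQ_Suc)
  qed
  have "incseq (\<lambda>n. LINT t|M. ?q n t)"
    by (intro incseq_SucI integral_mono intq q_mono) simp
  then obtain L where L: "(\<lambda>n. LINT t|M. ?q n t) \<longlonglongrightarrow> L"
    using incseq_convergent[of "\<lambda>n. LINT t|M. ?q n t" K] q_bd by blast
  show t2: "integrable M (\<lambda>t. t\<^sup>2)"
  proof (rule integral_monotone_convergence_nonneg(1)[OF intq _ _ _ L])
    show "AE t in M. mono (\<lambda>n. ?q n t)" by (intro always_eventually allI monoI q_mono)
    show "AE t in M. 0 \<le> ?q n t" for n by simp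
    show "AE t in M. (\<lambda>n. ?q n t) \<longlonglongrightarrow> t\<^sup>2" by (intro always_eventually allI q_lim)
    show "(\<lambda>t. t\<^sup>2) \<in> borel_measurable M" by measurable
  qed
  show t1: "integrable M (\<lambda>t. t)"
  proof (rule Bochner_Integration.integrable_bound[where f="\<lambda>t. 1 + t\<^sup>2"])
    show "integrable M (\<lambda>t. 1 + t\<^sup>2)" using t2 by simp
    show "(\<lambda>t. t) \<in> borel_measurable M" by measurable
    have "\<bar>t\<bar> \<le> 1 + t\<^sup>2" for t :: real
    proof (cases "\<bar>t\<bar> \<le> 1")
      case False
      then have "\<bar>t\<bar> * 1 \<le> \<bar>t\<bar> * \<bar>t\<bar>" by (intro mult_left_mono) auto
      then show ?thesis by (simp add: power2_eq_square)
    qed (use zero_le_power2[of t] in linarith)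
    then show "AE t in M. norm t \<le> norm (1 + t\<^sup>2)" by simp
  qed
  have ker: "integrable M (\<lambda>t. of_real (t\<^sup>2) / (of_real t - z))"
    "(LINT t|M. of_real (t\<^sup>2) / (of_real t - z)) = h z - of_real a + of_real (LINT t|M. t)" if z: "Im z > 0" for z
  proof -
    have eq: "complex_of_real (t\<^sup>2) / (of_real t - z) = of_real t + z + z\<^sup>2 * (1 / (of_real t - z))" for t
    proof -
      have "of_real t - z \<noteq> 0" using z by (auto simp: complex_eq_iff)
      then show ?thesis by (simp add: field_simps power2_eq_square)
    qed
    note k = integrable_cauchy_kernel[OF z]
    show "integrable M (\<lambda>t. of_real (t\<^sup>2) / (of_real t - z))"
      unfolding eq using t1 k by (intro Bochner_Integration.integrable_add integrable_mult_right) auto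
    have "(LINT t|M. of_real (t\<^sup>2) / (of_real t - z)) = of_real (LINT t|M. t) + z * of_real c + z\<^sup>2 * F z"
    proof -
      have t: "integrable M (\<lambda>t. complex_of_real t)" using t1 by (rule integrable_of_real)
      have "(LINT t|M. of_real t + z + z\<^sup>2 * (1 / (of_real t - z))) = (LINT t|M. of_real t + z) + (LINT t|M. z\<^sup>2 * (1 / (of_real t - z)))"
        using t k by (intro Bochner_Integration.integral_add Bochner_Integration.integrable_add integrable_mult_right) auto
      also have "(LINT t|M. z\<^sup>2 * (1 / (of_real t - z))) = z\<^sup>2 * F z"
        unfolding F_def by (rule Bochner_Integration.integral_mult_right_zero)
      also have "(LINT t|M. of_real t + z) = of_real (LINT t|M. t) + z * of_real c"
        using t by (simp add: c borel_UNIV scaleR_conv_of_real mult.commute)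
      finally show ?thesis unfolding eq .
    qed
    then show "(LINT t|M. of_real (t\<^sup>2) / (of_real t - z)) = h z - of_real a + of_real (LINT t|M. t)"
      using h[OF z] by simp
  qed
  \<comment> \<open>Both h and the integral of t^2 / (t - \<i> y) vanish at infinity, so the
    constant by which they differ is 0; this identifies a.\<close>
  have "(\<lambda>n. LINT t|M. of_real (t\<^sup>2) / (of_real t - \<i> * of_real (?y n))) \<longlonglongrightarrow> 0"
  proof (rule Lim_null_comparison)
    show "(\<lambda>n. (LINT t|M. t\<^sup>2) / ?y n) \<longlonglongrightarrow> 0" by (rule LIMSEQ_Suc[OF lim_const_over_n])
    have "cmod (LINT t|M. of_real (t\<^sup>2) / (of_real t - \<i> * of_real (?y n))) \<le> (LINT t|M. t\<^sup>2) / ?y n" for n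
    proof -
      have "cmod (LINT t|M. of_real (t\<^sup>2) / (of_real t - \<i> * of_real (?y n))) \<le> (LINT t|M. t\<^sup>2 / ?y n)"
      proof (rule Bochner_Integration.integral_norm_bound_integral)
        show "integrable M (\<lambda>t. complex_of_real (t\<^sup>2) / (of_real t - \<i> * of_real (?y n)))" by (rule ker(1)) simp
        show "integrable M (\<lambda>t. t\<^sup>2 / ?y n)" using t2 by simp
        fix t
        have "cmod (1 / (of_real t - \<i> * of_real (?y n))) \<le> 1 / Im (\<i> * of_real (?y n))"
          by (rule cauchy_kernel_continuous(3)) simp
        then have "t\<^sup>2 * cmod (1 / (of_real t - \<i> * of_real (?y n))) \<le> t\<^sup>2 * (1 / ?y n)"
          by (intro mult_left_mono) auto
        then show "cmod (of_real (t\<^sup>2) / (of_real t - \<i> * of_real (?y n))) \<le> t\<^sup>2 / ?y n"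
          by (simp add: norm_divide norm_power)
      qed
      then show ?thesis by simp
    qed
    then show "\<forall>\<^sub>F n in sequentially. cmod (LINT t|M. of_real (t\<^sup>2) / (of_real t - \<i> * of_real (?y n))) \<le> (LINT t|M. t\<^sup>2) / ?y n"
      by simp
  qed
  moreover have "(LINT t|M. of_real (t\<^sup>2) / (of_real t - \<i> * of_real (?y n))) = h (\<i> * of_real (?y n)) - of_real a + of_real (LINT t|M. t)" for n
    by (rule ker(2)) simp
  ultimately have "(\<lambda>n. h (\<i> * of_real (?y n)) - of_real a + of_real (LINT t|M. t)) \<longlonglongrightarrow> 0" by (simp only:)
  moreover have "(\<lambda>n. h (\<i> * of_real (?y n)) - of_real a + of_real (LINT t|M. t)) \<longlonglongrightarrow> 0 - of_real a + of_real (LINT t|M. t)"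
    by (intro tendsto_intros h0)
  ultimately have "0 = 0 - complex_of_real a + of_real (LINT t|M. t)" by (rule LIMSEQ_unique)
  then show a: "(LINT t|M. t) = a" by (simp add: complex_eq_iff)
  show "h z = (LINT t|M. of_real (t\<^sup>2) / (of_real t - z))" if "Im z > 0" for z
    using ker(2)[OF that] a by simp
qed

text \<open>Inductively f n is the transform of the measure t^(2n) dM. Applying
  \<open>moment_step\<close> to that measure returns the moments 2n and 2n + 1 and the
  representation of the next f.\<close>

lemma moments:
  fixes f :: "nat \<Rightarrow> complex \<Rightarrow> complex" and a c K :: "nat \<Rightarrow> real"
  assumes f0: "\<And>z. Im z > 0 \<Longrightarrow> f 0 z = (LINT t|M. 1 / (of_real t - z))"
    and fS: "\<And>n z. Im z > 0 \<Longrightarrow> f (Suc n) z = of_real (a n) + z * of_real (c n) + z\<^sup>2 * f n z"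
    and K: "\<And>n y. y > 0 \<Longrightarrow> cmod (f (Suc n) (\<i> * of_real y)) \<le> K n / y"
  shows "integrable M (\<lambda>t. t ^ (2 * n))" "(LINT t|M. t ^ (2 * n)) = c n"
    "integrable M (\<lambda>t. t ^ (2 * n + 1))" "(LINT t|M. t ^ (2 * n + 1)) = a n"
proof -
  have step: "integrable M (\<lambda>t. t ^ (2 * Suc n)) \<and> (\<forall>z. Im z > 0 \<longrightarrow> f (Suc n) z = (LINT t|M. t ^ (2 * Suc n) *\<^sub>R (1 / (of_real t - z))))
    \<and> (LINT t|M. t ^ (2 * n)) = c n \<and> integrable M (\<lambda>t. t ^ (2 * n + 1)) \<and> (LINT t|M. t ^ (2 * n + 1)) = a n"
    if IH: "integrable M (\<lambda>t. t ^ (2 * n))" "\<And>z. Im z > 0 \<Longrightarrow> f n z = (LINT t|M. t ^ (2 * n) *\<^sub>R (1 / (of_real t - z)))" for n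
  proof -
    let ?\<nu> = "density M (\<lambda>t. ennreal (t ^ (2 * n)))"
    have fin: "finite_borel_measure ?\<nu>" "measure ?\<nu> UNIV = (LINT t|M. t ^ (2 * n))"
      using finite_borel_measure_density[OF M_is_borel IH(1)] by auto
    interpret \<nu>: finite_borel_measure ?\<nu> by (rule fin)
    note dens = integrable_density_power[OF M_is_borel, where n=n]
    have hS: "f (Suc n) z = of_real (a n) + z * of_real (c n) + z\<^sup>2 * (LINT t|?\<nu>. 1 / (complex_of_real t - z))" if "Im z > 0" for z
      using fS[OF that] IH(2)[OF that] dens(2)[of "\<lambda>t. 1 / (complex_of_real t - z)"] cauchy_kernel_borel by simp
    note step = \<nu>.moment_step[where h="f (Suc n)" and K="K n" and a="a n" and c="c n"]
    have ms: "measure ?\<nu> UNIV = c n" "integrable ?\<nu> (\<lambda>t. t\<^sup>2)" "integrable ?\<nu> (\<lambda>t. t)" "(LINT t|?\<nu>. t) = a n"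
      by (rule step(1), erule hS, erule K, rule step(2), erule hS, erule K,
          rule step(3), erule hS, erule K, rule step(4), erule hS, erule K)
    have ms5: "f (Suc n) z = (LINT t|?\<nu>. of_real (t\<^sup>2) / (of_real t - z))" if "Im z > 0" for z
      by (rule step(5)[OF _ _ that], erule hS, erule K)
    have "integrable M (\<lambda>t. t ^ (2 * n) *\<^sub>R t\<^sup>2)" by (rule dens(1)[THEN iffD1, OF _ ms(2)]) measurable
    then have 1: "integrable M (\<lambda>t. t ^ (2 * Suc n))" by (simp add: power2_eq_square mult_ac)
    have "integrable M (\<lambda>t. t ^ (2 * n) *\<^sub>R t)" by (rule dens(1)[THEN iffD1, OF _ ms(3)]) measurable
    then have 2: "integrable M (\<lambda>t. t ^ (2 * n + 1))" by (simp add: mult.commute)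
    have "(LINT t|M. t ^ (2 * n) *\<^sub>R t) = a n" 
    proof -
      have "(LINT t|?\<nu>. t) = (LINT t|M. t ^ (2 * n) *\<^sub>R t)" by (rule dens(2)) measurable
      then show ?thesis using ms(4) by simp
    qed
    then have 3: "(LINT t|M. t ^ (2 * n + 1)) = a n" by (simp add: mult.commute)
    have 4: "f (Suc n) z = (LINT t|M. t ^ (2 * Suc n) *\<^sub>R (1 / (of_real t - z)))" if z: "Im z > 0" for z
    proof -
      have "f (Suc n) z = (LINT t|M. t ^ (2 * n) *\<^sub>R (complex_of_real (t\<^sup>2) / (of_real t - z)))"
        unfolding ms5[OF z] by (rule dens(2)) measurable
      also have "\<dots> = (LINT t|M. t ^ (2 * Suc n) *\<^sub>R (1 / (of_real t - z)))"
        by (intro Bochner_Integration.integral_cong refl) (simp add: scaleR_conv_of_real power2_eq_square mult_ac)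
      finally show ?thesis .
    qed
    show ?thesis using 1 2 3 4 ms(1) fin(2) by simp
  qed
  have ind: "integrable M (\<lambda>t. t ^ (2 * n)) \<and> (\<forall>z. Im z > 0 \<longrightarrow> f n z = (LINT t|M. t ^ (2 * n) *\<^sub>R (1 / (of_real t - z))))" for n
  proof (induction n)
    case 0
    then show ?case using f0 by simp
  next
    case (Suc n)
    then show ?case using step[of n] by blast
  qed
  from step[of n] ind[of n] show "integrable M (\<lambda>t. t ^ (2 * n))" "(LINT t|M. t ^ (2 * n)) = c n"
    "integrable M (\<lambda>t. t ^ (2 * n + 1))" "(LINT t|M. t ^ (2 * n + 1)) = a n" by blast+
qed

end

section \<open>Quadratic forms\<close>

definition qform :: "nat \<Rightarrow> (nat \<Rightarrow> nat \<Rightarrow> complex) \<Rightarrow> (nat \<Rightarrow> complex) \<Rightarrow> complex" where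
  "qform N H \<alpha> = (\<Sum>k<N. \<Sum>j<N. \<alpha> k * cnj (\<alpha> j) * H k j)"

text \<open>Half of e_k + s e_j; the factor 1/2 makes the polarization identity hold with
  coefficients of modulus 1.\<close>

definition polar_vec :: "complex \<Rightarrow> nat \<Rightarrow> nat \<Rightarrow> nat \<Rightarrow> complex" where
  "polar_vec s k j a = ((if a = k then 1 else 0) + s * (if a = j then 1 else 0)) / 2"

lemma qform_polar_vec:
  assumes "k < N" "j < N"
  shows "qform N H (polar_vec s k j) = (H k k + cnj s * H k j + s * H j k + s * cnj s * H j j) / 4"
proof -
  have s1: "(\<Sum>a<N. polar_vec s k j a * X a) = (X k + s * X j) / 2" for X :: "nat \<Rightarrow> complex"
  proof -
    have "(\<Sum>a<N. polar_vec s k j a * X a)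
        = (\<Sum>a<N. (if a = k then X a / 2 else 0) + (if a = j then s * X a / 2 else 0))"
      by (intro sum.cong refl) (auto simp: polar_vec_def field_simps)
    also have "\<dots> = X k / 2 + s * X j / 2" using assms by (simp add: sum.distrib)
    finally show ?thesis by (simp add: add_divide_distrib)
  qed
  have s2: "(\<Sum>a<N. cnj (polar_vec s k j a) * X a) = (X k + cnj s * X j) / 2" for X :: "nat \<Rightarrow> complex"
  proof -
    have "(\<Sum>a<N. cnj (polar_vec s k j a) * X a) = cnj (\<Sum>a<N. polar_vec s k j a * cnj (X a))" by simp
    also have "\<dots> = (X k + cnj s * X j) / 2" unfolding s1 by simp
    finally show ?thesis .
  qed
  have "qform N H (polar_vec s k j) = (\<Sum>a<N. polar_vec s k j a * (\<Sum>b<N. cnj (polar_vec s k j b) * H a b))"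
    by (simp add: qform_def sum_distrib_left mult.assoc)
  also have "\<dots> = (H k k + cnj s * H k j + s * H j k + s * cnj s * H j j) / 4"
    unfolding s2 s1 by (simp add: field_simps)
  finally show ?thesis .
qed

lemma qform_polar_diff:
  assumes "k < N" "j < N"
  shows "qform N H (polar_vec s k j) - qform N H (polar_vec (- s) k j) = (cnj s * H k j + s * H j k) / 2"
  unfolding qform_polar_vec[OF assms] by (simp add: field_simps)

lemma qform_polarization:
  assumes "k < N" "j < N"
  shows "qform N H (polar_vec 1 k j) - qform N H (polar_vec (- 1) k j)
    + \<i> * (qform N H (polar_vec \<i> k j) - qform N H (polar_vec (- \<i>) k j)) = H k j"
  unfolding qform_polar_diff[OF assms] by (simp add: field_simps)

text \<open>Polarization with real and imaginary part each a difference of two values of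
  \<open>q\<close>. When \<open>q\<close> grows with a real parameter, these are the four functions
  of a Jordan decomposition.\<close>

definition polar_entry :: "((nat \<Rightarrow> complex) \<Rightarrow> real) \<Rightarrow> nat \<Rightarrow> nat \<Rightarrow> complex" where
  "polar_entry q k j = Complex (q (polar_vec 1 k j) - q (polar_vec (- 1) k j)) (q (polar_vec \<i> k j) - q (polar_vec (- \<i>) k j))"

text \<open>The real part of the form sees only the Hermitian part of \<open>H\<close>, so that part
  is what comes back.\<close>

lemma polar_entry_Re_qform:
  assumes "k < N" "j < N" and q: "\<And>\<alpha>. q \<alpha> = Re (qform N H \<alpha>)"
  shows "polar_entry q k j = (H k j + cnj (H j k)) / 2"
  unfolding polar_entry_def q minus_complex.sel(1)[symmetric] qform_polar_diff[OF assms(1,2)]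
  by (simp add: complex_eq_iff)

lemma cnj_qform: "cnj (qform N H \<alpha>) = qform N (\<lambda>k j. cnj (H j k)) \<alpha>"
  unfolding qform_def by (subst sum.swap) (simp add: mult_ac)

lemma qform_polar_entry:
  assumes q: "\<And>\<alpha>. q \<alpha> = Re (qform N H \<alpha>)"
  shows "q \<alpha> = Re (qform N (polar_entry q) \<alpha>)"
proof -
  have "qform N (polar_entry q) \<alpha> = qform N (\<lambda>k j. (H k j + cnj (H j k)) / 2) \<alpha>"
    unfolding qform_def by (intro sum.cong refl) (simp add: polar_entry_Re_qform[OF _ _ q])
  also have "\<dots> = (qform N H \<alpha> + qform N (\<lambda>k j. cnj (H j k)) \<alpha>) / 2"
    unfolding qform_def sum.distrib[symmetric] sum_divide_distrib
    by (intro sum.cong refl) (simp add: field_simps)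
  also have "\<dots> = (qform N H \<alpha> + cnj (qform N H \<alpha>)) / 2" by (simp add: cnj_qform)
  finally have e: "qform N (polar_entry q) \<alpha> = (qform N H \<alpha> + cnj (qform N H \<alpha>)) / 2" .
  show ?thesis unfolding e by (simp add: q)
qed

text \<open>Being the real part of a quadratic form amounts to agreeing with the form of one's own
  polarized entries. That identity involves finitely many values at a time and so survives pointwise
  limits.\<close>

lemma qform_real_limit:
  assumes lim: "\<And>\<alpha>. (\<lambda>n. q n \<alpha>) \<longlonglongrightarrow> Q \<alpha>" and q: "\<And>n \<alpha>. q n \<alpha> = Re (qform N (H n) \<alpha>)"
  shows "Q \<alpha> = Re (qform N (polar_entry Q) \<alpha>)"
proof -
  have "(\<lambda>n. polar_entry (q n) k j) \<longlonglongrightarrow> polar_entry Q k j" for k j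
    unfolding polar_entry_def by (intro tendsto_Complex tendsto_diff lim)
  then have "(\<lambda>n. Re (qform N (polar_entry (q n)) \<alpha>)) \<longlonglongrightarrow> Re (qform N (polar_entry Q) \<alpha>)"
    unfolding qform_def by (intro tendsto_intros)
  moreover have "Re (qform N (polar_entry (q n)) \<alpha>) = q n \<alpha>" for n
    by (rule qform_polar_entry[symmetric]) (rule q)
  ultimately have "(\<lambda>n. q n \<alpha>) \<longlonglongrightarrow> Re (qform N (polar_entry Q) \<alpha>)" by simp
  from LIMSEQ_unique[OF lim this] show ?thesis .
qed

lemma hermitian_matI:
  assumes A: "A \<in> carrier_mat N N" and sym: "\<And>k j. k < N \<Longrightarrow> j < N \<Longrightarrow> A $$ (k, j) = cnj (A $$ (j, k))"
  shows "hermitian_mat A"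
proof -
  have "mat_adjoint A = A"
  proof (rule eq_matI)
    fix k j assume "k < dim_row A" "j < dim_col A"
    then show "mat_adjoint A $$ (k, j) = A $$ (k, j)"
      using A sym[of k j] by (simp add: mat_adjoint_def mat_of_rows_def)
  qed (use A in \<open>auto simp: mat_adjoint_def\<close>)
  then show ?thesis by (simp add: hermitian_mat_def)
qed

lemma psd_matI:
  assumes A: "A \<in> carrier_mat N N" and sym: "\<And>k j. k < N \<Longrightarrow> j < N \<Longrightarrow> A $$ (k, j) = cnj (A $$ (j, k))"
    and pos: "\<And>\<alpha>. 0 \<le> Re (qform N (\<lambda>k j. A $$ (k, j)) \<alpha>)"
  shows "psd_mat N A"
  unfolding psd_mat_def
proof (intro conjI ballI A hermitian_matI[OF A sym])
  fix v :: "complex Matrix.vec" assume v: "v \<in> carrier_vec N"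
  have eq: "(A *\<^sub>v v) \<bullet>c v = qform N (\<lambda>k j. A $$ (k, j)) (\<lambda>k. cnj (vec_index v k))"
    using A v by (auto simp: qform_def scalar_prod_def sum_distrib_left sum_distrib_right atLeast0LessThan mult_ac intro!: sum.cong)
  have "cnj (qform N (\<lambda>k j. A $$ (k, j)) (\<lambda>k. cnj (vec_index v k))) = qform N (\<lambda>k j. A $$ (k, j)) (\<lambda>k. cnj (vec_index v k))"
    unfolding cnj_qform unfolding qform_def by (intro sum.cong refl) (simp add: sym[symmetric])
  then have "Im (qform N (\<lambda>k j. A $$ (k, j)) (\<lambda>k. cnj (vec_index v k))) = 0" by (simp add: complex_eq_iff)
  then show "0 \<le> (A *\<^sub>v v) \<bullet>c v" unfolding eq using pos by (simp add: less_eq_complex_def)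
qed

section \<open>Distribution functions\<close>

text \<open>The ray is exhausted by the intervals [b - n, b), whose measures are increments of
  g.\<close>

lemma emeasure_stieltjes_measure_lessThan:
  assumes g: "mono g" "\<And>t. continuous (at_left t) g" and lim: "(g \<longlongrightarrow> 0) at_bot"
  shows "emeasure (stieltjes_measure g) {..<b} = ennreal (g b)"
proof -
  let ?A = "\<lambda>n. {b - real n..<b}"
  have "(\<lambda>n. emeasure (stieltjes_measure g) (?A n)) \<longlonglongrightarrow> emeasure (stieltjes_measure g) (\<Union>n. ?A n)"
    by (rule Lim_emeasure_incseq) (auto simp: incseq_def)
  moreover have "(\<Union>n. ?A n) = {..<b}"
  proof safe
    fix t assume "t < b"
    obtain n :: nat where "b - t \<le> n" using real_arch_simple by blast
    then show "t \<in> (\<Union>n. ?A n)" using \<open>t < b\<close> by (intro UN_I[of n]) auto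
  qed auto
  ultimately have 1: "(\<lambda>n. ennreal (g b - g (b - real n))) \<longlonglongrightarrow> emeasure (stieltjes_measure g) {..<b}"
    using emeasure_stieltjes_measure[OF g] by simp
  have "filterlim (\<lambda>n. b - real n) at_bot sequentially" by real_asymp
  from filterlim_compose[OF lim this] have "(\<lambda>n. ennreal (g b - g (b - real n))) \<longlonglongrightarrow> ennreal (g b - 0)"
    by (intro tendsto_intros)
  from LIMSEQ_unique[OF 1 this] show ?thesis by simp
qed

lemma mono_at_bot_nonneg:
  fixes g :: "real \<Rightarrow> real"
  assumes "mono g" "(g \<longlongrightarrow> 0) at_bot"
  shows "0 \<le> g b"
proof (rule tendsto_upperbound[OF assms(2)])
  show "\<forall>\<^sub>F t in at_bot. g t \<le> g b"
    unfolding eventually_at_bot_linorder using assms(1) by (auto simp: mono_def)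
qed simp

lemma finite_borel_measure_stieltjes:
  assumes g: "mono g" "\<And>t. continuous (at_left t) g" and lim: "(g \<longlongrightarrow> 0) at_bot" and C: "\<And>n. g (real n) \<le> C"
  shows "finite_borel_measure (stieltjes_measure g)" "measure (stieltjes_measure g) {..<b} = g b"
proof -
  have "(\<lambda>n. emeasure (stieltjes_measure g) {..<real n}) \<longlonglongrightarrow> emeasure (stieltjes_measure g) (\<Union>n. {..<real n})"
    by (rule Lim_emeasure_incseq) (auto simp: incseq_def)
  moreover have "(\<Union>n. {..<real n}) = UNIV" using reals_Archimedean2 by auto
  ultimately have "(\<lambda>n. ennreal (g (real n))) \<longlonglongrightarrow> emeasure (stieltjes_measure g) UNIV"
    by (simp add: emeasure_stieltjes_measure_lessThan[OF g lim])
  then have "emeasure (stieltjes_measure g) UNIV \<le> ennreal C"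
    by (rule LIMSEQ_le_const2) (auto intro!: ennreal_leI C)
  then have "emeasure (stieltjes_measure g) UNIV \<noteq> \<infinity>"
    by (metis ennreal_neq_top infinity_ennreal_def neq_top_trans)
  then have "finite_measure (stieltjes_measure g)"
    by (intro finite_measureI) simp
  then show "finite_borel_measure (stieltjes_measure g)"
    unfolding finite_borel_measure_def finite_borel_measure_axioms_def by simp
  show "measure (stieltjes_measure g) {..<b} = g b"
    unfolding measure_def emeasure_stieltjes_measure_lessThan[OF g lim]
    by (rule enn2real_ennreal) (rule mono_at_bot_nonneg[OF g(1) lim])
qed

context finite_borel_measure
begin

text \<open>Open rays give the left-continuous distribution function that the moment problem asks
  for; it is the left limit of the usual right-continuous one. For the last claim, open left rays
  generate the Borel sets and are closed under intersection.\<close>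

lemma lessThan_distribution:
  defines "g \<equiv> \<lambda>t. measure M {..<t}"
  shows "mono g" "\<And>t. continuous (at_left t) g" "(g \<longlongrightarrow> 0) at_bot" "stieltjes_measure g = M"
proof -
  have g: "(cdf M \<longlongrightarrow> g t) (at_left t)" for t unfolding g_def by (rule cdf_at_left)
  have le: "g t \<le> cdf M t" "s < t \<Longrightarrow> cdf M s \<le> g t" for s t
    unfolding g_def cdf_def by (auto intro!: finite_measure_mono)
  show mono: "mono g" unfolding g_def by (intro monoI finite_measure_mono) auto
  show cont: "continuous (at_left t) g" for t
  proof -
    have "(g \<longlongrightarrow> g t) (at_left t)"
    proof (rule tendstoI)
      fix e :: real assume e: "e > 0"
      from tendstoD[OF g e] obtain b where b: "b < t" "\<And>s. b < s \<Longrightarrow> s < t \<Longrightarrow> dist (cdf M s) (g t) < e"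
        by (auto simp: eventually_at_left_field)
      have "dist (g s) (g t) < e" if s: "(b + t) / 2 < s" "s < t" for s
      proof -
        have bt: "b < (b + t) / 2" "(b + t) / 2 < t" using b(1) by auto
        have "cdf M ((b + t) / 2) \<le> g s" using s by (intro le)
        moreover have "g s \<le> g t" using s by (intro monoD[OF mono]) simp
        ultimately show ?thesis using b(2)[OF bt] by (auto simp: dist_real_def abs_if split: if_splits)
      qed
      then show "\<forall>\<^sub>F s in at_left t. dist (g s) (g t) < e"
        unfolding eventually_at_left_field using b(1) by (intro exI[of _ "(b + t) / 2"]) auto
    qed
    then show ?thesis by (simp add: continuous_within)
  qed
  show lim: "(g \<longlongrightarrow> 0) at_bot"
    by (rule tendsto_sandwich[OF _ _ tendsto_const cdf_lim_at_bot]) (auto simp: g_def cdf_def intro!: always_eventually finite_measure_mono)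
  have bdd: "g (real n) \<le> measure M UNIV" for n unfolding g_def by (intro finite_measure_mono) (auto simp: borel_UNIV)
  note sm = finite_borel_measure_stieltjes[OF mono cont lim bdd]
  interpret S: finite_borel_measure "stieltjes_measure g" by (rule sm)
  show "stieltjes_measure g = M"
  proof (rule measure_eqI_generator_eq[where E="range lessThan" and \<Omega>=UNIV and A="\<lambda>n. {..<real n}"])
    show "Int_stable (range lessThan :: real set set)"
    proof (rule Int_stableI)
      fix a b :: "real set" assume "a \<in> range lessThan" "b \<in> range lessThan"
      then obtain s t where "a = {..<s}" "b = {..<t}" by blast
      then have "a \<inter> b = {..<min s t}" by auto
      then show "a \<inter> b \<in> range lessThan" by simp
    qed
    show "X \<in> range lessThan \<Longrightarrow> emeasure (stieltjes_measure g) X = emeasure M X" for X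
    proof -
      assume "X \<in> range lessThan"
      then obtain b where b: "X = {..<b}" by blast
      show ?thesis unfolding b S.emeasure_eq_measure emeasure_eq_measure sm(2) unfolding g_def ..
    qed
    show "sets (stieltjes_measure g) = sigma_sets UNIV (range lessThan)" "sets M = sigma_sets UNIV (range lessThan)"
      using M_is_borel by (simp_all add: borel_Iio)
    show "(\<Union>n. {..<real n}) = UNIV" using reals_Archimedean2 by auto
    show "emeasure (stieltjes_measure g) {..<real n} \<noteq> \<infinity>" for n by (simp add: S.emeasure_eq_measure)
  qed auto
qed

end

section \<open>The resolvents of the parameters\<close>

lemma clin_rel_lincomb:
  assumes rel: "clin_rel G" and ab: "\<And>k. k < p \<Longrightarrow> (a k, b k) \<in> G"
  shows "(lincomb a p \<alpha>, lincomb b p \<alpha>) \<in> G"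
  using ab
proof (induction p)
  case 0
  then show ?case using rel by (simp add: lincomb_def clin_rel_def)
next
  case (Suc p)
  have "(1 *\<^sub>C lincomb a p \<alpha> + \<alpha> p *\<^sub>C a p, 1 *\<^sub>C lincomb b p \<alpha> + \<alpha> p *\<^sub>C b p) \<in> G"
    using Suc by (intro clin_relD[OF rel]) auto
  then show ?case by (simp add: lincomb_def)
qed

context hamburger_data
begin

abbreviation "B \<equiv> closure (shift_operator N x)"

lemma shift_operator_eq: "shift_operator N x = comb_graph x (\<lambda>k. x (k + N))"
  by (auto simp: shift_operator_def comb_graph_def lincomb_def)

lemma gram_shift: "cinner (x (n + N)) (x m) = cinner (x n) (x (m + N))"
  using N by (simp add: gram hankel_entry_def)

lemma shift_symmetric:
  assumes "p \<in> comb_graph x (\<lambda>k. x (k + N))" "q \<in> comb_graph x (\<lambda>k. x (k + N))"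
  shows "cinner (snd p) (fst q) = cinner (fst p) (snd q)"
  using assms by (auto simp: comb_graph_def cinner_lincomb gram_shift)

sublocale closed_symmetric_relation B
proof
  show "clin_rel B" unfolding shift_operator_eq by (rule clin_rel_closure[OF clin_rel_comb_graph])
  show "closed B" by simp
  fix f g f' g' assume fg: "(f, g) \<in> B" "(f', g') \<in> B"
  \<comment> \<open>Symmetry passes to the closure in one argument at a time.\<close>
  have 1: "cinner (snd p) (fst q) = cinner (fst p) (snd q)"
    if "p \<in> comb_graph x (\<lambda>k. x (k + N))" "q \<in> B" for p q
    by (rule closed_relation_closure[where P="\<lambda>q. cinner (snd p) (fst q) = cinner (fst p) (snd q)", OF shift_symmetric[OF that(1)]])
      (use that(2) in \<open>auto simp: shift_operator_eq intro!: closed_Collect_eq continuous_intros\<close>)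
  have "cinner (snd (f, g)) (fst (f', g')) = cinner (fst (f, g)) (snd (f', g'))"
    by (rule closed_relation_closure[where P="\<lambda>p. cinner (snd p) (fst (f', g')) = cinner (fst p) (snd (f', g'))", OF 1[OF _ fg(2)]])
      (use fg(1) in \<open>auto simp: shift_operator_eq intro!: closed_Collect_eq continuous_intros\<close>)
  then show "cinner g f' = cinner f g'" by simp
qed

lemma shift_mem: "(x n, x (n + N)) \<in> B"
proof -
  have "(x n, x (n + N)) \<in> comb_graph x (\<lambda>k. x (k + N))"
    using comb_graphI[of x "Suc n" "\<lambda>k. if k = n then 1 else 0" "\<lambda>k. x (k + N)"] unfolding lincomb_single .
  then show ?thesis unfolding shift_operator_eq using closure_subset by blast
qed

lemma parameters_eq: "parameters N x = contractive_analytic (defect \<i> B) (defect (- \<i>) B)"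
  by (simp add: parameters_def)

lemma corresponds_iff:
  assumes R: "\<And>z. z \<in> upper_half_plane \<Longrightarrow> resolvent (quasi_sa_ext B (F z)) z = {(u, R z u) | u. True}"
  shows "corresponds N x F M \<longleftrightarrow> (\<forall>z\<in>upper_half_plane. \<forall>k<N. \<forall>j<N.
    has_stieltjes_integral (\<lambda>t. 1 / (of_real t - z)) (\<lambda>t. M t $$ (k, j)) (cinner (R z (x k)) (x j)))"
proof -
  have "single_valued {(u, R z u) | u. True}" "x k \<in> Domain {(u, R z u) | u. True}"
    "graph_apply {(u, R z u) | u. True} (x k) = R z (x k)" for z k
    by (auto simp: single_valued_def graph_apply_def)
  then show ?thesis
    unfolding corresponds_def Let_def by (intro ball_cong refl) (simp add: R)
qed

text \<open>The relations \<open>R (x (n + N)) = x n + z R (x n)\<close> and their adjoints reduce all matrix elements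
  of \<open>R\<close> to those with indices below \<open>N\<close>.\<close>

lemma resolvent_eqI:
  assumes "extends_cayley T" "cayley_pair z T R" "extends_cayley T'" "cayley_pair z T' R'" and z: "z \<in> upper_half_plane"
    and eq: "\<And>k j. k < N \<Longrightarrow> j < N \<Longrightarrow> cinner (R (x k)) (x j) = cinner (R' (x k)) (x j)"
  shows "R = R'"
proof
  fix u
  have rec: "cinner (R (x (n + N))) (x m) = cinner (x n) (x m) + z * cinner (R (x n)) (x m)"
    "cinner (R u) (x (m + N)) = z * cinner (R u) (x m) + cinner u (x m)"
    if T: "extends_cayley T" "cayley_pair z T R" for T R n m u
  proof -
    have "R (x (n + N)) = x n + z *\<^sub>C R (x n)"
      using cayley_pair_resolvent(1)[OF T shift_mem] cayley_pairD(3)[OF T(2)]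
      by (simp add: clin_diff clin_scaleC) (metis add.commute diff_eq_eq)
    then show "cinner (R (x (n + N))) (x m) = cinner (x n) (x m) + z * cinner (R (x n)) (x m)"
      by (simp add: cinner_simps)
    show "cinner (R u) (x (m + N)) = z * cinner (R u) (x m) + cinner u (x m)"
      using cayley_pair_resolvent(2)[OF T shift_mem, of u m] by (simp add: cinner_simps algebra_simps)
  qed
  have all: "cinner (R (x n)) (x m) = cinner (R' (x n)) (x m)" for n m
  proof (induction "n + m" arbitrary: n m rule: less_induct)
    case less
    show ?case
    proof (cases "n < N")
      case False
      define n' where "n' = n - N"
      have n: "n = n' + N" using False by (simp add: n'_def)
      have "cinner (R (x n')) (x m) = cinner (R' (x n')) (x m)" using N n by (intro less) auto
      then show ?thesis unfolding n rec(1)[OF assms(1,2)] rec(1)[OF assms(3,4)] by simp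
    next
      case nN: True
      show ?thesis
      proof (cases "m < N")
        case False
        define m' where "m' = m - N"
        have m: "m = m' + N" using False by (simp add: m'_def)
        have "cinner (R (x n)) (x m') = cinner (R' (x n)) (x m')" using N m by (intro less) auto
        then show ?thesis unfolding m rec(2)[OF assms(1,2)] rec(2)[OF assms(3,4)] by simp
      qed (use nN eq in auto)
    qed
  qed
  have y: "Im z > 0" using z by (simp add: upper_half_plane_def)
  show "R u = R' u"
    by (rule bdd_clin_eq[OF cayley_pairD(3)[OF assms(2)] _ cayley_pairD(3)[OF assms(4)] _ all])
       (rule dissipative_bound[OF cayley_pair_dissipative[OF assms(2)] y],
        rule dissipative_bound[OF cayley_pair_dissipative[OF assms(4)] y])
qed

end

section \<open>From parameters to solutions\<close>

text \<open>R v = u + z R u is used in the first slot of (R v, v), and the adjoint relation (R u, v)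
  = (u, u) + z (R u, u) in the second.\<close>

lemma resolvent_relations:
  assumes "closed_symmetric_relation B" "closed_symmetric_relation.extends_cayley B T" "cayley_pair z T R" "(u, v) \<in> B"
  shows "cinner (R v) v = cinner u v + z * cinner u u + z\<^sup>2 * cinner (R u) u"
proof -
  interpret closed_symmetric_relation B by (rule assms(1))
  have lin: "clin R" by (rule cayley_pairD(3)[OF assms(3)])
  have "R v - z *\<^sub>C R u = u"
    using cayley_pair_resolvent(1)[OF assms(2,3,4)] by (simp add: clin_diff[OF lin] clin_scaleC[OF lin])
  then have 1: "R v = u + z *\<^sub>C R u" by (metis add.commute diff_add_cancel)
  have "cinner (R u) v = cinner u u + z * cinner (R u) u"
    using cayley_pair_resolvent(2)[OF assms(2,3,4), of u] by (simp add: cinner_simps algebra_simps)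
  then show ?thesis unfolding 1 by (simp add: cinner_simps power2_eq_square algebra_simps)
qed

context hamburger_data
begin

lemma qform_lincomb: "cinner (R (lincomb x N \<alpha>)) (lincomb x N \<alpha>) = qform N (\<lambda>k j. cinner (R (x k)) (x j)) \<alpha>"
  if "clin R"
proof -
  have "R (lincomb x N \<alpha>) = lincomb (\<lambda>k. R (x k)) N \<alpha>"
    by (simp add: lincomb_def clin_sum[OF that] clin_scaleC[OF that])
  then show ?thesis by (simp add: cinner_lincomb qform_def)
qed

lemma hermitian_qform_moment: "Im (qform N (\<lambda>k j. S m $$ (k, j)) \<alpha>) = 0"
proof -
  have "cnj (qform N (\<lambda>k j. S m $$ (k, j)) \<alpha>) = qform N (\<lambda>k j. S m $$ (k, j)) \<alpha>"
    unfolding cnj_qform unfolding qform_def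
    by (intro sum.cong refl) (simp add: hermitian_mat_index[OF S herm, symmetric])
  then show ?thesis by (simp add: complex_eq_iff)
qed

text \<open>Let V n be A^n applied to the combination of x_0, ..., x_(N-1). The functions (R(z) V n,
  V n) obey a recursion in n whose coefficients are the moments 2n and 2n + 1, and |R(z)| <= 1 / Im
  z gives them the decay |V n|^2 / Im z.\<close>

lemma resolvent_measure:
  assumes T: "\<And>z. z \<in> upper_half_plane \<Longrightarrow> extends_cayley (T z)"
    and R: "\<And>z. z \<in> upper_half_plane \<Longrightarrow> cayley_pair z (T z) (R z)"
    and der: "\<And>z. z \<in> upper_half_plane \<Longrightarrow> \<exists>G. has_op_derivative R G z"
  shows "\<exists>\<mu>. finite_borel_measure \<mu> \<and>
    (\<forall>z\<in>upper_half_plane. (LINT t|\<mu>. 1 / (of_real t - z)) = qform N (\<lambda>k j. cinner (R z (x k)) (x j)) \<alpha>) \<and>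
    (\<forall>m. integrable \<mu> (\<lambda>t. t ^ m) \<and> of_real (LINT t|\<mu>. t ^ m) = qform N (\<lambda>k j. S m $$ (k, j)) \<alpha>)"
proof -
  define V where "V n = lincomb (\<lambda>k. x (k + n * N)) N \<alpha>" for n
  have VB: "(V n, V (Suc n)) \<in> B" for n
  proof -
    have "(x (k + n * N), x (k + Suc n * N)) \<in> B" for k
      using shift_mem[of "k + n * N"] by (simp add: ac_simps)
    then show ?thesis unfolding V_def by (intro clin_rel_lincomb[OF rel])
  qed
  have VV: "cinner (V p) (V q) = qform N (\<lambda>k j. S (p + q) $$ (k, j)) \<alpha>" for p q
    unfolding V_def cinner_lincomb qform_def using N
    by (intro sum.cong refl) (simp add: gram hankel_entry_def)
  define f where "f n z = cinner (R z (V n)) (V n)" for n z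
  define a where "a n = Re (cinner (V n) (V (Suc n)))" for n
  define c where "c n = (norm (V n))\<^sup>2" for n
  \<comment> \<open>Real, because the moment matrices are Hermitian.\<close>
  have a: "cinner (V n) (V (Suc n)) = of_real (a n)" for n
    unfolding a_def VV using hermitian_qform_moment[of "n + Suc n" \<alpha>] by (simp add: complex_eq_iff)
  have c: "cinner (V n) (V n) = of_real (c n)" for n unfolding c_def by (rule cinner_self)
  have uhp: "z \<in> upper_half_plane" if "Im z > 0" for z using that by (simp add: upper_half_plane_def)
  have rec: "f (Suc n) z = of_real (a n) + z * of_real (c n) + z\<^sup>2 * f n z" if z: "Im z > 0" for n z
    using resolvent_relations[OF closed_symmetric_relation_axioms T[OF uhp[OF z]] R[OF uhp[OF z]] VB[of n]]
    unfolding f_def a c .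
  have bd: "cmod (f n z) \<le> c n / Im z" if z: "Im z > 0" for n z
  proof -
    have "cmod (f n z) \<le> norm (R z (V n)) * norm (V n)" unfolding f_def by (rule cinner_Cauchy_Schwarz)
    also have "\<dots> \<le> ((1 / Im z) * norm (V n)) * norm (V n)"
      by (intro mult_right_mono dissipative_bound[OF cayley_pair_dissipative[OF R[OF uhp[OF z]]] z]) simp
    finally show ?thesis by (simp add: c_def power2_eq_square)
  qed
  have f0: "f 0 z = qform N (\<lambda>k j. cinner (R z (x k)) (x j)) \<alpha>" if "Im z > 0" for z
    unfolding f_def V_def using qform_lincomb[OF cayley_pairD(3)[OF R[OF uhp[OF that]]], of \<alpha>] by simp
  have "\<exists>\<mu>. finite_borel_measure \<mu> \<and> (\<forall>z. Im z > 0 \<longrightarrow> f 0 z = (LINT t|\<mu>. 1 / (of_real t - z)))"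
  proof (cases "V 0 = 0")
    \<comment> \<open>Normalization by the total mass is impossible here; the zero measure
      serves.\<close>
    case True
    have "finite_borel_measure (density lborel (\<lambda>t. ennreal 0))"
      by (rule finite_borel_measure_density(1)) auto
    moreover have "(LINT t|density lborel (\<lambda>t. ennreal 0). 1 / (complex_of_real t - z)) = 0" for z
      by (subst integral_density) auto
    ultimately show ?thesis using True by (intro exI[of _ "density lborel (\<lambda>t. ennreal 0)"]) (simp add: f_def)
  next
    case False
    show ?thesis
    proof (rule nevanlinna_representation[where ?s0.0="c 0" and ?s1.0="a 0" and g="f 1" and K="c 1"])
      show "f 0 holomorphic_on {z. Im z > 0}"
      proof (rule holomorphic_onI)
        fix z assume "z \<in> {z. Im z > 0}"
        then have z: "z \<in> upper_half_plane" by (simp add: upper_half_plane_def)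
        then obtain G where "has_op_derivative R G z" using der by blast
        from has_op_derivative_cinner[OF this, of "V 0" "V 0"] have "f 0 field_differentiable at z"
          unfolding f_def[abs_def] field_differentiable_def by blast
        then show "f 0 field_differentiable at z within {z. Im z > 0}"
          by (rule field_differentiable_at_within)
      qed
      show "Im (f 0 z) \<ge> 0" if "Im z > 0" for z
        using cayley_pair_dissipative[OF R[OF uhp[OF that]], of "V 0"] that unfolding f_def
        by (meson less_imp_le mult_nonneg_nonneg order_trans zero_le_power2)
      show "f 0 z = - of_real (c 0) / z - of_real (a 0) / z\<^sup>2 + f 1 z / z\<^sup>2" if "Im z > 0" for z
      proof -
        have "z \<noteq> 0" using that by auto
        then show ?thesis using rec[OF that, of 0] by (simp add: field_simps power2_eq_square)
      qed
      show "cmod (f 1 z) \<le> c 1 / Im z" if "Im z > 0" for z by (rule bd[OF that])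
      show "c 0 > 0" using False by (simp add: c_def)
    qed
  qed
  then obtain \<mu> where \<mu>: "finite_borel_measure \<mu>" "\<And>z. Im z > 0 \<Longrightarrow> f 0 z = (LINT t|\<mu>. 1 / (of_real t - z))"
    by blast
  interpret \<mu>: finite_borel_measure \<mu> by (rule \<mu>(1))
  have K: "cmod (f (Suc n) (\<i> * of_real y)) \<le> c (Suc n) / y" if "y > 0" for n y
    using bd[of "\<i> * of_real y" "Suc n"] that by simp
  note mom = \<mu>.moments[where f=f and a=a and c=c and K="\<lambda>n. c (Suc n)", OF \<mu>(2) rec K]
  have "integrable \<mu> (\<lambda>t. t ^ m) \<and> of_real (LINT t|\<mu>. t ^ m) = qform N (\<lambda>k j. S m $$ (k, j)) \<alpha>" for m
  proof (cases "even m")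
    case True
    then obtain n where n: "m = 2 * n" by (elim evenE)
    have "integrable \<mu> (\<lambda>t. t ^ (2 * n))" "(LINT t|\<mu>. t ^ (2 * n)) = c n"
      by (rule mom(1), assumption+, rule mom(2), assumption+)
    then show ?thesis unfolding n using c[of n, symmetric] by (simp add: VV mult_2)
  next
    case False
    then obtain n where n: "m = 2 * n + 1" by (elim oddE)
    have "integrable \<mu> (\<lambda>t. t ^ (2 * n + 1))" "(LINT t|\<mu>. t ^ (2 * n + 1)) = a n"
      by (rule mom(3), assumption+, rule mom(4), assumption+)
    moreover have "n + Suc n = 2 * n + 1" by simp
    ultimately show ?thesis unfolding n using a[of n, symmetric] by (simp only: VV)
  qed
  moreover have "(LINT t|\<mu>. 1 / (of_real t - z)) = qform N (\<lambda>k j. cinner (R z (x k)) (x j)) \<alpha>" if "z \<in> upper_half_plane" for z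
    using \<mu>(2)[of z] f0[of z] that by (simp add: upper_half_plane_def)
  ultimately show ?thesis using \<mu>(1) by blast
qed

text \<open>The measures \<mu> \<alpha> are chosen separately for each \<alpha>. \<open>Gq\<close>
  shows that their distribution functions form a quadratic form in \<alpha>; then polarization
  defines M, and monotonicity in t is positivity of its increments.\<close>

lemma solution_of_parameter:
  assumes F: "F \<in> parameters N x"
  shows "\<exists>M. hamburger_solution N S M \<and> corresponds N x F M"
proof -
  obtain T R where T: "\<And>z. z \<in> upper_half_plane \<Longrightarrow> extends_cayley (T z)"
    and R: "\<And>z. z \<in> upper_half_plane \<Longrightarrow> cayley_pair z (T z) (R z)"
    and res: "\<And>z. z \<in> upper_half_plane \<Longrightarrow> resolvent (quasi_sa_ext B (F z)) z = {(u, R z u) | u. True}"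
    and der: "\<And>z. z \<in> upper_half_plane \<Longrightarrow> \<exists>G. has_op_derivative R G z"
    using resolvent_family[OF F[unfolded parameters_eq]] by blast
  define b where "b z k j = cinner (R z (x k)) (x j)" for z k j
  have "\<forall>\<alpha>. \<exists>\<mu>. finite_borel_measure \<mu> \<and>
    (\<forall>z\<in>upper_half_plane. (LINT t|\<mu>. 1 / (of_real t - z)) = qform N (b z) \<alpha>) \<and>
    (\<forall>m. integrable \<mu> (\<lambda>t. t ^ m) \<and> of_real (LINT t|\<mu>. t ^ m) = qform N (\<lambda>k j. S m $$ (k, j)) \<alpha>)"
    unfolding b_def by (intro allI resolvent_measure[OF T R der])
  then obtain \<mu> where \<mu>: "\<And>\<alpha>. finite_borel_measure (\<mu> \<alpha>)"
    "\<And>\<alpha> z. z \<in> upper_half_plane \<Longrightarrow> (LINT t|\<mu> \<alpha>. 1 / (of_real t - z)) = qform N (b z) \<alpha>"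
    "\<And>\<alpha> m. integrable (\<mu> \<alpha>) (\<lambda>t. t ^ m)"
    "\<And>\<alpha> m. of_real (LINT t|\<mu> \<alpha>. t ^ m) = qform N (\<lambda>k j. S m $$ (k, j)) \<alpha>"
    by metis
  define G where "G \<alpha> t = measure (\<mu> \<alpha>) {..<t}" for \<alpha> t
  note G = finite_borel_measure.lessThan_distribution[OF \<mu>(1), folded G_def]
  have Gq: "G \<alpha> t = Re (qform N (polar_entry (\<lambda>\<alpha>. G \<alpha> t)) \<alpha>)" for \<alpha> t
  proof -
    let ?I = "\<lambda>n. {- real (Suc n)..t - 1 / real (Suc n)}"
    let ?z = "\<lambda>n s. Complex s (1 / (real (Suc n))\<^sup>2)"
    have z: "?z n s \<in> upper_half_plane" for n s by (simp add: upper_half_plane_def)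
    \<comment> \<open>Since Re (-\<i> w) = Im w, this factor turns the imaginary part of the
      inversion formula into the real part of a quadratic form.\<close>
    define H where "H n k j = - \<i> * of_real (1 / pi) * integral (?I n) (\<lambda>s. b (?z n s) k j)" for n k j
    define q where "q n \<alpha> = (1 / pi) * integral (?I n) (\<lambda>s. Im (LINT u|\<mu> \<alpha>. 1 / (complex_of_real u - ?z n s)))" for n \<alpha>
    show ?thesis
    proof (rule qform_real_limit)
      fix \<alpha>
      have "(\<lambda>n. q n \<alpha>) \<longlonglongrightarrow> (1 / pi) * (pi * G \<alpha> t)"
        unfolding q_def G_def by (intro tendsto_mult_left finite_borel_measure.stieltjes_inversion[OF \<mu>(1)])
      then show "(\<lambda>n. q n \<alpha>) \<longlonglongrightarrow> G \<alpha> t" by simp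
    next
      fix n \<alpha>
      have bint: "((\<lambda>s. b (?z n s) k j) has_integral integral (?I n) (\<lambda>s. b (?z n s) k j)) (?I n)" for k j
      proof (rule integrable_integral, rule integrable_continuous_interval)
        have "isCont (\<lambda>z. b z k j) z" if zU: "z \<in> upper_half_plane" for z
        proof -
          obtain D where "has_op_derivative R D z" using der[OF zU] by blast
          from DERIV_isCont[OF has_op_derivative_cinner[OF this]] show ?thesis unfolding b_def .
        qed
        then have "continuous_on upper_half_plane (\<lambda>z. b z k j)" by (intro continuous_at_imp_continuous_on) auto
        moreover have "continuous_on (?I n) (?z n)" unfolding Complex_eq by (intro continuous_intros)
        ultimately show "continuous_on (?I n) (\<lambda>s. b (?z n s) k j)"
          by (rule continuous_on_compose2) (use z in auto)
      qed
      have "((\<lambda>s. qform N (b (?z n s)) \<alpha>) has_integral qform N (\<lambda>k j. integral (?I n) (\<lambda>s. b (?z n s) k j)) \<alpha>) (?I n)"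
        unfolding qform_def by (intro has_integral_sum finite_lessThan has_integral_mult_right bint)
      from has_integral_linear[OF this bounded_linear_Im]
      have "integral (?I n) (\<lambda>s. Im (qform N (b (?z n s)) \<alpha>)) = Im (qform N (\<lambda>k j. integral (?I n) (\<lambda>s. b (?z n s) k j)) \<alpha>)"
        unfolding o_def by (rule integral_unique)
      then have "q n \<alpha> = (1 / pi) * Im (qform N (\<lambda>k j. integral (?I n) (\<lambda>s. b (?z n s) k j)) \<alpha>)"
        unfolding q_def \<mu>(2)[OF z] by simp
      also have "\<dots> = Re (- \<i> * of_real (1 / pi) * qform N (\<lambda>k j. integral (?I n) (\<lambda>s. b (?z n s) k j)) \<alpha>)" by simp
      also have "- \<i> * of_real (1 / pi) * qform N (\<lambda>k j. integral (?I n) (\<lambda>s. b (?z n s) k j)) \<alpha> = qform N (H n) \<alpha>"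
        unfolding qform_def H_def sum_distrib_left by (intro sum.cong refl) (simp add: mult_ac)
      finally show "q n \<alpha> = Re (qform N (H n) \<alpha>)" .
    qed
  qed
  define P where "P t = polar_entry (\<lambda>\<alpha>. G \<alpha> t)" for t
  define M where "M t = mat N N (\<lambda>(k, j). P t k j)" for t
  have M: "M t \<in> carrier_mat N N" for t by (simp add: M_def)
  have M_index: "M t $$ (k, j) = P t k j" if "k < N" "j < N" for t k j using that by (simp add: M_def)
  have P_sym: "P t k j = cnj (P t j k)" if kj: "k < N" "j < N" for t k j
  proof -
    have "P t k j = (P t k j + cnj (P t j k)) / 2"
      unfolding P_def by (rule polar_entry_Re_qform[OF kj]) (rule Gq)
    then show ?thesis by (simp add: field_simps)
  qed
  have M_sym: "M t $$ (k, j) = cnj (M t $$ (j, k))" if "k < N" "j < N" for t k j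
    using P_sym[OF that] that by (simp add: M_index)
  \<comment> \<open>The distribution functions at the four polar vectors are a Jordan decomposition
    of the entry; moments and transforms follow from the same statement.\<close>
  have integral: "has_stieltjes_integral f (\<lambda>t. M t $$ (k, j)) (H k j)"
    if kj: "k < N" "j < N" and f: "\<And>\<alpha>. integrable (\<mu> \<alpha>) f" "\<And>\<alpha>. (LINT t|\<mu> \<alpha>. f t) = qform N H \<alpha>" for f k j H
  proof -
    let ?v = "\<lambda>s. polar_vec s k j"
    have "\<forall>g\<in>{G (?v 1), G (?v (- 1)), G (?v \<i>), G (?v (- \<i>))}. mono g \<and> (\<forall>t. continuous (at_left t) g) \<and>
          integrable (stieltjes_measure g) f"
      using G f(1) by auto
    moreover have "\<forall>t. M t $$ (k, j) = Complex (G (?v 1) t - G (?v (- 1)) t) (G (?v \<i>) t - G (?v (- \<i>)) t)"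
      by (simp add: M_index[OF kj] P_def polar_entry_def)
    moreover have "H k j = ((LINT t|stieltjes_measure (G (?v 1)). f t) - (LINT t|stieltjes_measure (G (?v (- 1))). f t))
         + \<i> * ((LINT t|stieltjes_measure (G (?v \<i>)). f t) - (LINT t|stieltjes_measure (G (?v (- \<i>))). f t))"
      unfolding G(4) f(2) by (rule qform_polarization[OF kj, symmetric])
    ultimately show ?thesis unfolding has_stieltjes_integral_def by blast
  qed
  have "hamburger_solution N S M"
    unfolding hamburger_solution_def
  proof (intro conjI allI impI)
    show "M t \<in> carrier_mat N N" for t by (rule M)
    show "hermitian_mat (M t)" for t by (rule hermitian_matI[OF M M_sym])
    show "psd_mat N (M t - M s)" if "s \<le> t" for s t
    proof (rule psd_matI)
      show "M t - M s \<in> carrier_mat N N" by (rule minus_carrier_mat[OF M])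
      show "(M t - M s) $$ (k, j) = cnj ((M t - M s) $$ (j, k))" if "k < N" "j < N" for k j
        using M_sym[OF that] that M[of s] by simp
      fix \<alpha>
      have "qform N (\<lambda>k j. (M t - M s) $$ (k, j)) \<alpha> = qform N (P t) \<alpha> - qform N (P s) \<alpha>"
        unfolding qform_def sum_subtractf[symmetric]
        using M[of s] by (intro sum.cong refl) (simp add: M_index right_diff_distrib)
      then have "Re (qform N (\<lambda>k j. (M t - M s) $$ (k, j)) \<alpha>) = G \<alpha> t - G \<alpha> s"
        using Gq[of \<alpha> t] Gq[of \<alpha> s] by (simp add: P_def)
      then show "0 \<le> Re (qform N (\<lambda>k j. (M t - M s) $$ (k, j)) \<alpha>)"
        using monoD[OF G(1) that] by simp
    qed
    fix k j assume kj: "k < N" "j < N"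
    have GL: "(G \<alpha> \<longlongrightarrow> G \<alpha> t) (at_left t)" for \<alpha> t using G(2) by (simp add: continuous_within)
    show "continuous (at_left t) (\<lambda>s. M s $$ (k, j))" for t
      unfolding continuous_within M_index[OF kj] P_def polar_entry_def
      by (intro tendsto_Complex tendsto_diff GL)
    have "((\<lambda>t. M t $$ (k, j)) \<longlongrightarrow> Complex (0 - 0) (0 - 0)) at_bot"
      unfolding M_index[OF kj] P_def polar_entry_def by (intro tendsto_Complex tendsto_diff G(3))
    then show "((\<lambda>t. M t $$ (k, j)) \<longlongrightarrow> 0) at_bot" by (simp add: zero_complex.code)
    show "has_stieltjes_integral (\<lambda>t. of_real (t ^ m)) (\<lambda>t. M t $$ (k, j)) (S m $$ (k, j))" for m
    proof (rule integral[OF kj])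
      show "integrable (\<mu> \<alpha>) (\<lambda>t. complex_of_real (t ^ m))" for \<alpha> using \<mu>(3) by (rule integrable_of_real)
      show "(LINT t|\<mu> \<alpha>. complex_of_real (t ^ m)) = qform N (\<lambda>k j. S m $$ (k, j)) \<alpha>" for \<alpha>
        unfolding \<mu>(4)[symmetric] by (rule integral_complex_of_real)
    qed
  qed
  moreover have "corresponds N x F M"
  proof (rule corresponds_iff[THEN iffD2, OF res]; (intro ballI allI impI)?)
    fix z k j assume z: "z \<in> upper_half_plane" and kj: "k < N" "j < N"
    have "has_stieltjes_integral (\<lambda>t. 1 / (of_real t - z)) (\<lambda>t. M t $$ (k, j)) (b z k j)"
    proof (rule integral[OF kj])
      show "integrable (\<mu> \<alpha>) (\<lambda>t. 1 / (complex_of_real t - z))" for \<alpha>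
        using z by (intro finite_borel_measure.integrable_cauchy_kernel[OF \<mu>(1)]) (simp add: upper_half_plane_def)
      show "(LINT t|\<mu> \<alpha>. 1 / (complex_of_real t - z)) = qform N (b z) \<alpha>" for \<alpha> by (rule \<mu>(2)[OF z])
    qed
    then show "has_stieltjes_integral (\<lambda>t. 1 / (of_real t - z)) (\<lambda>t. M t $$ (k, j)) (cinner (R z (x k)) (x j))"
      by (simp add: b_def)
  qed
  ultimately show ?thesis by blast
qed

end

section \<open>From solutions to parameters\<close>

text \<open>|t - z| <= 1 + |c - z|, and 1 <= |c - z| / Im z.\<close>

lemma cauchy_kernel_domination:
  assumes z: "Im z > 0" and ct: "\<bar>t - c\<bar> \<le> 1"
  shows "cmod (1 / (complex_of_real c - z)) \<le> (1 + 1 / Im z) * cmod (1 / (complex_of_real t - z))"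
proof -
  have c: "Im z \<le> cmod (complex_of_real c - z)" using abs_Im_le_cmod[of "complex_of_real c - z"] by simp
  have t: "cmod (complex_of_real t - z) > 0" using z by (auto simp: complex_eq_iff)
  have "cmod (complex_of_real t - z) \<le> cmod (complex_of_real (t - c)) + cmod (complex_of_real c - z)"
    using norm_triangle_ineq[of "complex_of_real (t - c)" "complex_of_real c - z"] by simp
  also have "\<dots> \<le> 1 + cmod (complex_of_real c - z)" using ct by (simp only: norm_of_real)
  also have "\<dots> \<le> (1 + 1 / Im z) * cmod (complex_of_real c - z)"
    using c z by (simp add: field_simps)
  finally show ?thesis
    using t less_le_trans[OF z c] by (simp add: norm_divide field_simps)
qed

lemma transform_imp_rs:
  assumes "has_stieltjes_integral (\<lambda>t. 1 / (complex_of_real t - z)) m I" and z: "Im z > 0"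
  shows "(\<lambda>i. rs_sum i (\<lambda>t. 1 / (complex_of_real t - z)) m) \<longlonglongrightarrow> I"
  by (rule has_stieltjes_integral_imp_rs[OF assms(1)])
     (rule cauchy_kernel_continuous(2)[OF z] cauchy_kernel_domination[OF z], assumption?)+

lemma sum_telescope_int:
  fixes f :: "int \<Rightarrow> 'a::ab_group_add"
  assumes "a \<le> b"
  shows "(\<Sum>j\<in>{a..<b}. f (j + 1) - f j) = f b - f a"
  using assms
proof (induction b rule: int_ge_induct)
  case (step b)
  have "{a..<b + 1} = insert b {a..<b}" using step.hyps by auto
  then show ?case using step.IH by simp
qed simp

text \<open>The increments telescope. Convergence of these sums is what later bounds the total
  mass.\<close>

lemma rs_sum_const: "rs_sum i (\<lambda>_. 1) m = m (real (Suc i)) - m (- real (Suc i))"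
proof -
  let ?K = "int (Suc i) * int (Suc i)"
  have "rs_sum i (\<lambda>_. 1) m = m (of_int ?K / of_nat (Suc i)) - m (of_int (- ?K) / of_nat (Suc i))"
    unfolding rs_sum_def rs_cells_def rs_incr_def mult_1
    by (rule sum_telescope_int[where f="\<lambda>j. m (of_int j / of_nat (Suc i))"]) simp
  moreover have "of_int ?K / real (Suc i) = real (Suc i)" "of_int (- ?K) / real (Suc i) = - real (Suc i)"
    by (simp_all del: of_nat_Suc)
  ultimately show ?thesis by (simp only:)
qed

lemma rs_sum_qform:
  "rs_sum i f (\<lambda>t. qform N (H t) \<alpha>) = qform N (\<lambda>k j. rs_sum i f (\<lambda>t. H t k j)) \<alpha>"
proof -
  have d: "rs_incr i l (\<lambda>t. qform N (H t) \<alpha>) = qform N (\<lambda>k j. rs_incr i l (\<lambda>t. H t k j)) \<alpha>" for l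
    unfolding rs_incr_def qform_def sum_subtractf[symmetric] by (simp add: right_diff_distrib)
  have "rs_sum i f (\<lambda>t. qform N (H t) \<alpha>)
      = (\<Sum>l\<in>rs_cells i. \<Sum>k<N. \<Sum>j<N. \<alpha> k * cnj (\<alpha> j) * (f (rs_point i l) * rs_incr i l (\<lambda>t. H t k j)))"
    unfolding rs_sum_def d unfolding qform_def sum_distrib_left by (intro sum.cong refl) (simp add: mult_ac)
  also have "\<dots> = (\<Sum>k<N. \<Sum>j<N. \<Sum>l\<in>rs_cells i. \<alpha> k * cnj (\<alpha> j) * (f (rs_point i l) * rs_incr i l (\<lambda>t. H t k j)))"
    by (subst sum.swap) (intro sum.cong refl sum.swap)
  finally show ?thesis by (simp add: qform_def rs_sum_def sum_distrib_left)
qed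

lemma tendsto_qform:
  assumes "\<And>k j. k < N \<Longrightarrow> j < N \<Longrightarrow> ((\<lambda>t. H t k j) \<longlongrightarrow> L k j) F"
  shows "((\<lambda>t. qform N (H t) \<alpha>) \<longlongrightarrow> qform N L \<alpha>) F"
  unfolding qform_def using assms by (intro tendsto_intros) auto

section \<open>The resolvent family of a solution\<close>

context hamburger_solution_data
begin

text \<open>This is t / (t - z) = 1 + z / (t - z), multiplication by t being the index shift by
  N.\<close>

lemma resolvent_operator_shift:
  assumes z: "Im z > 0" and T: "clin T" "represents (\<lambda>t. 1 / (of_real t - z)) (\<lambda>n m. cinner (T (x n)) (x m))"
  shows "T (x (n + N)) - z *\<^sub>C T (x n) = x n"
proof -
  let ?\<phi> = "\<lambda>t. 1 / (complex_of_real t - z)"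
  have "cinner (T (x (n + N))) (x m) = z * cinner (T (x n)) (x m) + cinner (x n) (x m)" for m
  proof (rule LIMSEQ_unique)
    let ?r = "n div N + m div N" and ?m = "\<lambda>t. M t $$ (n mod N, m mod N)"
    have "(\<lambda>i. rs_sum i (\<lambda>t. ?\<phi> t * of_real (t ^ Suc ?r)) ?m) \<longlonglongrightarrow> cinner (T (x (n + N))) (x m)"
      using T(2)[unfolded represents_def, rule_format, of "n + N" m] N by simp
    moreover have "?\<phi> t * of_real (t ^ Suc ?r) = z * (?\<phi> t * of_real (t ^ ?r)) + 1 * (1 * of_real (t ^ ?r))" for t
    proof -
      have "complex_of_real t - z \<noteq> 0" using z by (auto simp: complex_eq_iff)
      then show ?thesis by (simp add: field_simps)
    qed
    ultimately show "(\<lambda>i. z * rs_sum i (\<lambda>t. ?\<phi> t * of_real (t ^ ?r)) ?m + 1 * rs_sum i (\<lambda>t. 1 * of_real (t ^ ?r)) ?m)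
        \<longlonglongrightarrow> cinner (T (x (n + N))) (x m)"
      by (simp only: rs_sum_linear)
    have "(\<lambda>i. z * rs_sum i (\<lambda>t. ?\<phi> t * of_real (t ^ ?r)) ?m + 1 * rs_sum i (\<lambda>t. 1 * of_real (t ^ ?r)) ?m)
        \<longlonglongrightarrow> z * cinner (T (x n)) (x m) + 1 * cinner (x n) (x m)"
      using T(2) represents_one unfolding represents_def by (intro tendsto_intros) auto
    then show "(\<lambda>i. z * rs_sum i (\<lambda>t. ?\<phi> t * of_real (t ^ ?r)) ?m + 1 * rs_sum i (\<lambda>t. 1 * of_real (t ^ ?r)) ?m)
        \<longlonglongrightarrow> z * cinner (T (x n)) (x m) + cinner (x n) (x m)" by simp
  qed
  then have "cinner (T (x (n + N)) - z *\<^sub>C T (x n) - x n) (lincomb x p \<beta>) = 0" for p \<beta>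
    by (simp add: lincomb_def cinner_sum_right cinner_simps)
  then have "norm (T (x (n + N)) - z *\<^sub>C T (x n) - x n) \<le> 0"
    by (intro norm_le_of_dense_cinner[OF dense]) auto
  then show ?thesis by simp
qed

lemma resolvent_operator_inverse:
  assumes z: "Im z > 0" and T: "clin T" "\<And>u. norm (T u) \<le> K * norm u" "represents (\<lambda>t. 1 / (of_real t - z)) (\<lambda>n m. cinner (T (x n)) (x m))"
    and fg: "(f, g) \<in> B"
  shows "T (g - z *\<^sub>C f) = f"
proof -
  have cT: "continuous_on A T" for A
    unfolding continuous_on_def using clin_tendsto[OF T(1,2) tendsto_ident_at] by blast
  have cTf: "continuous_on UNIV (\<lambda>p::'h \<times> 'h. T (snd p - z *\<^sub>C fst p))"
    by (rule continuous_on_compose2[OF cT]) (auto intro!: continuous_intros)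
  have "T (snd (f, g) - z *\<^sub>C fst (f, g)) = fst (f, g)"
  proof (rule closed_relation_closure[where P="\<lambda>p. T (snd p - z *\<^sub>C fst p) = fst p" and G="comb_graph x (\<lambda>k. x (k + N))"])
    show "closed {p. T (snd p - z *\<^sub>C fst p) = fst p}"
      by (intro closed_Collect_eq cTf continuous_intros)
    show "(f, g) \<in> closure (comb_graph x (\<lambda>k. x (k + N)))" using fg by (simp add: shift_operator_eq)
    fix p :: "'h \<times> 'h" assume "p \<in> comb_graph x (\<lambda>k. x (k + N))"
    then obtain r \<alpha> where p: "p = (lincomb x r \<alpha>, lincomb (\<lambda>k. x (k + N)) r \<alpha>)" by (auto simp: comb_graph_def)
    have "snd p - z *\<^sub>C fst p = (\<Sum>k<r. \<alpha> k *\<^sub>C (x (k + N) - z *\<^sub>C x k))"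
      by (simp add: p lincomb_def scaleC_sum_right sum_subtractf scaleC_diff_right scaleC_scaleC mult.commute)
    also have "T \<dots> = (\<Sum>k<r. \<alpha> k *\<^sub>C x k)"
      by (simp add: clin_sum[OF T(1)] clin_scaleC[OF T(1)] clin_diff[OF T(1)] resolvent_operator_shift[OF z T(1,3)])
    finally show "T (snd p - z *\<^sub>C fst p) = fst p" by (simp add: p lincomb_def)
  qed
  then show ?thesis by simp
qed

text \<open>1 / (t - w) - 1 / (t - z) - (w - z) / (t - z)^2 = (w - z)^2 / ((t - w) (t - z)^2). So
  the derivative is the operator of 1 / (t - z)^2, and the right-hand side bounds the
  remainder.\<close>

lemma resolvent_operator_derivative:
  assumes R: "\<And>z. Im z > 0 \<Longrightarrow> clin (R z)" "\<And>z u. Im z > 0 \<Longrightarrow> norm (R z u) \<le> (1 / Im z) * norm u"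
    "\<And>z. Im z > 0 \<Longrightarrow> represents (\<lambda>t. 1 / (of_real t - z)) (\<lambda>n m. cinner (R z (x n)) (x m))"
    and z: "Im z > 0"
  shows "\<exists>G. has_op_derivative R G z"
proof -
  let ?\<phi> = "\<lambda>z t. 1 / (complex_of_real t - z)"
  note ker = cauchy_kernel_continuous(2,3)
  have "cmod ((?\<phi> z t)\<^sup>2) \<le> (1 / Im z)\<^sup>2" for t
    unfolding norm_power by (intro power_mono ker[OF z]) simp
  moreover have "isCont (\<lambda>t. (?\<phi> z t)\<^sup>2) t" for t by (intro isCont_power ker[OF z])
  ultimately obtain G where G: "clin G" "\<And>u. norm (G u) \<le> (1 / Im z)\<^sup>2 * norm u"
    "represents (\<lambda>t. (?\<phi> z t)\<^sup>2) (\<lambda>n m. cinner (G (x n)) (x m))"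
    using operator_exists[of "\<lambda>t. (?\<phi> z t)\<^sup>2" "(1 / Im z)\<^sup>2"] by blast
  have bound: "norm (R w u - R z u - (w - z) *\<^sub>C G u) \<le> (cmod (w - z))\<^sup>2 * (1 / Im w * (1 / Im z)\<^sup>2) * norm u"
    if w: "Im w > 0" for w u
  proof (rule represents_operator_bound[where T="\<lambda>u. R w u - R z u - (w - z) *\<^sub>C G u"
        and \<phi>="\<lambda>t. 1 * (1 * ?\<phi> w t + (- 1) * ?\<phi> z t) + (- (w - z)) * (?\<phi> z t)\<^sup>2"])
    show "isCont (\<lambda>t. 1 * (1 * ?\<phi> w t + (- 1) * ?\<phi> z t) + (- (w - z)) * (?\<phi> z t)\<^sup>2) t" for t
      by (intro continuous_intros ker[OF z] ker[OF w])
    show "cmod (1 * (1 * ?\<phi> w t + (- 1) * ?\<phi> z t) + (- (w - z)) * (?\<phi> z t)\<^sup>2) \<le> (cmod (w - z))\<^sup>2 * (1 / Im w * (1 / Im z)\<^sup>2)" for t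
    proof -
      have "complex_of_real t - z \<noteq> 0" "complex_of_real t - w \<noteq> 0" using z w by (auto simp: complex_eq_iff)
      then have "1 * (1 * ?\<phi> w t + (- 1) * ?\<phi> z t) + (- (w - z)) * (?\<phi> z t)\<^sup>2 = (w - z)\<^sup>2 * (?\<phi> w t * (?\<phi> z t)\<^sup>2)"
        by (simp add: divide_simps power2_eq_square) (simp add: algebra_simps)
      also have "cmod \<dots> \<le> (cmod (w - z))\<^sup>2 * (1 / Im w * (1 / Im z)\<^sup>2)"
        unfolding norm_mult norm_power
        by (intro mult_left_mono mult_mono power_mono ker(2)[OF z] ker(2)[OF w]) (use w in auto)
      finally show ?thesis .
    qed
    show "clin (\<lambda>u. R w u - R z u - (w - z) *\<^sub>C G u)"
      using R(1)[OF z] R(1)[OF w] G(1)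
      by (simp add: clin_def scaleC_add_right scaleC_diff_right scaleC_scaleC mult.commute)
    \<comment> \<open>A crude bound, enough for the operator to be identified by its kernel; the
      quadratic one comes from the bound on the function.\<close>
    show "norm (R w u - R z u - (w - z) *\<^sub>C G u) \<le> (1 / Im w + 1 / Im z + cmod (w - z) * (1 / Im z)\<^sup>2) * norm u" for u
    proof -
      have "norm (R w u - R z u - (w - z) *\<^sub>C G u) \<le> norm (R w u) + norm (R z u) + cmod (w - z) * norm (G u)"
        using norm_triangle_ineq4[of "R w u - R z u" "(w - z) *\<^sub>C G u"] norm_triangle_ineq4[of "R w u" "R z u"]
        by (simp add: norm_scaleC)
      also have "\<dots> \<le> 1 / Im w * norm u + 1 / Im z * norm u + cmod (w - z) * ((1 / Im z)\<^sup>2 * norm u)"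
        by (intro add_mono mult_left_mono R(2) G(2) w z) simp
      finally show ?thesis by (simp add: algebra_simps)
    qed
    show "represents (\<lambda>t. 1 * (1 * ?\<phi> w t + (- 1) * ?\<phi> z t) + (- (w - z)) * (?\<phi> z t)\<^sup>2)
       (\<lambda>n m. cinner (R w (x n) - R z (x n) - (w - z) *\<^sub>C G (x n)) (x m))"
      using represents_linear[OF represents_linear[OF R(3)[OF w] R(3)[OF z], of 1 "- 1"] G(3), of 1 "- (w - z)"]
      by (simp add: cinner_simps algebra_simps)
  qed
  have "has_op_derivative R G z"
    unfolding has_op_derivative_def
  proof (intro allI impI)
    fix e :: real assume e: "e > 0"
    \<comment> \<open>Within Im z / 2 of z one has Im w >= Im z / 2, so the remainder constant is at
      most 2 / (Im z)^3, which the second term compensates.\<close>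
    define d where "d = min (Im z / 2) (e * (Im z)^3 / 2)"
    have d: "d > 0" using e z by (simp add: d_def)
    have "norm (R w u - R z u - (w - z) *\<^sub>C G u) \<le> e * cmod (w - z) * norm u" if dw: "dist w z < d" for w u
    proof -
      have wz: "cmod (w - z) \<le> Im z / 2" "cmod (w - z) \<le> e * (Im z)^3 / 2"
        using dw by (auto simp: d_def dist_norm)
      have w2: "Im w \<ge> Im z / 2" using abs_Im_le_cmod[of "w - z"] wz(1) by simp
      then have w: "Im w > 0" using z by linarith
      have "cmod (w - z) * (1 / Im w * (1 / Im z)\<^sup>2) \<le> (e * (Im z)^3 / 2) * (1 / (Im z / 2) * (1 / Im z)\<^sup>2)"
        by (intro mult_mono mult_right_mono divide_left_mono wz w2) (use w z e in auto)
      also have "\<dots> = e" using z by (simp add: power2_eq_square power3_eq_cube)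
      finally have "cmod (w - z) * (cmod (w - z) * (1 / Im w * (1 / Im z)\<^sup>2)) * norm u \<le> cmod (w - z) * e * norm u"
        by (intro mult_right_mono mult_left_mono) auto
      then show ?thesis using bound[OF w, of u] by (simp add: power2_eq_square mult_ac)
    qed
    then show "\<forall>\<^sub>F w in at z. \<forall>u. norm (R w u - R z u - (w - z) *\<^sub>C G u) \<le> e * cmod (w - z) * norm u"
      unfolding eventually_at using d by blast
  qed
  then show ?thesis by blast
qed

lemma parameter_of_solution: "\<exists>F\<in>parameters N x. corresponds N x F M"
proof -
  let ?\<phi> = "\<lambda>z t. 1 / (complex_of_real t - z)"
  note ker = cauchy_kernel_continuous(2,3)
  have "\<forall>z. \<exists>T. Im z > 0 \<longrightarrow> clin T \<and> (\<forall>u. norm (T u) \<le> (1 / Im z) * norm u) \<and> represents (?\<phi> z) (\<lambda>n m. cinner (T (x n)) (x m))"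
  proof
    fix z show "\<exists>T. Im z > 0 \<longrightarrow> clin T \<and> (\<forall>u. norm (T u) \<le> (1 / Im z) * norm u) \<and> represents (?\<phi> z) (\<lambda>n m. cinner (T (x n)) (x m))"
      using operator_exists[OF ker] by (cases "Im z > 0") blast+
  qed
  from choice[OF this] obtain R where R: "\<And>z. Im z > 0 \<Longrightarrow> clin (R z)" "\<And>z u. Im z > 0 \<Longrightarrow> norm (R z u) \<le> (1 / Im z) * norm u"
    "\<And>z. Im z > 0 \<Longrightarrow> represents (?\<phi> z) (\<lambda>n m. cinner (R z (x n)) (x m))"
    by blast
  have U: "Im z > 0" if "z \<in> upper_half_plane" for z using that by (simp add: upper_half_plane_def)
  have "\<exists>F\<in>contractive_analytic (defect \<i> B) (defect (- \<i>) B).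
      \<forall>z\<in>upper_half_plane. resolvent (quasi_sa_ext B (F z)) z = {(u, R z u) | u. True}"
  proof (rule parameter_of_resolvent_family)
    fix z assume "z \<in> upper_half_plane"
    then have z: "Im z > 0" by (rule U)
    show "clin (R z)" by (rule R(1)[OF z])
    show "\<exists>G. has_op_derivative R G z" by (rule resolvent_operator_derivative[OF R z])
    show "R z (g - z *\<^sub>C f) = f" if "(f, g) \<in> B" for f g
      by (rule resolvent_operator_inverse[OF z R(1)[OF z] R(2)[OF z] R(3)[OF z] that])
    show "Im z * (norm (R z u))\<^sup>2 \<le> Im (cinner (R z u) u)" for u
    proof (rule dissipative_operator[OF R(1)[OF z] R(2)[OF z] R(3)[OF z] z])
      show "Im (?\<phi> z t) = Im z * (cmod (?\<phi> z t))\<^sup>2" for t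
        by (simp add: norm_divide power_divide cmod_power2 Im_divide)
    qed
  qed
  then obtain F where F: "F \<in> parameters N x"
    and res: "\<And>z. z \<in> upper_half_plane \<Longrightarrow> resolvent (quasi_sa_ext B (F z)) z = {(u, R z u) | u. True}"
    unfolding parameters_eq by blast
  have "has_stieltjes_integral (?\<phi> z) (\<lambda>t. M t $$ (k, j)) (cinner (R z (x k)) (x j))"
    if "z \<in> upper_half_plane" and kj: "k < N" "j < N" for z k j
  proof -
    have z: "Im z > 0" by (rule U) fact
    \<comment> \<open>The moment of order 0 supplies a decomposition into finite measures, against
      which the bounded kernel is integrable.\<close>
    have "has_stieltjes_integral (\<lambda>t. of_real (t ^ 0)) (\<lambda>t. M t $$ (k, j)) (S 0 $$ (k, j))"
      using sol kj unfolding hamburger_solution_def by blast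
    from has_stieltjes_integral_times_bounded[OF this ker[OF z]]
    obtain J where J: "has_stieltjes_integral (?\<phi> z) (\<lambda>t. M t $$ (k, j)) J"
      "(\<lambda>i. rs_sum i (?\<phi> z) (\<lambda>t. M t $$ (k, j))) \<longlonglongrightarrow> J" by auto
    have "(\<lambda>i. rs_sum i (?\<phi> z) (\<lambda>t. M t $$ (k, j))) \<longlonglongrightarrow> cinner (R z (x k)) (x j)"
      using R(3)[OF z, unfolded represents_def, rule_format, of k j] kj by simp
    from LIMSEQ_unique[OF this J(2)] J(1) show ?thesis by simp
  qed
  then have "corresponds N x F M" by (intro corresponds_iff[THEN iffD2, OF res]) blast+
  then show ?thesis using F by blast
qed

text \<open>For fixed \<alpha> the form of M is the distribution function of a finite measure whose
  transform is the form of \<open>b\<close>, so inversion applies. The left-hand side involves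
  \<open>b\<close> alone: the transforms determine the forms of M.\<close>

lemma solution_determined:
  assumes b: "\<And>z k j. z \<in> upper_half_plane \<Longrightarrow> k < N \<Longrightarrow> j < N \<Longrightarrow>
    has_stieltjes_integral (\<lambda>t. 1 / (of_real t - z)) (\<lambda>t. M t $$ (k, j)) (b z k j)"
  shows "(\<lambda>n. integral {- real (Suc n)..t - 1 / real (Suc n)} (\<lambda>s. Im (qform N (b (Complex s (1 / (real (Suc n))\<^sup>2))) \<alpha>)))
    \<longlonglongrightarrow> pi * Re (qform N (\<lambda>k j. M t $$ (k, j)) \<alpha>)"
proof -
  define g where "g t = Re (qform N (\<lambda>k j. M t $$ (k, j)) \<alpha>)" for t
  have car: "M t \<in> carrier_mat N N" and hermM: "hermitian_mat (M t)" for t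
    using sol by (simp_all add: hamburger_solution_def)
  have g: "qform N (\<lambda>k j. M t $$ (k, j)) \<alpha> = of_real (g t)" for t
  proof -
    have "cnj (qform N (\<lambda>k j. M t $$ (k, j)) \<alpha>) = qform N (\<lambda>k j. M t $$ (k, j)) \<alpha>"
      unfolding cnj_qform unfolding qform_def
      by (intro sum.cong refl) (simp add: hermitian_mat_index[OF car hermM, symmetric])
    then show ?thesis by (simp add: g_def complex_eq_iff)
  qed
  have mono: "mono g"
  proof (rule monoI)
    fix s t :: real assume "s \<le> t"
    then have "psd_mat N (M t - M s)" using sol by (simp add: hamburger_solution_def)
    from psd_mat_sum_nonneg[OF this, of \<alpha>] have "0 \<le> Re (qform N (\<lambda>k j. (M t - M s) $$ (k, j)) \<alpha>)"
      by (simp add: qform_def less_eq_complex_def)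
    also have "qform N (\<lambda>k j. (M t - M s) $$ (k, j)) \<alpha> = qform N (\<lambda>k j. M t $$ (k, j)) \<alpha> - qform N (\<lambda>k j. M s $$ (k, j)) \<alpha>"
      unfolding qform_def sum_subtractf[symmetric]
      using car[of s] car[of t] by (intro sum.cong refl) (simp add: right_diff_distrib)
    finally show "g s \<le> g t" by (simp add: g_def)
  qed
  have cont: "continuous (at_left t) g" for t
    unfolding g_def continuous_within
    by (intro tendsto_Re tendsto_qform) (use sol in \<open>simp add: hamburger_solution_def continuous_within\<close>)
  have "(g \<longlongrightarrow> Re (qform N (\<lambda>k j. 0) \<alpha>)) at_bot"
    unfolding g_def by (intro tendsto_Re tendsto_qform) (use sol in \<open>simp add: hamburger_solution_def\<close>)
  then have lim: "(g \<longlongrightarrow> 0) at_bot" by (simp add: qform_def)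
  have rs: "(\<lambda>i. rs_sum i f (\<lambda>t. of_real (g t))) \<longlonglongrightarrow> qform N L \<alpha>"
    if "\<And>k j. k < N \<Longrightarrow> j < N \<Longrightarrow> (\<lambda>i. rs_sum i f (\<lambda>t. M t $$ (k, j))) \<longlonglongrightarrow> L k j" for f L
    unfolding g[symmetric] rs_sum_qform by (rule tendsto_qform) (rule that)
  have "(\<lambda>i. rs_sum i (\<lambda>_. 1) (\<lambda>t. M t $$ (k, j))) \<longlonglongrightarrow> cinner (x k) (x j)" if "k < N" "j < N" for k j
    using represents_one[unfolded represents_def, rule_format, of k j] that by simp
  from rs[OF this] have "(\<lambda>i. rs_sum i (\<lambda>_. 1) (\<lambda>t. of_real (g t))) \<longlonglongrightarrow> qform N (\<lambda>k j. cinner (x k) (x j)) \<alpha>" .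
  \<comment> \<open>The sums of the constant 1 are the values g(n) - g(-n); being convergent they
    are bounded, and monotonicity then bounds g from above.\<close>
  from convergent_imp_Bseq[OF convergentI[OF this]] obtain C where C: "\<And>i. cmod (rs_sum i (\<lambda>_. 1) (\<lambda>t. of_real (g t))) \<le> C"
    by (auto simp: Bseq_def)
  have bdd: "g (real n) \<le> C + g 0" for n
  proof -
    have "g (real n) \<le> g (real (Suc n))" "g (- real (Suc n)) \<le> g 0" by (intro monoD[OF mono]; simp)+
    moreover have "g (real (Suc n)) - g (- real (Suc n)) \<le> C"
      using C[of n] unfolding rs_sum_const of_real_diff[symmetric] norm_of_real by linarith
    ultimately show ?thesis by linarith
  qed
  note fin = finite_borel_measure_stieltjes[OF mono cont lim bdd]
  interpret \<mu>: finite_borel_measure "stieltjes_measure g" by (rule fin)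
  have tr: "(LINT t|stieltjes_measure g. 1 / (complex_of_real t - z)) = qform N (b z) \<alpha>" if zU: "z \<in> upper_half_plane" for z
  proof (rule LIMSEQ_unique)
    have z: "Im z > 0" using zU by (simp add: upper_half_plane_def)
    show "(\<lambda>i. rs_sum i (\<lambda>t. 1 / (complex_of_real t - z)) (\<lambda>t. of_real (g t))) \<longlonglongrightarrow> qform N (b z) \<alpha>"
      by (rule rs) (rule transform_imp_rs[OF b[OF zU] z])
    show "(\<lambda>i. rs_sum i (\<lambda>t. 1 / (complex_of_real t - z)) (\<lambda>t. of_real (g t)))
        \<longlonglongrightarrow> (LINT t|stieltjes_measure g. 1 / (complex_of_real t - z))"
    proof (rule rs_sum_tendsto_stieltjes_measure[OF mono cont cauchy_kernel_continuous(2)[OF z]])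
      show "integrable (stieltjes_measure g) (\<lambda>t. (1 + 1 / Im z) * cmod (1 / (complex_of_real t - z)))"
        by (intro integrable_mult_right integrable_norm \<mu>.integrable_cauchy_kernel[OF z])
    qed (rule cauchy_kernel_domination[OF z])
  qed
  have "Complex s (1 / (real (Suc n))\<^sup>2) \<in> upper_half_plane" for s n by (simp add: upper_half_plane_def)
  then show ?thesis using \<mu>.stieltjes_inversion[of t] unfolding tr fin(2) by (simp only: tr g_def)
qed

end

section \<open>Uniqueness\<close>

context hamburger_data
begin

lemma solution_unique:
  assumes M: "hamburger_solution N S M" "corresponds N x F M"
    and M': "hamburger_solution N S M'" "corresponds N x F M'" and F: "F \<in> parameters N x"
  shows "M = M'"
proof
  fix t
  obtain T R where "\<And>z. z \<in> upper_half_plane \<Longrightarrow> resolvent (quasi_sa_ext B (F z)) z = {(u, R z u) | u. True}"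
    using resolvent_family[OF F[unfolded parameters_eq]] by blast
  note iff = corresponds_iff[OF this]
  define b where "b z k j = cinner (R z (x k)) (x j)" for z k j
  interpret M: hamburger_solution_data N S x M by unfold_locales (rule M(1))
  interpret M': hamburger_solution_data N S x M' by unfold_locales (rule M'(1))
  have eq: "Re (qform N (\<lambda>k j. M t $$ (k, j)) \<alpha>) = Re (qform N (\<lambda>k j. M' t $$ (k, j)) \<alpha>)" for \<alpha>
  proof -
    have "pi * Re (qform N (\<lambda>k j. M t $$ (k, j)) \<alpha>) = pi * Re (qform N (\<lambda>k j. M' t $$ (k, j)) \<alpha>)"
    proof (rule LIMSEQ_unique[OF M.solution_determined[where b=b] M'.solution_determined[where b=b]])
    qed (use iff M(2) M'(2) in \<open>auto simp: b_def\<close>)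
    then show ?thesis by simp
  qed
  \<comment> \<open>A Hermitian matrix is recovered from the real part of its quadratic form by
    polarization.\<close>
  have entry: "M t $$ (k, j) = polar_entry (\<lambda>\<alpha>. Re (qform N (\<lambda>k j. M t $$ (k, j)) \<alpha>)) k j"
    if M: "hamburger_solution N S M" and kj: "k < N" "j < N" for M k j
  proof -
    have "polar_entry (\<lambda>\<alpha>. Re (qform N (\<lambda>k j. M t $$ (k, j)) \<alpha>)) k j = (M t $$ (k, j) + cnj (M t $$ (j, k))) / 2"
      by (rule polar_entry_Re_qform[OF kj refl])
    also have "cnj (M t $$ (j, k)) = M t $$ (k, j)"
      using M kj hermitian_mat_index[of "M t" N j k] by (simp add: hamburger_solution_def)
    finally show ?thesis by simp
  qed
  have car: "M t \<in> carrier_mat N N" "M' t \<in> carrier_mat N N"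
    using M(1) M'(1) by (simp_all add: hamburger_solution_def)
  show "M t = M' t"
  proof (rule eq_matI)
    fix k j assume "k < dim_row (M' t)" "j < dim_col (M' t)"
    then have "k < N" "j < N" using car by auto
    then show "M t $$ (k, j) = M' t $$ (k, j)" using entry[OF M(1)] entry[OF M'(1)] by (simp add: eq)
  qed (use car in auto)
qed

text \<open>Both resolvent entries are integrals of the same kernel against the same entry of M.
  They may come from different Jordan decompositions, yet both are limits of the same
  Riemann-Stieltjes sums.\<close>

lemma parameter_determined:
  assumes F: "F \<in> parameters N x" "corresponds N x F M" and F': "F' \<in> parameters N x" "corresponds N x F' M"
  shows "F = F'"
proof (rule parameter_unique[OF F(1)[unfolded parameters_eq] F'(1)[unfolded parameters_eq]])
  fix z assume z: "z \<in> upper_half_plane"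
  obtain T R where T: "\<And>z. z \<in> upper_half_plane \<Longrightarrow> extends_cayley (T z)" "\<And>z. z \<in> upper_half_plane \<Longrightarrow> cayley_pair z (T z) (R z)"
    and R: "\<And>z. z \<in> upper_half_plane \<Longrightarrow> resolvent (quasi_sa_ext B (F z)) z = {(u, R z u) | u. True}"
    using resolvent_family[OF F(1)[unfolded parameters_eq]] by blast
  obtain T' R' where T': "\<And>z. z \<in> upper_half_plane \<Longrightarrow> extends_cayley (T' z)" "\<And>z. z \<in> upper_half_plane \<Longrightarrow> cayley_pair z (T' z) (R' z)"
    and R': "\<And>z. z \<in> upper_half_plane \<Longrightarrow> resolvent (quasi_sa_ext B (F' z)) z = {(u, R' z u) | u. True}"
    using resolvent_family[OF F'(1)[unfolded parameters_eq]] by blast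
  have "R z = R' z"
  proof (rule resolvent_eqI[OF T(1)[OF z] T(2)[OF z] T'(1)[OF z] T'(2)[OF z] z])
    fix k j assume kj: "k < N" "j < N"
    have y: "Im z > 0" using z by (simp add: upper_half_plane_def)
    have "has_stieltjes_integral (\<lambda>t. 1 / (of_real t - z)) (\<lambda>t. M t $$ (k, j)) (cinner (R z (x k)) (x j))"
      using corresponds_iff[THEN iffD1, OF R F(2)] z kj by blast
    note 1 = transform_imp_rs[OF this y]
    have "has_stieltjes_integral (\<lambda>t. 1 / (of_real t - z)) (\<lambda>t. M t $$ (k, j)) (cinner (R' z (x k)) (x j))"
      using corresponds_iff[THEN iffD1, OF R' F'(2)] z kj by blast
    note 2 = transform_imp_rs[OF this y]
    show "cinner (R z (x k)) (x j) = cinner (R' z (x k)) (x j)" by (rule LIMSEQ_unique[OF 1 2])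
  qed
  then show "resolvent (quasi_sa_ext B (F z)) z = resolvent (quasi_sa_ext B (F' z)) z"
    by (simp add: R[OF z] R'[OF z])
qed

end

section \<open>The one-to-one correspondence of parameters and solutions\<close>

theorem theorem4:
  fixes N :: nat
    and S :: "nat \<Rightarrow> complex mat"
    and x :: "nat \<Rightarrow> 'h::complex_hilbert"
  assumes "N \<ge> 1"
    and "\<And>n. S n \<in> carrier_mat N N"
    and "\<And>n. hermitian_mat (S n)"
    and "\<And>n. psd_mat ((n + 1) * N) (block_hankel N S n)"
    and "\<And>n m. cinner (x n) (x m) = hankel_entry N S n m"
    and "closure (Modules.module.span scaleC (range x)) = UNIV"
  shows
    "(\<forall>M. hamburger_solution N S M \<longrightarrow> (\<exists>F\<in>parameters N x. corresponds N x F M)) \<and>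
     (\<forall>F\<in>parameters N x. \<exists>M. hamburger_solution N S M \<and> corresponds N x F M) \<and>
     (\<forall>F\<in>parameters N x. \<forall>F'\<in>parameters N x. \<forall>M M'.
        hamburger_solution N S M \<and> hamburger_solution N S M' \<and>
        corresponds N x F M \<and> corresponds N x F' M' \<longrightarrow> (F = F' \<longleftrightarrow> M = M'))"
proof -
  interpret hamburger_data N S x by unfold_locales (fact assms)+
  show ?thesis
  proof (intro conjI allI ballI impI)
    fix M assume "hamburger_solution N S M"
    then interpret hamburger_solution_data N S x M by unfold_locales
    show "\<exists>F\<in>parameters N x. corresponds N x F M" by (rule parameter_of_solution)
  next
    fix F assume "F \<in> parameters N x"
    then show "\<exists>M. hamburger_solution N S M \<and> corresponds N x F M" by (rule solution_of_parameter)
  next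
    fix F F' M M'
    assume "F \<in> parameters N x" "F' \<in> parameters N x"
      and "hamburger_solution N S M \<and> hamburger_solution N S M' \<and> corresponds N x F M \<and> corresponds N x F' M'"
    then show "F = F' \<longleftrightarrow> M = M'"
      using solution_unique[of M F M'] parameter_determined[of F M F'] by auto
  qed
qed

end
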